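(* Let $B$ be a $D_k$-finitely generated $D_k$-Hopf algebra over a differential field $(k,D_k)$ with $\operatorname{char}k=0$. Then $B$ is of $D_k$-finite presentation over $k$.
   Context: All rings (and Hopf algebras, as algebras) are commutative with unit. A differential field $(k,D_k)$ is a field $k$ with a finite-dimensional $k$-vector space $D_k$ carrying a Lie bracket (making it a Lie ring) and a $k$-linear Lie ring homomorphism $\theta_k:D_k\to\mathrm{Der}(k,k)$ (not necessarily injective) with $[\partial_1,a\partial_2]-a[\partial_1,\partial_2]=\theta_k(\partial_1)(a)\partial_2$. A $D_k$-algebra is a $k$-algebra $S$ with a $k$-linear Lie ring homomorphism $D_k\to\mathrm{Der}(S,S)$ compatible with the action of $D_k$ on $k$; tensor products over $k$ are $D_k$-algebras by the Leibniz rule. A $D_k$-Hopf algebra is a Hopf algebra $B$ over $k$ that is a $D_k$-algebra and whose coproduct, counit and antipode are morphisms of $D_k$-algebras. $B$ is $D_k$-finitely generated over $k$ if there is a finite set $\Sigma\subset B$ such that every element of $B$ is a polynomial over $k$ in elements $(\partial_1\cdots\partial_n)a$ with $\partial_i\in D_k$, $a\in\Sigma$. $k\{T_1,\dots,T_n\}$ denotes the free $D_k$-algebra over $k$ on $T_1,\dots,T_n$ (ring of $D_k$-polynomials). $B$ is of $D_k$-finite presentation over $k$ if there is an isomorphism of $D_k$-algebras $B\cong k\{T_1,\dots,T_n\}/I$ where the ideal $I$ is $D_k$-finitely generated, i.e. generated as a $D_k$-stable ideal by finitely many elements. *)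

theory Defs
  imports Complex_Main "HOL-Algebra.Module" "HOL-Algebra.QuotRing" "HOL-Algebra.Generated_Rings"
begin

text \<open>
  The given field, Lie ring and Hopf algebra live on types; the rings constructed from them
  (tensor products, differential polynomials, quotients) are quotients depending on these data, so
  algebras are records over the library's \<open>module\<close> record, extended by the action of the Lie ring.
\<close>

record ('k, 'd, 'a) dalg = "('k, 'a) module" +
  der :: "'d \<Rightarrow> 'a \<Rightarrow> 'a"

definition dalg_of_type ::
    "('k \<Rightarrow> 'a \<Rightarrow> 'a) \<Rightarrow> ('d \<Rightarrow> 'a \<Rightarrow> 'a) \<Rightarrow> ('k, 'd, 'a::comm_ring_1) dalg" where
  "dalg_of_type sc dr =
    \<lparr>carrier = UNIV, mult = (*), one = 1, zero = 0, add = (+), smult = sc, der = dr\<rparr>"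

definition derivation :: "('a, 'm) ring_scheme \<Rightarrow> ('a \<Rightarrow> 'a) \<Rightarrow> bool" where
  "derivation R f \<longleftrightarrow> f \<in> carrier R \<rightarrow> carrier R \<and>
    (\<forall>a\<in>carrier R. \<forall>b\<in>carrier R. f (a \<oplus>\<^bsub>R\<^esub> b) = f a \<oplus>\<^bsub>R\<^esub> f b) \<and>
    (\<forall>a\<in>carrier R. \<forall>b\<in>carrier R.
       f (a \<otimes>\<^bsub>R\<^esub> b) = (f a \<otimes>\<^bsub>R\<^esub> b) \<oplus>\<^bsub>R\<^esub> (a \<otimes>\<^bsub>R\<^esub> f b))"

definition lie_action ::
    "('k \<Rightarrow> 'd \<Rightarrow> 'd) \<Rightarrow> ('d \<Rightarrow> 'd \<Rightarrow> 'd) \<Rightarrow> ('k, 'd::ab_group_add, 'a) dalg \<Rightarrow> bool" where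
  "lie_action scD br S \<longleftrightarrow>
    (\<forall>x. derivation S (der S x)) \<and>
    (\<forall>x y. \<forall>a\<in>carrier S. der S (x + y) a = der S x a \<oplus>\<^bsub>S\<^esub> der S y a) \<and>
    (\<forall>c x. \<forall>a\<in>carrier S. der S (scD c x) a = c \<odot>\<^bsub>S\<^esub> der S x a) \<and>
    (\<forall>x y. \<forall>a\<in>carrier S.
       der S (br x y) a = der S x (der S y a) \<ominus>\<^bsub>S\<^esub> der S y (der S x a))"


section \<open>Differential fields and algebras over them\<close>

locale differential_field =
  fixes scD :: "'k::field \<Rightarrow> 'd::ab_group_add \<Rightarrow> 'd"
    and br :: "'d \<Rightarrow> 'd \<Rightarrow> 'd"
    and \<theta> :: "'d \<Rightarrow> 'k \<Rightarrow> 'k"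
  assumes finite_dim: "\<exists>Basis. finite_dimensional_vector_space scD Basis"
    and br_add_left: "br (x + y) z = br x z + br y z"
    and br_add_right: "br x (y + z) = br x y + br x z"
    and br_self: "br x x = 0"
    and jacobi: "br x (br y z) + br y (br z x) + br z (br x y) = 0"
    and \<theta>_action: "lie_action scD br (dalg_of_type (*) \<theta>)"
    and br_scale_right: "br x (scD a y) - scD a (br x y) = scD (\<theta> x a) y"
begin

definition K :: "('k, 'd, 'k) dalg" where
  "K = dalg_of_type (*) \<theta>"

definition D_algebra :: "('k, 'd, 'a) dalg \<Rightarrow> bool" where
  "D_algebra S \<longleftrightarrow> algebra K S \<and> lie_action scD br S \<and>
    (\<forall>x c. der S x (c \<odot>\<^bsub>S\<^esub> \<one>\<^bsub>S\<^esub>) = \<theta> x c \<odot>\<^bsub>S\<^esub> \<one>\<^bsub>S\<^esub>)"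

end

definition D_hom :: "('k, 'd, 'a) dalg \<Rightarrow> ('k, 'd, 'b) dalg \<Rightarrow> ('a \<Rightarrow> 'b) set" where
  "D_hom S T = {f \<in> ring_hom S T.
     (\<forall>c. \<forall>a\<in>carrier S. f (c \<odot>\<^bsub>S\<^esub> a) = c \<odot>\<^bsub>T\<^esub> f a) \<and>
     (\<forall>x. \<forall>a\<in>carrier S. f (der S x a) = der T x (f a))}"

definition D_iso :: "('k, 'd, 'a) dalg \<Rightarrow> ('k, 'd, 'b) dalg \<Rightarrow> ('a \<Rightarrow> 'b) set" where
  "D_iso S T = {f \<in> D_hom S T. bij_betw f (carrier S) (carrier T)}"


section \<open>Tensor products\<close>

text \<open>
  A list of pairs stands for the formal sum of the tensors \<open>a \<otimes> b\<close>; these are taken modulo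
  commutativity and bilinearity. The rule for zero is not redundant: formal sums have no negatives.
\<close>

inductive_set tensor_rel ::
    "('k, 'd, 'a) dalg \<Rightarrow> ('k, 'd, 'b) dalg \<Rightarrow> (('a \<times> 'b) list \<times> ('a \<times> 'b) list) set"
  for S :: "('k, 'd, 'a) dalg" and T :: "('k, 'd, 'b) dalg" where
  refl: "u \<in> lists (carrier S \<times> carrier T) \<Longrightarrow> (u, u) \<in> tensor_rel S T"
| sym: "(u, v) \<in> tensor_rel S T \<Longrightarrow> (v, u) \<in> tensor_rel S T"
| trans: "\<lbrakk>(u, v) \<in> tensor_rel S T; (v, w) \<in> tensor_rel S T\<rbrakk> \<Longrightarrow> (u, w) \<in> tensor_rel S T"
| append: "\<lbrakk>(u, u') \<in> tensor_rel S T; (v, v') \<in> tensor_rel S T\<rbrakk>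
    \<Longrightarrow> (u @ v, u' @ v') \<in> tensor_rel S T"
| commute: "\<lbrakk>u \<in> lists (carrier S \<times> carrier T); v \<in> lists (carrier S \<times> carrier T)\<rbrakk>
    \<Longrightarrow> (u @ v, v @ u) \<in> tensor_rel S T"
| add_left: "\<lbrakk>a \<in> carrier S; a' \<in> carrier S; b \<in> carrier T\<rbrakk>
    \<Longrightarrow> ([(a \<oplus>\<^bsub>S\<^esub> a', b)], [(a, b), (a', b)]) \<in> tensor_rel S T"
| add_right: "\<lbrakk>a \<in> carrier S; b \<in> carrier T; b' \<in> carrier T\<rbrakk>
    \<Longrightarrow> ([(a, b \<oplus>\<^bsub>T\<^esub> b')], [(a, b), (a, b')]) \<in> tensor_rel S T"
| zero: "b \<in> carrier T \<Longrightarrow> ([(\<zero>\<^bsub>S\<^esub>, b)], []) \<in> tensor_rel S T"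
| balanced: "\<lbrakk>a \<in> carrier S; b \<in> carrier T\<rbrakk>
    \<Longrightarrow> ([(c \<odot>\<^bsub>S\<^esub> a, b)], [(a, c \<odot>\<^bsub>T\<^esub> b)]) \<in> tensor_rel S T"

definition tensor ::
    "('k, 'd, 'a) dalg \<Rightarrow> ('k, 'd, 'b) dalg \<Rightarrow> ('k, 'd, ('a \<times> 'b) list set) dalg" where
  "tensor S T =
    \<lparr>carrier = lists (carrier S \<times> carrier T) // tensor_rel S T,
     mult = (\<lambda>U V. \<Union>u\<in>U. \<Union>v\<in>V.
       tensor_rel S T `` {[(a \<otimes>\<^bsub>S\<^esub> a', b \<otimes>\<^bsub>T\<^esub> b'). (a, b) \<leftarrow> u, (a', b') \<leftarrow> v]}),
     one = tensor_rel S T `` {[(\<one>\<^bsub>S\<^esub>, \<one>\<^bsub>T\<^esub>)]},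
     zero = tensor_rel S T `` {[]},
     add = (\<lambda>U V. \<Union>u\<in>U. \<Union>v\<in>V. tensor_rel S T `` {u @ v}),
     smult = (\<lambda>c U. \<Union>u\<in>U. tensor_rel S T `` {[(c \<odot>\<^bsub>S\<^esub> a, b). (a, b) \<leftarrow> u]}),
     der = (\<lambda>x U. \<Union>u\<in>U. tensor_rel S T ``
       {[(der S x a, b). (a, b) \<leftarrow> u] @ [(a, der T x b). (a, b) \<leftarrow> u]})\<rparr>"

definition pure_tensor ::
    "('k, 'd, 'a) dalg \<Rightarrow> ('k, 'd, 'b) dalg \<Rightarrow> 'a \<Rightarrow> 'b \<Rightarrow> ('a \<times> 'b) list set" where
  "pure_tensor S T a b = tensor_rel S T `` {[(a, b)]}"

text \<open>
  The map on \<open>S \<otimes> T\<close> induced by a bilinear map \<open>f\<close> into \<open>M\<close>. For bilinear \<open>f\<close> the image below is a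
  singleton.
\<close>

definition tensor_lift ::
    "('a, 'm) ring_scheme \<Rightarrow> ('b \<Rightarrow> 'c \<Rightarrow> 'a) \<Rightarrow> ('b \<times> 'c) list set \<Rightarrow> 'a" where
  "tensor_lift M f U =
    the_elem ((\<lambda>u. foldr (\<lambda>(b, c) m. f b c \<oplus>\<^bsub>M\<^esub> m) u \<zero>\<^bsub>M\<^esub>) ` U)"

definition tensor_map ::
    "('k, 'd, 'a) dalg \<Rightarrow> ('k, 'd, 'b) dalg \<Rightarrow> ('c \<Rightarrow> 'a) \<Rightarrow> ('e \<Rightarrow> 'b)
      \<Rightarrow> ('c \<times> 'e) list set \<Rightarrow> ('a \<times> 'b) list set" where
  "tensor_map S' T' f g =
    tensor_lift (tensor S' T') (\<lambda>a b. pure_tensor S' T' (f a) (g b))"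

definition tensor_assoc ::
    "('k, 'd, 'a) dalg \<Rightarrow> ('k, 'd, 'b) dalg \<Rightarrow> ('k, 'd, 'c) dalg
      \<Rightarrow> ('a \<times> ('b \<times> 'c) list set) list set \<Rightarrow> (('a \<times> 'b) list set \<times> 'c) list set" where
  "tensor_assoc S T U =
    (let M = tensor (tensor S T) U
     in tensor_lift M (\<lambda>a. tensor_lift M
          (\<lambda>b c. pure_tensor (tensor S T) U (pure_tensor S T a b) c)))"


section \<open>Differential Hopf algebras\<close>

locale D_Hopf_algebra = differential_field scD br \<theta>
  for scD :: "'k::field \<Rightarrow> 'd::ab_group_add \<Rightarrow> 'd" and br \<theta> +
  fixes B :: "('k, 'd, 'b) dalg"
    and \<Delta> :: "'b \<Rightarrow> ('b \<times> 'b) list set"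
    and \<epsilon> :: "'b \<Rightarrow> 'k"
    and antipode :: "'b \<Rightarrow> 'b"
  assumes D_algebra_B: "D_algebra B"
    and comult_hom: "\<Delta> \<in> D_hom B (tensor B B)"
    and counit_hom: "\<epsilon> \<in> D_hom B K"
    and antipode_hom: "antipode \<in> D_hom B B"
    and coassoc: "b \<in> carrier B \<Longrightarrow>
      tensor_map (tensor B B) B \<Delta> (\<lambda>a. a) (\<Delta> b) =
      tensor_assoc B B B (tensor_map B (tensor B B) (\<lambda>a. a) \<Delta> (\<Delta> b))"
    and counit_left: "b \<in> carrier B \<Longrightarrow>
      tensor_lift B (\<lambda>c a. c \<odot>\<^bsub>B\<^esub> a) (tensor_map K B \<epsilon> (\<lambda>a. a) (\<Delta> b)) = b"
    and counit_right: "b \<in> carrier B \<Longrightarrow>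
      tensor_lift B (\<lambda>a c. c \<odot>\<^bsub>B\<^esub> a) (tensor_map B K (\<lambda>a. a) \<epsilon> (\<Delta> b)) = b"
    and antipode_left: "b \<in> carrier B \<Longrightarrow>
      tensor_lift B (mult B) (tensor_map B B antipode (\<lambda>a. a) (\<Delta> b)) = \<epsilon> b \<odot>\<^bsub>B\<^esub> \<one>\<^bsub>B\<^esub>"
    and antipode_right: "b \<in> carrier B \<Longrightarrow>
      tensor_lift B (mult B) (tensor_map B B (\<lambda>a. a) antipode (\<Delta> b)) = \<epsilon> b \<odot>\<^bsub>B\<^esub> \<one>\<^bsub>B\<^esub>"

text \<open>
  The polynomials over the base field in the elements of a set form the subring generated by this set
  and the scalars.
\<close>

definition D_finitely_generated :: "('k, 'd, 'a) dalg \<Rightarrow> bool" where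
  "D_finitely_generated S \<longleftrightarrow> (\<exists>\<Sigma>. finite \<Sigma> \<and> \<Sigma> \<subseteq> carrier S \<and>
     carrier S = generate_ring S
       ({c \<odot>\<^bsub>S\<^esub> \<one>\<^bsub>S\<^esub> | c. True} \<union> {foldr (der S) xs a | xs a. a \<in> \<Sigma>}))"


section \<open>Differential ideals and quotients\<close>

definition D_ideal :: "'a set \<Rightarrow> ('k, 'd, 'a) dalg \<Rightarrow> bool" where
  "D_ideal I S \<longleftrightarrow> ideal I S \<and> (\<forall>x. \<forall>a\<in>I. der S x a \<in> I)"

definition D_genideal :: "('k, 'd, 'a) dalg \<Rightarrow> 'a set \<Rightarrow> 'a set" where
  "D_genideal S G = \<Inter>{I. D_ideal I S \<and> G \<subseteq> I}"

definition D_quot :: "('k, 'd, 'a) dalg \<Rightarrow> 'a set \<Rightarrow> ('k, 'd, 'a set) dalg" where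
  "D_quot S I =
    \<lparr>carrier = carrier (S Quot I), mult = mult (S Quot I), one = one (S Quot I),
     zero = zero (S Quot I), add = add (S Quot I),
     smult = (\<lambda>c A. \<Union>a\<in>A. I +>\<^bsub>S\<^esub> (c \<odot>\<^bsub>S\<^esub> a)),
     der = (\<lambda>x A. \<Union>a\<in>A. I +>\<^bsub>S\<^esub> der S x a)\<rparr>"


section \<open>Differential polynomials and finite presentation\<close>

text \<open>
  The axioms of algebras over a differential field are equational, so the free algebra consists of
  the terms in the variables modulo the congruence generated by all instances of the axioms.
\<close>

datatype (vars: 'v, 'k, 'd) dterm =
  Var 'v
| Const 'k
| Plus "('v, 'k, 'd) dterm" "('v, 'k, 'd) dterm"
| Times "('v, 'k, 'd) dterm" "('v, 'k, 'd) dterm"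
| Der 'd "('v, 'k, 'd) dterm"

context differential_field
begin

inductive dterm_eq :: "('v, 'k, 'd) dterm \<Rightarrow> ('v, 'k, 'd) dterm \<Rightarrow> bool" (infix \<open>\<approx>\<close> 50) where
  refl: "s \<approx> s"
| sym: "s \<approx> t \<Longrightarrow> t \<approx> s"
| trans: "\<lbrakk>s \<approx> t; t \<approx> u\<rbrakk> \<Longrightarrow> s \<approx> u"
| cong_Plus: "\<lbrakk>s \<approx> s'; t \<approx> t'\<rbrakk> \<Longrightarrow> Plus s t \<approx> Plus s' t'"
| cong_Times: "\<lbrakk>s \<approx> s'; t \<approx> t'\<rbrakk> \<Longrightarrow> Times s t \<approx> Times s' t'"
| cong_Der: "s \<approx> s' \<Longrightarrow> Der x s \<approx> Der x s'"
| Plus_assoc: "Plus (Plus s t) u \<approx> Plus s (Plus t u)"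
| Plus_commute: "Plus s t \<approx> Plus t s"
| Plus_zero: "Plus (Const 0) s \<approx> s"
| Plus_minus: "Plus (Times (Const (- 1)) s) s \<approx> Const 0"
| Times_assoc: "Times (Times s t) u \<approx> Times s (Times t u)"
| Times_commute: "Times s t \<approx> Times t s"
| Times_one: "Times (Const 1) s \<approx> s"
| distrib: "Times (Plus s t) u \<approx> Plus (Times s u) (Times t u)"
| Const_plus: "Const (a + b) \<approx> Plus (Const a) (Const b)"
| Const_times: "Const (a * b) \<approx> Times (Const a) (Const b)"
| Der_Plus: "Der x (Plus s t) \<approx> Plus (Der x s) (Der x t)"
| Der_Times: "Der x (Times s t) \<approx> Plus (Times (Der x s) t) (Times s (Der x t))"
| Der_Const: "Der x (Const a) \<approx> Const (\<theta> x a)"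
| Der_add: "Der (x + y) s \<approx> Plus (Der x s) (Der y s)"
| Der_scale: "Der (scD a x) s \<approx> Times (Const a) (Der x s)"
| Der_bracket: "Der (br x y) s \<approx> Plus (Der x (Der y s)) (Times (Const (- 1)) (Der y (Der x s)))"

definition dterms :: "'v set \<Rightarrow> ('v, 'k, 'd) dterm set" where
  "dterms V = {t. vars t \<subseteq> V}"

definition dterm_rel :: "'v set \<Rightarrow> (('v, 'k, 'd) dterm \<times> ('v, 'k, 'd) dterm) set" where
  "dterm_rel V = {(s, t). s \<in> dterms V \<and> t \<in> dterms V \<and> s \<approx> t}"

definition free_D_algebra :: "'v set \<Rightarrow> ('k, 'd, ('v, 'k, 'd) dterm set) dalg" where
  "free_D_algebra V =
    \<lparr>carrier = dterms V // dterm_rel V,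
     mult = (\<lambda>X Y. \<Union>s\<in>X. \<Union>t\<in>Y. dterm_rel V `` {Times s t}),
     one = dterm_rel V `` {Const 1},
     zero = dterm_rel V `` {Const 0},
     add = (\<lambda>X Y. \<Union>s\<in>X. \<Union>t\<in>Y. dterm_rel V `` {Plus s t}),
     smult = (\<lambda>c X. \<Union>s\<in>X. dterm_rel V `` {Times (Const c) s}),
     der = (\<lambda>x X. \<Union>s\<in>X. dterm_rel V `` {Der x s})\<rparr>"

definition D_finitely_presented :: "('k, 'd, 'a) dalg \<Rightarrow> bool" where
  "D_finitely_presented S \<longleftrightarrow> (\<exists>(n::nat) G.
     let F = free_D_algebra {..<n}
     in finite G \<and> G \<subseteq> carrier F \<and> D_iso S (D_quot F (D_genideal F G)) \<noteq> {})"

end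

end

theory Submission
  imports Defs "HOL-Library.Multiset_Order"
begin

text \<open>
  Choose a finite-dimensional comodule whose matrix coefficients \<open>X\<close> generate \<open>B\<close> differentially, and
  let \<open>A\<^sub>0\<close> be the algebra generated by the entries of \<open>X\<close> and \<open>X\<^sup>-\<^sup>1\<close>. Over \<open>A\<^sub>0\<close>, the algebra \<open>B\<close> is
  generated by the derivatives \<open>z\<close> of the entries of the logarithmic derivatives \<open>X\<^sup>-\<^sup>1 \<partial>X\<close>. The elements
  of order at most \<open>m\<close> form Hopf subalgebras \<open>A\<^sub>m\<close>, and a \<open>z\<close> of order \<open>m + 1\<close> satisfies
  \<open>\<Delta> z \<in> 1 \<otimes> z + B \<otimes> A\<^sub>m\<close>. In characteristic 0 this implies that those \<open>z\<close> which are linearly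
  independent over the base field modulo \<open>A\<^sub>m\<close> are algebraically independent over \<open>A\<^sub>m\<close>.

  Order the derivatives compatibly with differentiation. The set of those which depend linearly on
  smaller ones modulo lower order is closed under differentiation, so by Dickson's lemma it is generated
  by finitely many of its members, and their relations, together with those of \<open>A\<^sub>0\<close> and the formulas
  for \<open>\<partial>X\<close>, reduce every differential polynomial to a combination of monomials that are linearly
  independent in \<open>B\<close>. Hence these finitely many relations generate all others.
\<close>

section \<open>Balanced maps and coproducts\<close>

text \<open>A differential ideal of differential polynomials need not be finitely generated, and
  reduction by a relation normally divides by its initial or separant. Neither obstacle is met here:
  above order 0 the relations used for reduction are linear over the base field in their top order,
  with leading coefficient 1, so their derivatives have the same shape and rewriting never divides.

  This linearity comes from the group structure. The coproduct of \<open>X\<close> is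
  multiplicative; passing to the logarithmic derivative splits off a term with left factor 1 and
  leaves right factors of order 0. A derivation kills the 1, so the shape survives differentiation,
  and the \<open>z\<close> of one order behave like additive coordinates over the lower orders.
  Operators that commute with the group action lower the degree of an algebraic relation between
  them until it is linear; in positive characteristic, additive polynomials such as p-th powers
  would escape this.

  Order 0 has no such coordinates. There the relations are those of a finitely generated algebra and
  are reduced by leading monomials, so that Dickson's lemma serves twice.\<close>

definition ev :: "('a \<Rightarrow> 'c \<Rightarrow> 'x::comm_monoid_add) \<Rightarrow> ('a \<times> 'c) list \<Rightarrow> 'x" where
  "ev f u = (\<Sum>p\<leftarrow>u. f (fst p) (snd p))"

lemma ev_simps [simp]:
  "ev f [] = 0" "ev f (p # u) = f (fst p) (snd p) + ev f u" "ev f (u @ v) = ev f u + ev f v"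
  by (simp_all add: ev_def)

lemma ev_map: "ev f (map g u) = (\<Sum>p\<leftarrow>u. f (fst (g p)) (snd (g p)))"
  by (simp add: ev_def comp_def)

lemma ev_concat: "ev f (concat us) = (\<Sum>u\<leftarrow>us. ev f u)"
  by (induction us) auto

lemma ev_cong: "(\<And>x y. (x, y) \<in> set u \<Longrightarrow> f x y = g x y) \<Longrightarrow> ev f u = ev g u"
  unfolding ev_def by (rule arg_cong[where f = sum_list], rule map_cong) auto

lemma ev_add_fun: "ev (\<lambda>x y. f x y + g x y) u = ev f u + ev g u"
  by (induction u) (auto simp: ac_simps)

lemma ev_hom:
  assumes "h 0 = 0" "\<And>x y. h (x + y) = h x + h y"
  shows "h (ev f u) = ev (\<lambda>x y. h (f x y)) u"
  by (induction u) (auto simp: assms)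

lemma ev_mem:
  assumes "0 \<in> N" "\<And>x y. x \<in> N \<Longrightarrow> y \<in> N \<Longrightarrow> x + y \<in> N" "\<And>x y. (x, y) \<in> set u \<Longrightarrow> f x y \<in> N"
  shows "ev f u \<in> N"
  using assms(3) by (induction u) (auto simp: assms(1,2))

lemma ev_sum: "ev (\<lambda>x y. \<Sum>j\<in>J. f j x y) u = (\<Sum>j\<in>J. ev (f j) u)"
  by (induction u) (auto simp: sum.distrib)

text \<open>Fubini for two formal sums; \<open>cop_mult_repr\<close> uses it to change the
  representatives of two factors one at a time.\<close>

lemma ev_swap: "ev (\<lambda>x y. ev (f x y) v) u = ev (\<lambda>x' y'. ev (\<lambda>x y. f x y x' y') u) v"
proof (induction v)
  case Nil
  then show ?case by (induction u) auto
next
  case (Cons p v)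
  then show ?case by (simp add: ev_add_fun)
qed

section \<open>Functionals, dual bases and slices of formal sums\<close>

locale scalar_algebra = vector_space sc
  for sc :: "'k::field \<Rightarrow> 'b::comm_ring_1 \<Rightarrow> 'b" +
  assumes scale_mult: "sc c (a * b) = sc c a * b"
begin

lemma scale_mult_right: "sc c (a * b) = a * sc c b"
  by (metis mult.commute scale_mult)

lemma scale_one_mult: "sc c 1 * a = sc c a"
  by (metis mult_1 scale_mult)

text \<open>Balanced maps need not be linear in their values: the derivation of a tensor product evaluates to
  \<open>f (D x a) b + f a (D x b)\<close>, which is balanced in \<open>a\<close>, \<open>b\<close> but not homogeneous.\<close>
definition balanced :: "('b \<Rightarrow> 'b \<Rightarrow> 'b) \<Rightarrow> bool" where
  "balanced f \<longleftrightarrow> (\<forall>a a' b. f (a + a') b = f a b + f a' b) \<and> (\<forall>a b b'. f a (b + b') = f a b + f a b') \<and>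
     (\<forall>c a b. f (sc c a) b = f a (sc c b))"

definition functional :: "('b \<Rightarrow> 'k) \<Rightarrow> bool" where
  "functional \<psi> \<longleftrightarrow> (\<forall>x y. \<psi> (x + y) = \<psi> x + \<psi> y) \<and> (\<forall>c x. \<psi> (sc c x) = c * \<psi> x)"

lemma functional_add: "functional \<psi> \<Longrightarrow> \<psi> (x + y) = \<psi> x + \<psi> y"
  and functional_scale: "functional \<psi> \<Longrightarrow> \<psi> (sc c x) = c * \<psi> x"
  by (auto simp: functional_def)

lemma functional_0: "functional \<psi> \<Longrightarrow> \<psi> 0 = 0"
  using functional_scale[of \<psi> 0 0] by simp

lemma functional_sum: "functional \<psi> \<Longrightarrow> \<psi> (sum f J) = (\<Sum>j\<in>J. \<psi> (f j))"
  by (induction J rule: infinite_finite_induct) (auto simp: functional_0 functional_add)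

lemma functional_mult: "functional \<psi> \<Longrightarrow> functional (\<lambda>x. \<psi> (p * x))"
  by (auto simp: functional_def ring_distribs scale_mult_right[symmetric])

lemma functional_ev: "functional \<psi> \<Longrightarrow> \<psi> (ev f u) = ev (\<lambda>x y. \<psi> (f x y)) u"
  by (rule ev_hom) (auto simp: functional_0 functional_add)

text \<open>A basis of \<open>W\<close> stays independent when \<open>z\<close> is added, so the
  values 0 on the basis and 1 at \<open>z\<close> extend linearly. Such functionals serve as
  coordinates throughout, also in infinite dimension.\<close>

lemma functional_exists:
  assumes W: "subspace W" and z: "z \<notin> W"
  shows "\<exists>\<psi>. functional \<psi> \<and> (\<forall>w\<in>W. \<psi> w = 0) \<and> \<psi> z = 1"
proof -
  interpret p: vector_space_pair sc "(*) :: 'k \<Rightarrow> 'k \<Rightarrow> 'k"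
    by unfold_locales (auto simp: algebra_simps)
  obtain E where E: "E \<subseteq> W" "independent E" "W \<subseteq> span E"
    using basis_exists[of W] by metis
  have sE: "span E = W"
    using E W by (simp add: span_subspace)
  have "independent (insert z E)"
    using E sE z by (simp add: independent_insertI)
  then obtain g where g: "Vector_Spaces.linear sc (*) g"
    "\<forall>x\<in>insert z E. g x = (if x = z then 1 else 0)"
    using p.linear_independent_extend[of "insert z E" "\<lambda>x. if x = z then 1 else 0"] by blast
  have g0: "g w = 0" if "w \<in> W" for w
  proof (rule p.linear_eq_0_on_span[OF g(1), of E])
    show "g x = 0" if "x \<in> E" for x using that g(2) z E(1) by auto
    show "w \<in> span E" using that sE by simp
  qed
  have "functional g"
    unfolding functional_def using g(1) by (simp add: p.linear_add p.linear_scale)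
  then show ?thesis using g0 g(2) by auto
qed

text \<open>A basis \<open>E\<close> is chosen inside \<open>P\<close>; the coordinate at
  \<open>e\<close> separates \<open>e\<close> from the span of the other basis vectors and is
  defined on the whole space, not only on \<open>span P\<close>.\<close>

lemma dual_basis:
  assumes "finite P"
  obtains E \<psi> where "finite E" "E \<subseteq> P" "\<And>e. e \<in> E \<Longrightarrow> functional (\<psi> e)"
    "\<And>p. p \<in> span P \<Longrightarrow> p = (\<Sum>e\<in>E. sc (\<psi> e p) e)"
    "\<And>e e'. e \<in> E \<Longrightarrow> e' \<in> E \<Longrightarrow> \<psi> e e' = (if e = e' then 1 else 0)"
proof -
  obtain E where E: "E \<subseteq> P" "independent E" "P \<subseteq> span E"
    using basis_exists[of P] by metis
  have fin: "finite E" using E assms finite_subset by blast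
  have "\<exists>\<psi>. functional \<psi> \<and> (\<forall>w\<in>span (E - {e}). \<psi> w = 0) \<and> \<psi> e = 1" if "e \<in> E" for e
    using E(2) that by (intro functional_exists) (auto simp: dependent_def)
  then obtain \<psi> where \<psi>: "\<And>e. e \<in> E \<Longrightarrow> functional (\<psi> e)"
      "\<And>e w. e \<in> E \<Longrightarrow> w \<in> span (E - {e}) \<Longrightarrow> \<psi> e w = 0" "\<And>e. e \<in> E \<Longrightarrow> \<psi> e e = 1"
    by metis
  have d: "\<psi> e e' = (if e = e' then 1 else 0)" if "e \<in> E" "e' \<in> E" for e e'
    using that \<psi>(2)[of e e'] \<psi>(3) by (auto intro: span_base)
  have "p = (\<Sum>e\<in>E. sc (\<psi> e p) e)" if "p \<in> span P" for p
  proof -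
    have "p \<in> span E"
      using that E(3) by (metis span_minimal subspace_span subsetD)
    then obtain u where u: "p = (\<Sum>e\<in>E. sc (u e) e)"
      using span_finite[OF fin] by auto
    have "\<psi> e p = u e" if "e \<in> E" for e
    proof -
      have "\<psi> e p = (\<Sum>e'\<in>E. u e' * (if e = e' then 1 else 0))"
        unfolding u using that \<psi>(1) d by (simp add: functional_sum functional_scale)
      then show ?thesis using that fin by (simp add: if_distrib cong: if_cong)
    qed
    then show ?thesis using u by simp
  qed
  then show thesis using that[of E \<psi>] fin E(1) \<psi>(1) d by blast
qed

lemma balanced_sum_scale:
  assumes "balanced f"
  shows "f (\<Sum>j\<in>J. sc (c j) (p j)) q = (\<Sum>j\<in>J. f (p j) (sc (c j) q))"
    and "f q (\<Sum>j\<in>J. sc (c j) (p j)) = (\<Sum>j\<in>J. f (sc (c j) q) (p j))"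
proof -
  have f0: "f 0 x = 0" "f x 0 = 0" for x
    using assms unfolding balanced_def by (metis add_cancel_right_left)+
  show "f (\<Sum>j\<in>J. sc (c j) (p j)) q = (\<Sum>j\<in>J. f (p j) (sc (c j) q))"
    using assms f0 by (induction J rule: infinite_finite_induct) (auto simp: balanced_def)
  show "f q (\<Sum>j\<in>J. sc (c j) (p j)) = (\<Sum>j\<in>J. f (sc (c j) q) (p j))"
    using assms f0 by (induction J rule: infinite_finite_induct) (auto simp: balanced_def)
qed

lemma balanced_0: assumes "balanced f" shows "f 0 x = 0" "f x 0 = 0"
  using assms unfolding balanced_def by (metis add_cancel_right_left)+

lemma balanced_sum:
  assumes "balanced f"
  shows "f (sum p J) q = (\<Sum>j\<in>J. f (p j) q)" and "f q (sum p J) = (\<Sum>j\<in>J. f q (p j))"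
  using balanced_sum_scale[OF assms, where c = "\<lambda>_. 1"] by simp_all

lemma balanced_add: "balanced f \<Longrightarrow> f (a + a') b = f a b + f a' b" "balanced f \<Longrightarrow> f a (b + b') = f a b + f a b'"
  and balanced_scale: "balanced f \<Longrightarrow> f (sc c a) b = f a (sc c b)"
  unfolding balanced_def by auto

text \<open>Expanding the left factors in a basis \<open>E\<close> of their span turns
  \<open>u\<close> into the sum of the tensors of \<open>e\<close> with the slice of
  \<open>u\<close> by the coordinate of \<open>e\<close>. Hence a tensor with all slices in
  \<open>N\<close> has a representative with right factors in \<open>N\<close>, and its left factors
  stay among those of \<open>u\<close>.\<close>

lemma slices_left:
  assumes "\<And>\<psi>. functional \<psi> \<Longrightarrow> ev (\<lambda>x y. sc (\<psi> x) y) u \<in> N"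
  obtains v where "set v \<subseteq> fst ` set u \<times> N" "\<And>f. balanced f \<Longrightarrow> ev f u = ev f v"
proof -
  obtain E \<psi> where E: "finite E" "E \<subseteq> fst ` set u" "\<And>e. e \<in> E \<Longrightarrow> functional (\<psi> e)"
    "\<And>p. p \<in> span (fst ` set u) \<Longrightarrow> p = (\<Sum>e\<in>E. sc (\<psi> e p) e)"
    "\<And>e e'. e \<in> E \<Longrightarrow> e' \<in> E \<Longrightarrow> \<psi> e e' = (if e = e' then 1 else 0)"
    by (rule dual_basis[of "fst ` set u", OF finite_imageI[OF List.finite_set]]) (rule that, assumption+)
  obtain es where es: "set es = E" "distinct es" using E(1) finite_distinct_list by blast
  let ?v = "map (\<lambda>e. (e, ev (\<lambda>x y. sc (\<psi> e x) y) u)) es"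
  have "ev f u = ev f ?v" if f: "balanced f" for f
  proof -
    have "ev f u = ev (\<lambda>x y. \<Sum>e\<in>E. f e (sc (\<psi> e x) y)) u"
    proof (rule ev_cong)
      fix x y assume "(x, y) \<in> set u"
      then have "x \<in> span (fst ` set u)" by (force intro: span_base)
      then show "f x y = (\<Sum>e\<in>E. f e (sc (\<psi> e x) y))"
        using E(4)[of x] balanced_sum_scale(1)[OF f, of "\<lambda>e. \<psi> e x" "\<lambda>e. e" E y] by simp
    qed
    also have "\<dots> = (\<Sum>e\<in>E. ev (\<lambda>x y. f e (sc (\<psi> e x) y)) u)" by (rule ev_sum)
    also have "\<dots> = (\<Sum>e\<in>E. f e (ev (\<lambda>x y. sc (\<psi> e x) y) u))"
      by (rule sum.cong[OF HOL.refl], rule ev_hom[symmetric]) (auto simp: balanced_0[OF f] balanced_add[OF f])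
    also have "\<dots> = ev f ?v"
      by (simp add: ev_map es sum_list_distinct_conv_sum_set)
    finally show ?thesis .
  qed
  moreover have "set ?v \<subseteq> fst ` set u \<times> N" using es E assms by auto
  ultimately show thesis using that by blast
qed

end

text \<open>The list \<open>cop b\<close> is a chosen representative of the coproduct of \<open>b\<close>, so an identity in the tensor
  product becomes an identity of the values of all balanced maps.\<close>
locale hopf = scalar_algebra sc
  for sc :: "'k::field_char_0 \<Rightarrow> 'b::comm_ring_1 \<Rightarrow> 'b" +
  fixes cop :: "'b \<Rightarrow> ('b \<times> 'b) list" and eps :: "'b \<Rightarrow> 'k" and S :: "'b \<Rightarrow> 'b"
  assumes cop_add: "balanced f \<Longrightarrow> ev f (cop (a + b)) = ev f (cop a) + ev f (cop b)"
    and cop_scale: "balanced f \<Longrightarrow> ev f (cop (sc c a)) = ev (\<lambda>x y. f (sc c x) y) (cop a)"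
    and cop_mult: "balanced f \<Longrightarrow>
      ev f (cop (a * b)) = ev (\<lambda>x y. ev (\<lambda>x' y'. f (x * x') (y * y')) (cop b)) (cop a)"
    and cop_one: "balanced f \<Longrightarrow> ev f (cop 1) = f 1 1"
    and coassoc: "\<lbrakk>\<And>z. balanced (\<lambda>x y. g x y z); \<And>x. balanced (\<lambda>y z. g x y z)\<rbrakk> \<Longrightarrow>
      ev (\<lambda>x z. ev (\<lambda>p q. g p q z) (cop x)) (cop b) =
      ev (\<lambda>x y. ev (\<lambda>p q. g x p q) (cop y)) (cop b)"
    and counit_left: "ev (\<lambda>x y. sc (eps x) y) (cop b) = b"
    and counit_right: "ev (\<lambda>x y. sc (eps y) x) (cop b) = b"
    and antipode_left: "ev (\<lambda>x y. S x * y) (cop b) = sc (eps b) 1"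
    and antipode_right: "ev (\<lambda>x y. x * S y) (cop b) = sc (eps b) 1"
    and eps_functional: "functional eps"
    and S_add: "S (a + b) = S a + S b" and S_mult: "S (a * b) = S a * S b" and S_one: "S 1 = 1"
    and S_scale: "S (sc c a) = sc c (S a)"
begin

text \<open>\<open>u\<close> is another representative of the coproduct of \<open>b\<close>, as far
  as balanced maps into the algebra can tell. These include the slices by functionals, which by
  \<open>slices_left\<close> determine the values of all the others.\<close>

definition repr :: "'b \<Rightarrow> ('b \<times> 'b) list \<Rightarrow> bool" where
  "repr b u \<longleftrightarrow> (\<forall>f. balanced f \<longrightarrow> ev f (cop b) = ev f u)"

definition in_tensor :: "'b set \<Rightarrow> 'b set \<Rightarrow> 'b \<Rightarrow> bool" where
  "in_tensor P Q b \<longleftrightarrow> (\<exists>u. set u \<subseteq> P \<times> Q \<and> repr b u)"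

text \<open>The operator \<open>(\<psi> \<otimes> id) \<circ> \<Delta>\<close>.\<close>
definition T :: "('b \<Rightarrow> 'k) \<Rightarrow> 'b \<Rightarrow> 'b" where
  "T \<psi> b = ev (\<lambda>x y. sc (\<psi> x) y) (cop b)"

lemma S_0: "S 0 = 0"
  using S_add[of 0 0] by simp

lemma repr_D: "repr b u \<Longrightarrow> balanced f \<Longrightarrow> ev f (cop b) = ev f u"
  by (simp add: repr_def)

lemma balanced_T: "functional \<psi> \<Longrightarrow> balanced (\<lambda>x y. sc (\<psi> x) y)"
  by (auto simp: balanced_def functional_add functional_scale scale_left_distrib scale_right_distrib mult.commute)

lemma balanced_antipode: "balanced (\<lambda>x y. S x * y)"
  by (auto simp: balanced_def S_add S_scale ring_distribs scale_mult_right[symmetric] scale_mult[symmetric])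

lemma T_repr: "functional \<psi> \<Longrightarrow> repr b u \<Longrightarrow> T \<psi> b = ev (\<lambda>x y. sc (\<psi> x) y) u"
  unfolding T_def by (rule repr_D) (auto intro: balanced_T)

lemma T_add: "functional \<psi> \<Longrightarrow> T \<psi> (a + b) = T \<psi> a + T \<psi> b"
  unfolding T_def by (rule cop_add[OF balanced_T])

lemma T_0: "functional \<psi> \<Longrightarrow> T \<psi> 0 = 0"
  using T_add[of \<psi> 0 0] by simp

lemma T_scale: "functional \<psi> \<Longrightarrow> T \<psi> (sc c a) = sc c (T \<psi> a)"
proof -
  assume \<psi>: "functional \<psi>"
  have "T \<psi> (sc c a) = ev (\<lambda>x y. sc (\<psi> (sc c x)) y) (cop a)"
    unfolding T_def by (rule cop_scale[OF balanced_T[OF \<psi>]])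
  also have "\<dots> = ev (\<lambda>x y. sc c (sc (\<psi> x) y)) (cop a)"
    using \<psi> by (simp add: functional_scale)
  also have "\<dots> = sc c (T \<psi> a)"
    unfolding T_def by (rule ev_hom[symmetric]) (auto simp: scale_right_distrib)
  finally show ?thesis .
qed

lemma T_sum: "functional \<psi> \<Longrightarrow> T \<psi> (sum f J) = (\<Sum>j\<in>J. T \<psi> (f j))"
  by (induction J rule: infinite_finite_induct) (auto simp: T_0 T_add)

lemma T_one: "functional \<psi> \<Longrightarrow> T \<psi> 1 = sc (\<psi> 1) 1"
  unfolding T_def by (rule cop_one[OF balanced_T])

text \<open>The representatives are exchanged one after the other: for a fixed entry of one factor,
  the product map is balanced in the entries of the other.\<close>

lemma cop_mult_repr:
  assumes "repr a u" "repr b v" "balanced f"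
  shows "ev f (cop (a * b)) = ev (\<lambda>x y. ev (\<lambda>x' y'. f (x * x') (y * y')) v) u"
proof -
  have b1: "balanced (\<lambda>x' y'. f (x * x') (y * y'))" for x y
    using assms(3) by (auto simp: balanced_def ring_distribs scale_mult_right[symmetric])
  have b2: "balanced (\<lambda>x y. f (x * x') (y * y'))" for x' y'
    using assms(3) by (auto simp: balanced_def ring_distribs scale_mult[symmetric])
  have "ev f (cop (a * b)) = ev (\<lambda>x y. ev (\<lambda>x' y'. f (x * x') (y * y')) v) (cop a)"
    unfolding cop_mult[OF assms(3)] using repr_D[OF assms(2) b1] by simp
  also have "\<dots> = ev (\<lambda>x' y'. ev (\<lambda>x y. f (x * x') (y * y')) (cop a)) v" by (rule ev_swap)
  also have "\<dots> = ev (\<lambda>x' y'. ev (\<lambda>x y. f (x * x') (y * y')) u) v"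
    using repr_D[OF assms(1) b2] by simp
  finally show ?thesis by (simp add: ev_swap[of _ u v])
qed

lemma repr_cop: "repr a (cop a)" by (simp add: repr_def)

text \<open>A twisted Leibniz rule: each left factor \<open>p\<close> of the coproduct of
  \<open>a\<close> is absorbed into the functional that slices \<open>b\<close>. Inductions over
  products therefore have to treat all functionals at once.\<close>

lemma T_mult_repr:
  assumes \<psi>: "functional \<psi>" and u: "repr a u"
  shows "T \<psi> (a * b) = ev (\<lambda>p q. q * T (\<lambda>x. \<psi> (p * x)) b) u"
proof -
  have "T \<psi> (a * b) = ev (\<lambda>x y. ev (\<lambda>x' y'. sc (\<psi> (x * x')) (y * y')) (cop b)) u"
    unfolding T_def[of \<psi>] by (rule cop_mult_repr[OF u repr_cop balanced_T[OF \<psi>]])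
  also have "\<dots> = ev (\<lambda>p q. q * T (\<lambda>x. \<psi> (p * x)) b) u"
  proof (rule ev_cong)
    fix x y
    have "y * T (\<lambda>x'. \<psi> (x * x')) b = ev (\<lambda>x' y'. y * sc (\<psi> (x * x')) y') (cop b)"
      unfolding T_def by (rule ev_hom) (auto simp: ring_distribs)
    then show "ev (\<lambda>x' y'. sc (\<psi> (x * x')) (y * y')) (cop b) = y * T (\<lambda>x'. \<psi> (x * x')) b"
      by (simp add: scale_mult_right)
  qed
  finally show ?thesis .
qed

text \<open>This is the right counit law under \<open>\<psi>\<close>. Consequently an element is
  zero as soon as the counit kills all its slices.\<close>

lemma eps_T: assumes "functional \<psi>" shows "eps (T \<psi> b) = \<psi> b"
proof -
  have "eps (T \<psi> b) = ev (\<lambda>x y. \<psi> x * eps y) (cop b)"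
    unfolding T_def by (simp add: functional_ev[OF eps_functional] functional_scale[OF eps_functional])
  also have "\<dots> = \<psi> (ev (\<lambda>x y. sc (eps y) x) (cop b))"
    using assms by (simp add: functional_ev functional_scale mult.commute)
  finally show ?thesis by (simp add: counit_right)
qed

section \<open>Hopf subalgebras and independence over them\<close>

definition hopf_subalgebra :: "'b set \<Rightarrow> bool" where
  "hopf_subalgebra A \<longleftrightarrow> (\<forall>c. sc c 1 \<in> A) \<and> (\<forall>a\<in>A. \<forall>b\<in>A. a + b \<in> A \<and> a * b \<in> A) \<and>
     (\<forall>a\<in>A. S a \<in> A \<and> in_tensor A A a)"

lemma hopf_subalgebraD:
  assumes "hopf_subalgebra A"
  shows "0 \<in> A" "1 \<in> A" "a \<in> A \<Longrightarrow> b \<in> A \<Longrightarrow> a + b \<in> A" "a \<in> A \<Longrightarrow> b \<in> A \<Longrightarrow> a * b \<in> A"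
    "a \<in> A \<Longrightarrow> S a \<in> A" "a \<in> A \<Longrightarrow> sc c a \<in> A" "a \<in> A \<Longrightarrow> in_tensor A A a"
proof -
  have *: "sc c 1 \<in> A" for c using assms by (auto simp: hopf_subalgebra_def)
  show "0 \<in> A" using *[of 0] by simp
  show "1 \<in> A" using *[of 1] by simp
  show "a \<in> A \<Longrightarrow> b \<in> A \<Longrightarrow> a + b \<in> A" "a \<in> A \<Longrightarrow> b \<in> A \<Longrightarrow> a * b \<in> A"
    "a \<in> A \<Longrightarrow> S a \<in> A"  "a \<in> A \<Longrightarrow> in_tensor A A a"
    using assms by (auto simp: hopf_subalgebra_def)
  show "sc c a \<in> A" if "a \<in> A"
  proof -
    have "sc c 1 * a \<in> A" using assms * that by (simp add: hopf_subalgebra_def)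
    then show ?thesis by (simp add: scale_one_mult)
  qed
qed

lemma hopf_subalgebra_subspace: "hopf_subalgebra A \<Longrightarrow> subspace A"
  by (auto simp: subspace_def hopf_subalgebraD)

lemma T_mem: "hopf_subalgebra A \<Longrightarrow> a \<in> A \<Longrightarrow> functional \<psi> \<Longrightarrow> T \<psi> a \<in> A"
proof -
  assume A: "hopf_subalgebra A" and a: "a \<in> A" and \<psi>: "functional \<psi>"
  obtain u where u: "set u \<subseteq> A \<times> A" "repr a u"
    using hopf_subalgebraD(7)[OF A a] by (auto simp: in_tensor_def)
  show ?thesis unfolding T_repr[OF \<psi> u(2)]
    by (rule ev_mem) (use u(1) A in \<open>auto simp: hopf_subalgebraD\<close>)
qed

text \<open>The coefficients of a relation may be replaced by their counits, since if
  \<open>\<Sum> a\<^sub>j w\<^sub>j \<in> N\<close> then also \<open>\<Sum> S(a\<^sub>j\<^sub>1) a\<^sub>j\<^sub>2 w\<^sub>j \<in> N\<close>.\<close>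
lemma independent_over_subalgebra:
  assumes A: "hopf_subalgebra A" and N: "subspace N"
    and AN: "\<And>a n. a \<in> A \<Longrightarrow> n \<in> N \<Longrightarrow> a * n \<in> N"
    and TN: "\<And>\<psi> n. functional \<psi> \<Longrightarrow> n \<in> N \<Longrightarrow> T \<psi> n \<in> N"
    and w: "\<And>\<psi> j. functional \<psi> \<Longrightarrow> j \<in> J \<Longrightarrow> T \<psi> (w j) - sc (\<psi> 1) (w j) \<in> N"
    and ind: "\<And>c. (\<Sum>j\<in>J. sc (c j) (w j)) \<in> N \<Longrightarrow> \<forall>j\<in>J. c j = 0"
    and a: "\<And>j. j \<in> J \<Longrightarrow> a j \<in> A" and rel: "(\<Sum>j\<in>J. a j * w j) \<in> N" and j: "j \<in> J"
  shows "a j = 0"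
proof -
  \<comment> \<open>\<open>T \<psi>\<close> turns a relation with coefficients \<open>a j\<close>
    into one with coefficients \<open>T \<psi> (a j)\<close>: in the twisted Leibniz rule the slice
    of \<open>w j\<close> belonging to a left factor \<open>p\<close> is \<open>\<psi> p\<close>
    times \<open>w j\<close> modulo \<open>N\<close>.\<close>
  have T_rel: "(\<Sum>j\<in>J. T \<psi> (a j) * w j) \<in> N"
    if a: "\<And>j. j \<in> J \<Longrightarrow> a j \<in> A" and rel: "(\<Sum>j\<in>J. a j * w j) \<in> N" and \<psi>: "functional \<psi>" for a \<psi>
  proof -
    have "T \<psi> (a j * w j) - T \<psi> (a j) * w j \<in> N" if j: "j \<in> J" for j
    proof -
      obtain u where u: "set u \<subseteq> A \<times> A" "repr (a j) u"
        using hopf_subalgebraD(7)[OF A a[OF j]] by (auto simp: in_tensor_def)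
      have "T \<psi> (a j * w j) = ev (\<lambda>p q. q * (T (\<lambda>x. \<psi> (p * x)) (w j) - sc (\<psi> p) (w j)) + q * sc (\<psi> p) (w j)) u"
        unfolding T_mult_repr[OF \<psi> u(2)] by (simp add: ring_distribs)
      also have "\<dots> = ev (\<lambda>p q. q * (T (\<lambda>x. \<psi> (p * x)) (w j) - sc (\<psi> p) (w j))) u + ev (\<lambda>p q. q * sc (\<psi> p) (w j)) u"
        by (rule ev_add_fun)
      also have "ev (\<lambda>p q. q * sc (\<psi> p) (w j)) u = T \<psi> (a j) * w j"
      proof -
        have "T \<psi> (a j) * w j = ev (\<lambda>x y. sc (\<psi> x) y * w j) u"
          unfolding T_repr[OF \<psi> u(2)] by (rule ev_hom) (auto simp: ring_distribs)
        then show ?thesis by (simp add: scale_mult[symmetric] scale_mult_right[symmetric])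
      qed
      finally have "T \<psi> (a j * w j) - T \<psi> (a j) * w j =
          ev (\<lambda>p q. q * (T (\<lambda>x. \<psi> (p * x)) (w j) - sc (\<psi> p) (w j))) u" by simp
      also have "\<dots> \<in> N"
      proof (rule ev_mem)
        fix x y assume "(x, y) \<in> set u"
        then have "y \<in> A" using u by auto
        then show "y * (T (\<lambda>xa. \<psi> (x * xa)) (w j) - sc (\<psi> x) (w j)) \<in> N"
          using w[OF functional_mult[OF \<psi>] j, of x] AN by simp
      qed (use N in \<open>auto simp: subspace_def\<close>)
      finally show ?thesis .
    qed
    then have "(\<Sum>j\<in>J. T \<psi> (a j * w j) - T \<psi> (a j) * w j) \<in> N"
      using N by (intro subspace_sum) auto
    moreover have "(\<Sum>j\<in>J. T \<psi> (a j * w j)) \<in> N"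
      using TN[OF \<psi> rel] by (simp add: T_sum[OF \<psi>])
    ultimately have "(\<Sum>j\<in>J. T \<psi> (a j * w j)) - (\<Sum>j\<in>J. T \<psi> (a j * w j) - T \<psi> (a j) * w j) \<in> N"
      using N by (intro subspace_diff)
    then show ?thesis by (simp add: sum_subtractf)
  qed
  have eps_rel: "eps (a j) = 0"
    if a: "\<And>j. j \<in> J \<Longrightarrow> a j \<in> A" and rel: "(\<Sum>j\<in>J. a j * w j) \<in> N" and j: "j \<in> J" for a j
  proof (cases "finite J")
    case True
    obtain js where js: "set js = J" "distinct js" using True finite_distinct_list by blast
    have "\<exists>u. set u \<subseteq> A \<times> A \<and> repr (a j) u" if "j \<in> J" for j
      using hopf_subalgebraD(7)[OF A a[OF that]] by (auto simp: in_tensor_def)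
    then obtain u where u: "\<And>j. j \<in> J \<Longrightarrow> set (u j) \<subseteq> A \<times> A" "\<And>j. j \<in> J \<Longrightarrow> repr (a j) (u j)"
      by metis
    \<comment> \<open>\<open>L\<close> collects the coproducts of the \<open>a j\<close>, with right
      factors multiplied by \<open>w j\<close>. By \<open>T_rel\<close> all its slices lie in
      \<open>N\<close>, so it can be rewritten with left factors in \<open>A\<close> and right
      factors in \<open>N\<close>, where the values of the antipode map are in
      \<open>N\<close>.\<close>
    define L where "L = concat (map (\<lambda>j. map (\<lambda>p. (fst p, snd p * w j)) (u j)) js)"
    have evL: "ev f L = (\<Sum>j\<in>J. ev (\<lambda>p q. f p (q * w j)) (u j))" for f :: "'b \<Rightarrow> 'b \<Rightarrow> 'b"
      unfolding L_def ev_concat by (simp add: comp_def ev_map js sum_list_distinct_conv_sum_set)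
        (simp add: ev_def)
    have "ev (\<lambda>x y. sc (\<psi> x) y) L \<in> N" if \<psi>: "functional \<psi>" for \<psi>
    proof -
      have "ev (\<lambda>x y. sc (\<psi> x) y) L = (\<Sum>j\<in>J. T \<psi> (a j) * w j)"
        unfolding evL
      proof (rule sum.cong[OF HOL.refl])
        fix j assume j: "j \<in> J"
        have "T \<psi> (a j) * w j = ev (\<lambda>x y. sc (\<psi> x) y * w j) (u j)"
          unfolding T_repr[OF \<psi> u(2)[OF j]] by (rule ev_hom) (auto simp: ring_distribs)
        then show "ev (\<lambda>p q. sc (\<psi> p) (q * w j)) (u j) = T \<psi> (a j) * w j"
          by (simp add: scale_mult)
      qed
      then show ?thesis using T_rel[OF a rel \<psi>] by simp
    qed
    then obtain v where v: "set v \<subseteq> fst ` set L \<times> N" "\<And>f. balanced f \<Longrightarrow> ev f L = ev f v"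
      using slices_left by blast
    have fL: "fst ` set L \<subseteq> A" unfolding L_def using u(1) js by fastforce
    have "ev (\<lambda>x y. S x * y) L = ev (\<lambda>x y. S x * y) v"
      by (rule v(2)[OF balanced_antipode])
    also have "\<dots> \<in> N"
    proof (rule ev_mem)
      fix x y assume "(x, y) \<in> set v"
      then have "x \<in> A" "y \<in> N" using v(1) fL by auto
      then show "S x * y \<in> N" using A AN by (simp add: hopf_subalgebraD)
    qed (use N in \<open>auto simp: subspace_def\<close>)
    also have "ev (\<lambda>x y. S x * y) L = (\<Sum>j\<in>J. sc (eps (a j)) (w j))"
      unfolding evL
    proof (rule sum.cong[OF HOL.refl])
      fix j assume j: "j \<in> J"
      have "ev (\<lambda>p q. S p * q) (u j) = sc (eps (a j)) 1"
        using repr_D[OF u(2)[OF j] balanced_antipode] antipode_left by simp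
      then have "ev (\<lambda>p q. S p * q) (u j) * w j = sc (eps (a j)) (w j)"
        by (simp add: scale_one_mult)
      moreover have "ev (\<lambda>p q. S p * q) (u j) * w j = ev (\<lambda>p q. S p * q * w j) (u j)"
        by (rule ev_hom) (auto simp: ring_distribs)
      ultimately show "ev (\<lambda>p q. S p * (q * w j)) (u j) = sc (eps (a j)) (w j)"
        by (simp add: mult.assoc)
    qed
    finally have "\<forall>j\<in>J. eps (a j) = 0" by (rule ind)
    then show ?thesis using j by blast
  next
    case False
    \<comment> \<open>A sum over an infinite set is 0 by convention, so \<open>ind\<close> would
      force the constant 1 to vanish.\<close>
    have "(\<Sum>j\<in>J. sc ((\<lambda>_. 1) j) (w j)) \<in> N"
      using False N by (simp add: subspace_def)
    then show ?thesis using ind[of "\<lambda>_. 1"] j by auto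
  qed
  show ?thesis
  proof (rule ccontr)
    assume "a j \<noteq> 0"
    \<comment> \<open>A nonzero coefficient has a slice with counit 1, while slicing preserves the
      relation; this contradicts \<open>eps_rel\<close>.\<close>
    then obtain \<psi> where \<psi>: "functional \<psi>" "\<psi> (a j) = 1"
      using functional_exists[OF subspace_single_0, of "a j"] by auto
    have "eps (T \<psi> (a j)) = 0"
      by (rule eps_rel[of "\<lambda>j. T \<psi> (a j)", OF _ T_rel[OF a rel \<psi>(1)] j])
        (use a T_mem[OF A _ \<psi>(1)] in auto)
    then show False using \<psi> by (simp add: eps_T)
  qed
qed

end

section \<open>Algebraic independence over a Hopf subalgebra\<close>

definition mset_val :: "('v \<Rightarrow> 'b::comm_monoid_mult) \<Rightarrow> 'v multiset \<Rightarrow> 'b" where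
  "mset_val z \<rho> = prod_mset (image_mset z \<rho>)"

lemma mset_val_simps [simp]: "mset_val z {#} = 1" "mset_val z (add_mset i \<rho>) = z i * mset_val z \<rho>"
  "mset_val z (\<rho> + \<sigma>) = mset_val z \<rho> * mset_val z \<sigma>"
  by (simp_all add: mset_val_def)

text \<open>The condition on \<open>z\<close> is \<open>\<Delta> z - 1 \<otimes> z \<in> B \<otimes> A\<close>: modulo \<open>A\<close> the \<open>z i\<close> are
  coordinates on a vector group.\<close>
locale block = hopf sc cop eps S
  for sc :: "'k::field_char_0 \<Rightarrow> 'b::comm_ring_1 \<Rightarrow> 'b" and cop eps S +
  fixes A :: "'b set" and z :: "'v \<Rightarrow> 'b" and Z :: "'v set"
  assumes A: "hopf_subalgebra A"
    and z: "i \<in> Z \<Longrightarrow> \<exists>u. set u \<subseteq> UNIV \<times> A \<and> repr (z i) ((1, z i) # u)"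
    and z_indep: "i \<in> Z \<Longrightarrow> z i \<notin> span (A \<union> z ` (Z - {i}))"
begin

text \<open>The filtration by degree in the \<open>z i\<close> over \<open>A\<close>. The bound is
  strict, so \<open>F 0\<close> is zero and monomials of degree \<open>d\<close> are studied modulo
  \<open>F d\<close>.\<close>

definition F :: "nat \<Rightarrow> 'b set" where
  "F d = span {a * mset_val z \<rho> |a \<rho>. a \<in> A \<and> set_mset \<rho> \<subseteq> Z \<and> size \<rho> < d}"

lemma F_subspace: "subspace (F d)" by (simp add: F_def)

lemma F_0: "F 0 = {0}" by (simp add: F_def)

lemma F_base: "a \<in> A \<Longrightarrow> set_mset \<rho> \<subseteq> Z \<Longrightarrow> size \<rho> < d \<Longrightarrow> a * mset_val z \<rho> \<in> F d"
  unfolding F_def by (rule span_base) blast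

lemma F_induct [consumes 1, case_names base zero add scale]:
  assumes "x \<in> F d"
    and "\<And>a \<rho>. a \<in> A \<Longrightarrow> set_mset \<rho> \<subseteq> Z \<Longrightarrow> size \<rho> < d \<Longrightarrow> P (a * mset_val z \<rho>)"
    and "P 0" "\<And>x y. P x \<Longrightarrow> P y \<Longrightarrow> P (x + y)" "\<And>c x. P x \<Longrightarrow> P (sc c x)"
  shows "P x"
proof (rule span_induct_alt[OF assms(1)[unfolded F_def]])
  show "P (sc c x + y)" if "x \<in> {a * mset_val z \<rho> |a \<rho>. a \<in> A \<and> set_mset \<rho> \<subseteq> Z \<and> size \<rho> < d}" "P y" for c x y
    using that assms by auto
qed (rule assms)

lemma F_mono: "d \<le> d' \<Longrightarrow> F d \<subseteq> F d'"
  unfolding F_def by (intro span_mono) fastforce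

lemma F_mult_A:
  assumes "a \<in> A" "x \<in> F d"
  shows "a * x \<in> F d"
  using assms(2)
proof (induction rule: F_induct)
  case (base b \<rho>)
  have "a * b * mset_val z \<rho> \<in> F d"
    using base A assms(1) by (intro F_base) (auto simp: hopf_subalgebraD)
  then show ?case by (simp add: mult.assoc)
qed (use F_subspace in \<open>auto simp: ring_distribs scale_mult_right[symmetric] subspace_def\<close>)

lemma F_mult_z:
  assumes "i \<in> Z" "x \<in> F d"
  shows "z i * x \<in> F (Suc d)"
  using assms(2)
proof (induction rule: F_induct)
  case (base b \<rho>)
  have "b * mset_val z (add_mset i \<rho>) \<in> F (Suc d)"
    using base assms(1) by (intro F_base) auto
  then show ?case by (simp add: ac_simps)
qed (use F_subspace in \<open>auto simp: ring_distribs scale_mult_right[symmetric] subspace_def\<close>)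

text \<open>Up to the scalar \<open>\<psi> 1\<close>, the operator \<open>T \<psi>\<close>
  translates the coordinate \<open>z i\<close> by this element, which lies in
  \<open>A\<close>.\<close>

definition coef :: "('b \<Rightarrow> 'k) \<Rightarrow> 'v \<Rightarrow> 'b" where
  "coef \<psi> i = T \<psi> (z i) - sc (\<psi> 1) (z i)"

lemma coef_repr:
  assumes "functional \<psi>" "repr (z i) ((1, z i) # u)"
  shows "coef \<psi> i = ev (\<lambda>x y. sc (\<psi> x) y) u"
  unfolding coef_def T_repr[OF assms] by simp

lemma coef_mem: assumes "functional \<psi>" "i \<in> Z" shows "coef \<psi> i \<in> A"
proof -
  obtain u where u: "set u \<subseteq> UNIV \<times> A" "repr (z i) ((1, z i) # u)" using z assms by blast
  show ?thesis unfolding coef_repr[OF assms(1) u(2)]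
    by (rule ev_mem) (use u(1) A in \<open>auto simp: hopf_subalgebraD\<close>)
qed

text \<open>Multiplicities become scalars of the field, where characteristic zero can be applied to
  them.\<close>

lemma sum_mset_count: "(\<Sum>i\<in>#\<rho>. f i) = (\<Sum>i\<in>set_mset \<rho>. sc (of_nat (count \<rho> i)) (f i))"
proof -
  have "(\<Sum>i\<in>#\<rho>. f i) = (\<Sum>i\<in>X. sc (of_nat (count \<rho> i)) (f i))" if "finite X" "set_mset \<rho> \<subseteq> X" for X
    using that(2)
  proof (induction \<rho>)
    case (add i \<rho>)
    have "(\<Sum>j\<in>X. sc (of_nat (count (add_mset i \<rho>) j)) (f j)) =
        (\<Sum>j\<in>X. (if j = i then f j else 0) + sc (of_nat (count \<rho> j)) (f j))"
      by (rule sum.cong) (auto simp: scale_left_distrib)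
    then show ?case using add that(1) by (simp add: sum.distrib)
  qed simp
  then show ?thesis by blast
qed

text \<open>The directional derivative of the monomial that moves every \<open>z i\<close> by
  \<open>coef \<psi> i\<close>; a repeated variable contributes once for each occurrence, and
  \<open>lower_add\<close> is the product rule.\<close>

definition lower :: "('b \<Rightarrow> 'k) \<Rightarrow> 'v multiset \<Rightarrow> 'b" where
  "lower \<psi> \<rho> = (\<Sum>i\<in>#\<rho>. coef \<psi> i * mset_val z (\<rho> - {#i#}))"

lemma sum_mset_mem:
  "subspace N \<Longrightarrow> (\<And>i. i \<in># \<rho> \<Longrightarrow> f i \<in> N) \<Longrightarrow> (\<Sum>i\<in>#\<rho>. f i) \<in> N"
  by (induction \<rho>) (auto simp: subspace_def)

lemma lower_mem: "functional \<psi> \<Longrightarrow> set_mset \<rho> \<subseteq> Z \<Longrightarrow> lower \<psi> \<rho> \<in> F (size \<rho>)"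
  unfolding lower_def
  by (rule sum_mset_mem[OF F_subspace], rule F_base)
    (auto simp: size_Diff_singleton intro!: coef_mem dest: in_diffD, metis Suc_pred lessI size_eq_0_iff_empty gr0I multi_member_last empty_iff set_mset_empty)

lemma lower_add:
  "lower \<psi> (add_mset i \<rho>) = coef \<psi> i * mset_val z \<rho> + z i * lower \<psi> \<rho>"
proof -
  have "(\<Sum>j\<in>#\<rho>. coef \<psi> j * mset_val z (add_mset i \<rho> - {#j#})) =
      (\<Sum>j\<in>#\<rho>. z i * (coef \<psi> j * mset_val z (\<rho> - {#j#})))"
    by (intro arg_cong[where f = sum_mset] image_mset_cong)
      (simp add: multiset_add_sub_el_shuffle mult.left_commute)
  then show ?thesis by (simp add: lower_def sum_mset_distrib_left)
qed

text \<open>Modulo lower degree, the operators \<open>T \<psi>\<close> with \<open>\<psi> 1 = 0\<close> act on monomials like derivations.\<close>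
lemma T_mset_val:
  assumes "set_mset \<rho> \<subseteq> Z" "functional \<psi>"
  shows "T \<psi> (mset_val z \<rho>) - sc (\<psi> 1) (mset_val z \<rho>) - lower \<psi> \<rho> \<in> F (size \<rho> - 1)"
  using assms
proof (induction \<rho> arbitrary: \<psi>)
  case empty
  then show ?case by (simp add: T_one lower_def F_0)
next
  case (add i \<rho>)
  have i: "i \<in> Z" and \<rho>: "set_mset \<rho> \<subseteq> Z" using add.prems by auto
  obtain u where u: "set u \<subseteq> UNIV \<times> A" "repr (z i) ((1, z i) # u)" using z i by blast
  let ?w = "mset_val z \<rho>" and ?d = "size \<rho>"
  have T: "T \<psi> (z i * ?w) = z i * T \<psi> ?w + ev (\<lambda>x y. y * T (\<lambda>v. \<psi> (x * v)) ?w) u"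
    unfolding T_mult_repr[OF add.prems(2) u(2)] by simp
  \<comment> \<open>This is the part of the coproduct of \<open>z i\<close> beyond the term with
    left factor 1. Modulo \<open>F ?d\<close> each operator in it acts on \<open>?w\<close> as the
    scalar \<open>\<psi> x\<close>, and the sum of the \<open>sc (\<psi> x) y\<close> is
    \<open>coef \<psi> i\<close>.\<close>
  have e: "ev (\<lambda>x y. y * T (\<lambda>v. \<psi> (x * v)) ?w) u - coef \<psi> i * ?w \<in> F ?d"
  proof -
    have "coef \<psi> i * ?w = ev (\<lambda>x y. sc (\<psi> x) y * ?w) u"
      unfolding coef_repr[OF add.prems(2) u(2)] by (rule ev_hom) (auto simp: ring_distribs)
    then have "ev (\<lambda>x y. y * T (\<lambda>v. \<psi> (x * v)) ?w) u = coef \<psi> i * ?w +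
        ev (\<lambda>x y. y * (T (\<lambda>v. \<psi> (x * v)) ?w - sc (\<psi> x) ?w)) u"
      by (simp add: scale_mult[symmetric] scale_mult_right[symmetric] ring_distribs flip: ev_add_fun)
    moreover have "ev (\<lambda>x y. y * (T (\<lambda>v. \<psi> (x * v)) ?w - sc (\<psi> x) ?w)) u \<in> F ?d"
    proof (rule ev_mem)
      fix x y assume xy: "(x, y) \<in> set u"
      have "T (\<lambda>v. \<psi> (x * v)) ?w - sc (\<psi> (x * 1)) ?w - lower (\<lambda>v. \<psi> (x * v)) \<rho> \<in> F (?d - 1)"
        by (rule add.IH[OF \<rho> functional_mult[OF add.prems(2)]])
      then have "T (\<lambda>v. \<psi> (x * v)) ?w - sc (\<psi> (x * 1)) ?w - lower (\<lambda>v. \<psi> (x * v)) \<rho> \<in> F ?d"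
        using F_mono[of "?d - 1" ?d] by auto
      then have "(T (\<lambda>v. \<psi> (x * v)) ?w - sc (\<psi> (x * 1)) ?w - lower (\<lambda>v. \<psi> (x * v)) \<rho>)
          + lower (\<lambda>v. \<psi> (x * v)) \<rho> \<in> F ?d"
        using lower_mem[OF functional_mult[OF add.prems(2)] \<rho>] F_subspace by (intro subspace_add)
      then show "y * (T (\<lambda>v. \<psi> (x * v)) ?w - sc (\<psi> x) ?w) \<in> F ?d"
        using u(1) xy by (intro F_mult_A) auto
    qed (use F_subspace in \<open>auto simp: subspace_def\<close>)
    ultimately show ?thesis by simp
  qed
  have "z i * (T \<psi> ?w - sc (\<psi> 1) ?w - lower \<psi> \<rho>) \<in> F ?d"
  \<comment> \<open>For the empty monomial \<open>?d - 1\<close> truncates to 0, and multiplying by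
    \<open>z i\<close> would only lead to \<open>F 1\<close>; there the induction hypothesis says
    that the difference is zero.\<close>
  proof (cases "\<rho> = {#}")
    case True
    then show ?thesis using add.IH[OF \<rho> add.prems(2)] by (simp add: F_0)
  next
    case False
    then have "Suc (?d - 1) = ?d" by (simp add: nonempty_has_size)
    then show ?thesis using F_mult_z[OF i add.IH[OF \<rho> add.prems(2)]] by simp
  qed
  then have "z i * (T \<psi> ?w - sc (\<psi> 1) ?w - lower \<psi> \<rho>) +
      (ev (\<lambda>x y. y * T (\<lambda>v. \<psi> (x * v)) ?w) u - coef \<psi> i * ?w) \<in> F ?d"
    using e F_subspace by (intro subspace_add)
  also have "z i * (T \<psi> ?w - sc (\<psi> 1) ?w - lower \<psi> \<rho>) +
      (ev (\<lambda>x y. y * T (\<lambda>v. \<psi> (x * v)) ?w) u - coef \<psi> i * ?w) =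
      T \<psi> (mset_val z (add_mset i \<rho>)) - sc (\<psi> 1) (mset_val z (add_mset i \<rho>)) - lower \<psi> (add_mset i \<rho>)"
    by (simp add: T lower_add scale_mult_right ring_distribs)
  finally show ?case by simp
qed

lemma T_mset_val_le: 
  assumes "set_mset \<rho> \<subseteq> Z" "functional \<psi>"
  shows "T \<psi> (mset_val z \<rho>) - sc (\<psi> 1) (mset_val z \<rho>) \<in> F (size \<rho>)"
proof -
  have "T \<psi> (mset_val z \<rho>) - sc (\<psi> 1) (mset_val z \<rho>) - lower \<psi> \<rho> + lower \<psi> \<rho> \<in> F (size \<rho>)"
    using T_mset_val[OF assms] F_mono[of "size \<rho> - 1" "size \<rho>"] lower_mem[OF assms(2,1)] F_subspace
    by (intro subspace_add) auto
  then show ?thesis by simp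
qed

text \<open>In top degree the operator acts through the coefficient only, because modulo lower
  degree it acts on the monomial as a scalar.\<close>

lemma T_mult_mset_val:
  assumes \<rho>: "set_mset \<rho> \<subseteq> Z" and \<psi>: "functional \<psi>" and a: "a \<in> A"
  shows "T \<psi> (a * mset_val z \<rho>) - T \<psi> a * mset_val z \<rho> \<in> F (size \<rho>)"
proof -
  obtain u where u: "set u \<subseteq> A \<times> A" "repr a u"
    using hopf_subalgebraD(7)[OF A a] by (auto simp: in_tensor_def)
  let ?w = "mset_val z \<rho>"
  have "T \<psi> a * ?w = ev (\<lambda>x y. sc (\<psi> x) y * ?w) u"
    unfolding T_repr[OF \<psi> u(2)] by (rule ev_hom) (auto simp: ring_distribs)
  then have "T \<psi> (a * ?w) = T \<psi> a * ?w + ev (\<lambda>x y. y * (T (\<lambda>v. \<psi> (x * v)) ?w - sc (\<psi> x) ?w)) u"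
    unfolding T_mult_repr[OF \<psi> u(2)]
    by (simp add: scale_mult[symmetric] scale_mult_right[symmetric] ring_distribs flip: ev_add_fun)
  moreover have "ev (\<lambda>x y. y * (T (\<lambda>v. \<psi> (x * v)) ?w - sc (\<psi> x) ?w)) u \<in> F (size \<rho>)"
  proof (rule ev_mem)
    fix x y assume xy: "(x, y) \<in> set u"
    show "y * (T (\<lambda>v. \<psi> (x * v)) ?w - sc (\<psi> x) ?w) \<in> F (size \<rho>)"
      using u(1) xy T_mset_val_le[OF \<rho> functional_mult[OF \<psi>], of x] by (intro F_mult_A) auto
  qed (use F_subspace in \<open>auto simp: subspace_def\<close>)
  ultimately show ?thesis by simp
qed

lemma T_F:
  assumes "functional \<psi>" "x \<in> F d"
  shows "T \<psi> x \<in> F d"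
  using assms(2)
proof (induction rule: F_induct)
  case (base a \<rho>)
  have "(T \<psi> (a * mset_val z \<rho>) - T \<psi> a * mset_val z \<rho>) + T \<psi> a * mset_val z \<rho> \<in> F d"
    using T_mult_mset_val[of \<rho> \<psi> a] F_mono[of "size \<rho>" d] base T_mem[OF A] F_subspace assms(1)
    by (intro subspace_add F_base) auto
  then show ?case by simp
qed (use F_subspace assms(1) in \<open>auto simp: subspace_def T_0 T_add T_scale\<close>)

text \<open>The coproduct of a coefficient lies in \<open>A \<otimes> A\<close>, so its slice by a
  functional vanishing on \<open>A\<close> is zero, and the part of top degree disappears.\<close>

lemma T_F_lower:
  assumes "functional \<psi>" "\<And>a. a \<in> A \<Longrightarrow> \<psi> a = 0" "x \<in> F (Suc d)"
  shows "T \<psi> x \<in> F d"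
  using assms(3)
proof (induction rule: F_induct)
  case (base a \<rho>)
  have "T \<psi> a = 0"
  proof -
    obtain u where u: "set u \<subseteq> A \<times> A" "repr a u"
      using hopf_subalgebraD(7)[OF A base(1)] by (auto simp: in_tensor_def)
    have "T \<psi> a = ev (\<lambda>x y. 0) u"
      unfolding T_repr[OF assms(1) u(2)] by (rule ev_cong) (use u(1) assms(2) in auto)
    then show ?thesis using ev_mem[of "{0::'b}" u "\<lambda>x y. 0"] by simp
  qed
  then show ?case using T_mult_mset_val[OF base(2) assms(1) base(1)] F_mono[of "size \<rho>" d] base by auto
qed (use F_subspace assms(1) in \<open>auto simp: subspace_def T_0 T_add T_scale\<close>)

text \<open>The general criterion with \<open>F d\<close> as the subspace passes from coefficients
  in the field to coefficients in \<open>A\<close>. Independence over the field is the hypothesis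
  \<open>ind\<close>, since the next proof has to supply it from its own induction
  hypothesis.\<close>

lemma monomials_indep_over_A:
  assumes ind: "\<And>R c. finite R \<Longrightarrow> (\<And>\<rho>. \<rho> \<in> R \<Longrightarrow> set_mset \<rho> \<subseteq> Z \<and> size \<rho> = d) \<Longrightarrow>
      (\<Sum>\<rho>\<in>R. sc (c \<rho>) (mset_val z \<rho>)) \<in> F d \<Longrightarrow> \<forall>\<rho>\<in>R. c \<rho> = 0"
    and "finite R" and R: "\<And>\<rho>. \<rho> \<in> R \<Longrightarrow> set_mset \<rho> \<subseteq> Z \<and> size \<rho> = d"
    and "\<And>\<rho>. \<rho> \<in> R \<Longrightarrow> a \<rho> \<in> A" "(\<Sum>\<rho>\<in>R. a \<rho> * mset_val z \<rho>) \<in> F d" "\<sigma> \<in> R"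
  shows "a \<sigma> = 0"
proof (rule independent_over_subalgebra[OF A, where N = "F d" and J = R and w = "mset_val z" and a = a])
  show "T \<psi> (mset_val z j) - sc (\<psi> 1) (mset_val z j) \<in> F d" if "functional \<psi>" "j \<in> R" for \<psi> j
    using T_mset_val_le[of j \<psi>] that R[OF that(2)] by auto
  show "\<forall>j\<in>R. c j = 0" if "(\<Sum>j\<in>R. sc (c j) (mset_val z j)) \<in> F d" for c
    by (rule ind[OF assms(2) R that])
qed (use assms F_mult_A T_F F_subspace in auto)

text \<open>A functional \<open>\<phi>\<close> that vanishes on \<open>A\<close> and on all \<open>z i\<close> but one lowers the degree of a relation by
  one; the counits of its new coefficients are the old ones times exponents, hence
  characteristic zero.\<close>
lemma monomials_indep:
  assumes "finite R" "\<And>\<rho>. \<rho> \<in> R \<Longrightarrow> set_mset \<rho> \<subseteq> Z \<and> size \<rho> = d"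
    "(\<Sum>\<rho>\<in>R. sc (c \<rho>) (mset_val z \<rho>)) \<in> F d"
  shows "\<forall>\<rho>\<in>R. c \<rho> = 0"
  using assms
proof (induction d arbitrary: R c)
  case 0
  have "R \<subseteq> {{#}}" using 0(2) by auto
  then have "R = {} \<or> R = {{#}}" by auto
  then show ?case using 0(3) by (auto simp: F_0)
next
  case (Suc d)
  show ?case
  proof
    fix \<sigma> assume \<sigma>: "\<sigma> \<in> R"
    then obtain t \<sigma>' where t: "\<sigma> = add_mset t \<sigma>'"
      using Suc.prems(2)[OF \<sigma>] by (metis size_eq_Suc_imp_eq_union)
    have tZ: "t \<in> Z" using Suc.prems(2)[OF \<sigma>] t by auto
    obtain \<phi> where \<phi>: "functional \<phi>" "\<And>w. w \<in> span (A \<union> z ` (Z - {t})) \<Longrightarrow> \<phi> w = 0" "\<phi> (z t) = 1"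
      using functional_exists[OF subspace_span z_indep[OF tZ]] by blast
    have \<phi>A: "\<phi> a = 0" if "a \<in> A" for a using \<phi>(2) that by (auto intro: span_base)
    have \<phi>1: "\<phi> 1 = 0" using \<phi>A A by (simp add: hopf_subalgebraD)
    \<comment> \<open>By \<open>eps_T\<close> and \<open>\<phi> 1 = 0\<close>, the counit of
      \<open>coef \<phi> i\<close> is \<open>\<phi> (z i)\<close>.\<close>
    have eps_coef: "eps (coef \<phi> i) = (if i = t then 1 else 0)" if "i \<in> Z" for i
      using \<phi>(2)[of "z i"] \<phi>(1,3) that by (auto simp: coef_def \<phi>1 eps_T intro: span_base)
    \<comment> \<open>The derivative of the relation along \<open>\<phi>\<close> is collected by
      monomials \<open>\<nu>\<close> of degree \<open>d\<close>: the variables in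
      \<open>I \<nu>\<close> lead from \<open>\<nu>\<close> back into \<open>R\<close>, and
      \<open>i\<close> occurs once more in \<open>add_mset i \<nu>\<close> than in
      \<open>\<nu>\<close>, whence the integer factor in \<open>a \<nu>\<close>.\<close>
    define R' where "R' = (\<lambda>(\<rho>, i). \<rho> - {#i#}) ` (SIGMA \<rho>:R. set_mset \<rho>)"
    define I where "I \<nu> = {i \<in> \<Union>(set_mset ` R). add_mset i \<nu> \<in> R}" for \<nu>
    define a where "a \<nu> = (\<Sum>i\<in>I \<nu>. sc (c (add_mset i \<nu>) * of_nat (count \<nu> i + 1)) (coef \<phi> i))" for \<nu>
    have fin: "finite R'" "finite (I \<nu>)" for \<nu>
      using Suc.prems(1) by (auto simp: R'_def I_def)
    have R': "set_mset \<nu> \<subseteq> Z \<and> size \<nu> = d" if "\<nu> \<in> R'" for \<nu>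
      using that Suc.prems(2) by (force simp: R'_def size_Diff_singleton dest: in_diffD)
    have IZ: "I \<nu> \<subseteq> Z" for \<nu> using Suc.prems(2) by (auto simp: I_def)
    have aA: "a \<nu> \<in> A" for \<nu>
      unfolding a_def using A IZ
      by (intro subspace_sum hopf_subalgebra_subspace) (auto intro!: hopf_subalgebraD coef_mem \<phi>)
    have "(\<Sum>\<rho>\<in>R. sc (c \<rho>) (lower \<phi> \<rho>)) = (\<Sum>\<nu>\<in>R'. a \<nu> * mset_val z \<nu>)"
    proof -
      have "(\<Sum>\<rho>\<in>R. sc (c \<rho>) (lower \<phi> \<rho>)) =
          (\<Sum>\<rho>\<in>R. \<Sum>i\<in>set_mset \<rho>. sc (c \<rho> * of_nat (count \<rho> i)) (coef \<phi> i * mset_val z (\<rho> - {#i#})))"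
      proof (rule sum.cong[OF HOL.refl])
        fix \<rho>
        show "sc (c \<rho>) (lower \<phi> \<rho>) =
          (\<Sum>i\<in>set_mset \<rho>. sc (c \<rho> * of_nat (count \<rho> i)) (coef \<phi> i * mset_val z (\<rho> - {#i#})))"
          unfolding lower_def by (simp add: sum_mset_count scale_sum_right)
      qed
      also have "\<dots> = (\<Sum>(\<rho>, i)\<in>(SIGMA \<rho>:R. set_mset \<rho>). sc (c \<rho> * of_nat (count \<rho> i)) (coef \<phi> i * mset_val z (\<rho> - {#i#})))"
        using Suc.prems(1) by (subst sum.Sigma) auto
      also have "\<dots> = (\<Sum>(\<nu>, i)\<in>(SIGMA \<nu>:R'. I \<nu>). sc (c (add_mset i \<nu>) * of_nat (count \<nu> i + 1)) (coef \<phi> i * mset_val z \<nu>))"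
        by (rule sum.reindex_bij_witness[where i = "\<lambda>(\<nu>, i). (add_mset i \<nu>, i)" and j = "\<lambda>(\<rho>, i). (\<rho> - {#i#}, i)"])
          (auto simp: R'_def I_def)
      also have "\<dots> = (\<Sum>\<nu>\<in>R'. \<Sum>i\<in>I \<nu>. sc (c (add_mset i \<nu>) * of_nat (count \<nu> i + 1)) (coef \<phi> i * mset_val z \<nu>))"
        using fin by (subst sum.Sigma) auto
      finally show ?thesis by (simp only: a_def sum_distrib_right scale_mult)
    qed
    \<comment> \<open>\<open>T \<phi>\<close> sends the relation from \<open>F (Suc d)\<close> to
      \<open>F d\<close>, and on monomials of degree \<open>Suc d\<close> it agrees with
      \<open>lower \<phi>\<close> modulo \<open>F d\<close>, since
      \<open>\<phi> 1 = 0\<close>.\<close>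
    moreover have "(\<Sum>\<rho>\<in>R. sc (c \<rho>) (lower \<phi> \<rho>)) \<in> F d"
    proof -
      have "(\<Sum>\<rho>\<in>R. sc (c \<rho>) (T \<phi> (mset_val z \<rho>))) \<in> F d"
        using T_F_lower[OF \<phi>(1) \<phi>A Suc.prems(3)] by (simp add: T_sum[OF \<phi>(1)] T_scale[OF \<phi>(1)])
      moreover have "(\<Sum>\<rho>\<in>R. sc (c \<rho>) (T \<phi> (mset_val z \<rho>) - lower \<phi> \<rho>)) \<in> F d"
      proof (intro subspace_sum subspace_scale F_subspace)
        fix \<rho> assume "\<rho> \<in> R"
        then show "T \<phi> (mset_val z \<rho>) - lower \<phi> \<rho> \<in> F d"
          using T_mset_val[OF _ \<phi>(1), of \<rho>] Suc.prems(2)[of \<rho>] by (simp add: \<phi>1)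
      qed
      ultimately have "(\<Sum>\<rho>\<in>R. sc (c \<rho>) (T \<phi> (mset_val z \<rho>))) -
          (\<Sum>\<rho>\<in>R. sc (c \<rho>) (T \<phi> (mset_val z \<rho>) - lower \<phi> \<rho>)) \<in> F d"
        using F_subspace by (intro subspace_diff)
      then show ?thesis by (simp add: scale_right_diff_distrib sum_subtractf)
    qed
    ultimately have rel: "(\<Sum>\<nu>\<in>R'. a \<nu> * mset_val z \<nu>) \<in> F d" by simp
    have \<sigma>': "\<sigma>' \<in> R'" using \<sigma> t by (force simp: R'_def)
    have "a \<sigma>' = 0"
      by (rule monomials_indep_over_A[OF _ fin(1) R' aA rel \<sigma>']) (rule Suc.IH)
    \<comment> \<open>Only \<open>i = t\<close> contributes to this counit, so it is
      \<open>c \<sigma>\<close> times a positive integer.\<close>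
    then have "eps (a \<sigma>') = 0" using functional_0[OF eps_functional] by simp
    also have "eps (a \<sigma>') = (\<Sum>i\<in>I \<sigma>'. c (add_mset i \<sigma>') * of_nat (count \<sigma>' i + 1) * (if i = t then 1 else 0))"
      unfolding a_def functional_sum[OF eps_functional] functional_scale[OF eps_functional]
    proof (rule sum.cong[OF HOL.refl])
      fix i assume "i \<in> I \<sigma>'"
      then have "i \<in> Z" using IZ by blast
      then show "c (add_mset i \<sigma>') * of_nat (count \<sigma>' i + 1) * eps (coef \<phi> i) =
          c (add_mset i \<sigma>') * of_nat (count \<sigma>' i + 1) * (if i = t then 1 else 0)"
        by (simp only: eps_coef)
    qed
    also have "\<dots> = (\<Sum>i\<in>I \<sigma>'. if i = t then c \<sigma> * of_nat (count \<sigma>' t + 1) else 0)"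
      by (rule sum.cong) (auto simp: t)
    also have "\<dots> = c \<sigma> * of_nat (count \<sigma>' t + 1)"
    proof -
      have "t \<in> I \<sigma>'" using \<sigma> t by (auto simp: I_def intro!: bexI[of _ \<sigma>])
      then show ?thesis using fin(2)[of \<sigma>'] by simp
    qed
    finally have "c \<sigma> = 0 \<or> (of_nat (count \<sigma>' t + 1) :: 'k) = 0" by (simp only: mult_eq_0_iff)
    then show "c \<sigma> = 0" using of_nat_neq_0[of "count \<sigma>' t", where 'a = 'k] by simp
  qed
qed

text \<open>The terms below the top degree \<open>d\<close> lie in \<open>F d\<close>, so the
  coefficients in degree \<open>d\<close> vanish; they are removed, and the degree bound
  drops.\<close>

lemma alg_independent:
  assumes "finite R" "\<And>\<rho>. \<rho> \<in> R \<Longrightarrow> set_mset \<rho> \<subseteq> Z" "\<And>\<rho>. \<rho> \<in> R \<Longrightarrow> a \<rho> \<in> A"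
    "(\<Sum>\<rho>\<in>R. a \<rho> * mset_val z \<rho>) = 0"
  shows "\<forall>\<rho>\<in>R. a \<rho> = 0"
proof -
  have "\<forall>\<rho>\<in>R. a \<rho> = 0" if "\<And>\<rho>. \<rho> \<in> R \<Longrightarrow> size \<rho> < d" for d
    using assms that
  proof (induction d arbitrary: R)
    case (Suc d)
    let ?H = "{\<rho> \<in> R. size \<rho> = d}" and ?L = "{\<rho> \<in> R. size \<rho> < d}"
    have R: "R = ?H \<union> ?L" using Suc.prems(5) by (auto simp: less_Suc_eq)
    have s: "(\<Sum>\<rho>\<in>?H. a \<rho> * mset_val z \<rho>) + (\<Sum>\<rho>\<in>?L. a \<rho> * mset_val z \<rho>) = 0"
      using Suc.prems(1,4) by (subst sum.union_disjoint[symmetric]) (auto simp flip: R)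
    have L: "(\<Sum>\<rho>\<in>?L. a \<rho> * mset_val z \<rho>) \<in> F d"
      using Suc.prems by (intro subspace_sum F_subspace F_base) auto
    have "(\<Sum>\<rho>\<in>?H. a \<rho> * mset_val z \<rho>) = - (\<Sum>\<rho>\<in>?L. a \<rho> * mset_val z \<rho>)"
      using s by (simp only: eq_neg_iff_add_eq_0)
    then have "(\<Sum>\<rho>\<in>?H. a \<rho> * mset_val z \<rho>) \<in> F d"
      using subspace_neg[OF F_subspace L] by simp
    then have H: "a \<rho> = 0" if "\<rho> \<in> ?H" for \<rho>
      using Suc.prems
      by (intro monomials_indep_over_A[where R = ?H and d = d, OF monomials_indep _ _ _ _ that]) auto
    then have "(\<Sum>\<rho>\<in>?L. a \<rho> * mset_val z \<rho>) = 0" using s by simp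
    then have "\<forall>\<rho>\<in>?L. a \<rho> = 0"
      using Suc.prems by (intro Suc.IH) auto
    then show ?case using R H by blast
  qed auto
  moreover have "\<rho> \<in> R \<Longrightarrow> size \<rho> < Suc (sum size R)" for \<rho>
    using assms(1) by (simp add: le_imp_less_Suc member_le_sum)
  ultimately show ?thesis by blast
qed

end

section \<open>Generators of a differential Hopf algebra\<close>

context hopf
begin

text \<open>The formal difference of \<open>cop b\<close> and \<open>u\<close> has only zero slices.
  Rewritten with right factors in the zero subspace, it is annihilated by every balanced
  map.\<close>

lemma repr_if_slices:
  assumes "\<And>\<psi>. functional \<psi> \<Longrightarrow> T \<psi> b = ev (\<lambda>x y. sc (\<psi> x) y) u"
  shows "repr b u"
  unfolding repr_def
proof (intro allI impI)
  fix f assume f: "balanced f"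
  let ?w = "cop b @ map (\<lambda>p. (fst p, - snd p)) u"
  have w: "ev g ?w = ev g (cop b) - ev g u" if "balanced g" for g
  proof -
    have "g x (- y) = - g x y" for x y
      using balanced_add(2)[OF that, of x y "- y"] balanced_0[OF that] by (simp add: eq_neg_iff_add_eq_0 add.commute)
    then have "ev g (map (\<lambda>p. (fst p, - snd p)) u) = - ev g u"
      by (induction u) auto
    then show ?thesis by simp
  qed
  have "ev (\<lambda>x y. sc (\<psi> x) y) ?w \<in> {0}" if "functional \<psi>" for \<psi>
    using assms[OF that] w[OF balanced_T[OF that]] by (simp add: T_def)
  then obtain v where v: "set v \<subseteq> fst ` set ?w \<times> {0}" "\<And>f. balanced f \<Longrightarrow> ev f ?w = ev f v"
    using slices_left by blast
  have "ev f v \<in> {0}"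
    by (rule ev_mem) (use v(1) balanced_0[OF f] in auto)
  then show "ev f (cop b) = ev f u" using w[OF f] v(2)[OF f] by simp
qed

lemma cop_0: "balanced f \<Longrightarrow> ev f (cop 0) = 0"
  using cop_add[of f 0 0] by simp

lemma cop_sum: "balanced f \<Longrightarrow> ev f (cop (sum a J)) = (\<Sum>j\<in>J. ev f (cop (a j)))"
  by (induction J rule: infinite_finite_induct) (auto simp: cop_0 cop_add)

lemma S_sum: "S (sum f J) = (\<Sum>j\<in>J. S (f j))"
  by (induction J rule: infinite_finite_induct) (auto simp: S_0 S_add)

text \<open>This is coassociativity; the functional on the right is the convolution of
  \<open>\<psi>\<close> and \<open>\<phi>\<close>. In particular the slices of an element span a
  space stable under all \<open>T \<phi>\<close>.\<close>

lemma T_T: assumes "functional \<psi>" "functional \<phi>" shows "T \<phi> (T \<psi> b) = T (\<lambda>x. \<phi> (T \<psi> x)) b"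
proof -
  have "T \<phi> (T \<psi> b) = ev (\<lambda>x y. T \<phi> (sc (\<psi> x) y)) (cop b)"
    unfolding T_def[of \<psi> b] by (rule ev_hom) (auto simp: assms T_0 T_add)
  also have "\<dots> = ev (\<lambda>x y. ev (\<lambda>p q. sc (\<psi> x * \<phi> p) q) (cop y)) (cop b)"
  proof (rule ev_cong)
    fix x y
    have "T \<phi> (sc (\<psi> x) y) = sc (\<psi> x) (ev (\<lambda>p q. sc (\<phi> p) q) (cop y))"
      by (simp add: T_scale assms) (simp add: T_def)
    also have "\<dots> = ev (\<lambda>p q. sc (\<psi> x * \<phi> p) q) (cop y)"
      by (subst ev_hom[where h = "sc (\<psi> x)"]) (auto simp: scale_right_distrib)
    finally show "T \<phi> (sc (\<psi> x) y) = ev (\<lambda>p q. sc (\<psi> x * \<phi> p) q) (cop y)" .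
  qed
  also have "\<dots> = ev (\<lambda>x z. ev (\<lambda>p q. sc (\<psi> p * \<phi> q) z) (cop x)) (cop b)"
    by (rule coassoc[symmetric])
      (auto simp: balanced_def functional_add[OF assms(1)] functional_add[OF assms(2)] functional_scale[OF assms(1)]
        functional_scale[OF assms(2)] scale_left_distrib scale_right_distrib algebra_simps)
  also have "\<dots> = T (\<lambda>x. \<phi> (T \<psi> x)) b"
    unfolding T_def[of "\<lambda>x. \<phi> (T \<psi> x)"]
  proof (rule ev_cong)
    fix x z
    have "\<phi> (T \<psi> x) = ev (\<lambda>p q. \<psi> p * \<phi> q) (cop x)"
      by (simp add: T_def functional_ev[OF assms(2)] functional_scale[OF assms(2)])
    then show "ev (\<lambda>p q. sc (\<psi> p * \<phi> q) z) (cop x) = sc (\<phi> (T \<psi> x)) z"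
      by (simp, subst ev_hom[where h = "\<lambda>c. sc c z"]) (auto simp: scale_left_distrib)
  qed
  finally show ?thesis .
qed

lemma functional_T: "functional \<psi> \<Longrightarrow> functional \<phi> \<Longrightarrow> functional (\<lambda>x. \<phi> (T \<psi> x))"
  by (auto simp: functional_def[of "\<lambda>x. \<phi> (T \<psi> x)"] T_add T_scale functional_add functional_scale)

text \<open>\<open>E\<close> is a basis of a finite-dimensional comodule, and the \<open>X q s\<close> are its matrix coefficients.\<close>
lemma matrix_coefficients:
  assumes "finite \<Sigma>"
  obtains E :: "'b set" and X :: "'b \<Rightarrow> 'b \<Rightarrow> 'b" where "finite E"
    "\<And>f q s. balanced f \<Longrightarrow> q \<in> E \<Longrightarrow> s \<in> E \<Longrightarrow> ev f (cop (X q s)) = (\<Sum>r\<in>E. f (X q r) (X r s))"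
    "\<And>q s. q \<in> E \<Longrightarrow> s \<in> E \<Longrightarrow> eps (X q s) = (if q = s then 1 else 0)"
    "\<Sigma> \<subseteq> span {X q s |q s. q \<in> E \<and> s \<in> E}"
proof -
  \<comment> \<open>The slices of the given elements span a subcomodule, by \<open>T_T\<close>. It
    is finite-dimensional, since each slice lies in the span of the right factors of a chosen
    coproduct, and it contains \<open>\<Sigma>\<close>, since slicing by the counit is the
    identity.\<close>
  define V where "V = span {T \<psi> b |\<psi> b. functional \<psi> \<and> b \<in> \<Sigma>}"
  define P where "P = (\<Union>b\<in>\<Sigma>. snd ` set (cop b))"
  have finP: "finite P" using assms by (auto simp: P_def)
  have "V \<subseteq> span P"
    unfolding V_def
  proof (rule span_minimal)
    show "{T \<psi> b |\<psi> b. functional \<psi> \<and> b \<in> \<Sigma>} \<subseteq> span P"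
    proof clarify
      fix \<psi> b assume b: "b \<in> \<Sigma>"
      show "T \<psi> b \<in> span P"
        unfolding T_def
      proof (rule ev_mem)
        fix x y assume "(x, y) \<in> set (cop b)"
        then have "y \<in> P" using b by (force simp: P_def)
        then show "sc (\<psi> x) y \<in> span P" by (intro span_scale span_base)
      qed (auto intro: span_add span_zero)
    qed
  qed auto
  obtain E0 where E0: "E0 \<subseteq> V" "independent E0" "V \<subseteq> span E0"
    using basis_exists[of V] by metis
  have "finite E0"
    using independent_span_bound[OF finP E0(2)] E0(1) \<open>V \<subseteq> span P\<close> by auto
  then obtain E \<psi> where fin: "finite E" and E: "E \<subseteq> E0" "\<And>e. e \<in> E \<Longrightarrow> functional (\<psi> e)"
    "\<And>p. p \<in> span E0 \<Longrightarrow> p = (\<Sum>e\<in>E. sc (\<psi> e p) e)"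
    "\<And>e e'. e \<in> E \<Longrightarrow> e' \<in> E \<Longrightarrow> \<psi> e e' = (if e = e' then 1 else 0)"
    by (rule dual_basis) (rule that, assumption+)
  have EV: "E \<subseteq> V" using E(1) E0(1) by blast
  have expand: "p = (\<Sum>e\<in>E. sc (\<psi> e p) e)" if "p \<in> V" for p
    using E(3) E0(3) that by blast
  have TV: "T \<phi> v \<in> V" if \<phi>: "functional \<phi>" and "v \<in> V" for \<phi> v
    using that(2)[unfolded V_def]
  proof (induction rule: span_induct_alt)
    case base
    then show ?case by (simp add: T_0 \<phi> V_def span_zero)
  next
    case (step c x y)
    then obtain \<psi> b where x: "x = T \<psi> b" "functional \<psi>" "b \<in> \<Sigma>" by auto
    have "T \<phi> x \<in> V"
      unfolding V_def x(1) T_T[OF x(2) \<phi>] by (rule span_base) (use x functional_T[OF x(2) \<phi>] in blast)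
    then show ?case using step by (simp add: T_add T_scale \<phi> V_def span_add span_scale)
  qed
  \<comment> \<open>The coefficient of the basis vector \<open>s\<close> in the right factors: the
    coproduct of \<open>q\<close> is the sum of \<open>X q s \<otimes> s\<close> over
    \<open>s\<close>.\<close>
  define X where "X q s = ev (\<lambda>x y. sc (\<psi> s y) x) (cop q)" for q s
  have balanced\<psi>: "balanced (\<lambda>x y. sc (\<psi> s y) x)" if "s \<in> E" for s
    using E(2)[OF that]
    by (auto simp: balanced_def functional_add functional_scale scale_left_distrib scale_right_distrib mult.commute)
  have cop_E: "ev f (cop q) = (\<Sum>r\<in>E. f (X q r) r)" if f: "balanced f" and q: "q \<in> E" for f q
  proof -
    have "ev (\<lambda>x y. sc (\<phi> x) y) (cop q) \<in> V" if "functional \<phi>" for \<phi>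
      using TV[OF that, of q] EV q by (auto simp: T_def)
    then obtain v where v: "set v \<subseteq> fst ` set (cop q) \<times> V" "\<And>f. balanced f \<Longrightarrow> ev f (cop q) = ev f v"
      using slices_left by blast
    have "ev f v = ev (\<lambda>x y. \<Sum>r\<in>E. f (sc (\<psi> r y) x) r) v"
    proof (rule ev_cong)
      fix x y assume "(x, y) \<in> set v"
      then have "y = (\<Sum>e\<in>E. sc (\<psi> e y) e)" using v(1) expand by blast
      then have "f x y = f x (\<Sum>e\<in>E. sc (\<psi> e y) e)" by simp
      also have "\<dots> = (\<Sum>r\<in>E. f (sc (\<psi> r y) x) r)"
        by (rule balanced_sum_scale(2)[OF f, of x "\<lambda>e. \<psi> e y" "\<lambda>e. e" E])
      finally show "f x y = (\<Sum>r\<in>E. f (sc (\<psi> r y) x) r)" .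
    qed
    also have "\<dots> = (\<Sum>r\<in>E. f (ev (\<lambda>x y. sc (\<psi> r y) x) v) r)"
      unfolding ev_sum
      by (rule sum.cong[OF HOL.refl], rule ev_hom[symmetric]) (auto simp: balanced_0[OF f] balanced_add[OF f])
    also have "\<dots> = (\<Sum>r\<in>E. f (X q r) r)"
      unfolding X_def by (rule sum.cong[OF HOL.refl]) (simp add: v(2)[OF balanced\<psi>])
    finally show ?thesis using v(2)[OF f] by simp
  qed
  \<comment> \<open>Comparing the coefficients of \<open>s\<close> on both sides of coassociativity
    for \<open>q\<close> gives the matrix coproduct.\<close>
  have X: "repr (X q s) (map (\<lambda>r. (X q r, X r s)) es)"
    if q: "q \<in> E" and s: "s \<in> E" and es: "set es = E" "distinct es" for q s es
  proof (rule repr_if_slices)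
    fix \<phi> assume \<phi>: "functional \<phi>"
    have T: "T \<phi> (X q s) = ev (\<lambda>x z. ev (\<lambda>p r. sc (\<psi> s z) (sc (\<phi> p) r)) (cop x)) (cop q)"
    proof -
      have "T \<phi> (X q s) = ev (\<lambda>x z. T \<phi> (sc (\<psi> s z) x)) (cop q)"
        unfolding X_def by (rule ev_hom) (auto simp: \<phi> T_0 T_add)
      moreover have "T \<phi> (sc (\<psi> s z) x) = ev (\<lambda>p r. sc (\<psi> s z) (sc (\<phi> p) r)) (cop x)" for x z
        unfolding T_scale[OF \<phi>] unfolding T_def by (rule ev_hom) (auto simp: scale_right_distrib)
      ultimately show ?thesis by simp
    qed
    also have "\<dots> = ev (\<lambda>x y. ev (\<lambda>p t. sc (\<psi> s t) (sc (\<phi> x) p)) (cop y)) (cop q)"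
      using E(2)[OF s] \<phi>
      by (intro coassoc) (auto simp: balanced_def functional_add functional_scale scale_left_distrib scale_right_distrib algebra_simps)
    also have "\<dots> = ev (\<lambda>x y. sc (\<phi> x) (X y s)) (cop q)"
      unfolding X_def
      by (intro ev_cong, subst ev_hom[where h = "sc _"]) (auto simp: scale_right_distrib mult.commute)
    also have "\<dots> = (\<Sum>r\<in>E. sc (\<phi> (X q r)) (X r s))"
    proof (rule cop_E[OF _ q])
      have "X (a + b) s = X a s + X b s" for a b
        unfolding X_def by (rule cop_add[OF balanced\<psi>[OF s]])
      moreover have "X (sc c a) s = sc c (X a s)" for c a
      proof -
        have "X (sc c a) s = ev (\<lambda>x y. sc (\<psi> s y) (sc c x)) (cop a)"
          unfolding X_def by (rule cop_scale[OF balanced\<psi>[OF s]])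
        also have "\<dots> = ev (\<lambda>x y. sc c (sc (\<psi> s y) x)) (cop a)" by (simp add: mult.commute)
        also have "\<dots> = sc c (X a s)"
          unfolding X_def by (rule ev_hom[symmetric]) (auto simp: scale_right_distrib)
        finally show ?thesis .
      qed
      ultimately show "balanced (\<lambda>x y. sc (\<phi> x) (X y s))"
        using \<phi> by (auto simp: balanced_def functional_add functional_scale scale_left_distrib scale_right_distrib mult.commute)
    qed
    finally show "T \<phi> (X q s) = ev (\<lambda>x y. sc (\<phi> x) y) (map (\<lambda>r. (X q r, X r s)) es)"
      using es by (simp add: ev_map sum_list_distinct_conv_sum_set)
  qed
  obtain es where es: "set es = E" "distinct es" using fin finite_distinct_list by blast
  have copX: "ev f (cop (X q s)) = (\<Sum>r\<in>E. f (X q r) (X r s))" if "balanced f" "q \<in> E" "s \<in> E" for f q s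
    using repr_D[OF X[OF that(2,3) es] that(1)] es by (simp add: ev_map sum_list_distinct_conv_sum_set)
  have epsX: "eps (X q s) = (if q = s then 1 else 0)" if q: "q \<in> E" and s: "s \<in> E" for q s
  proof -
    have "eps (X q s) = ev (\<lambda>x y. \<psi> s y * eps x) (cop q)"
      unfolding X_def by (simp add: functional_ev[OF eps_functional] functional_scale[OF eps_functional])
    also have "\<dots> = \<psi> s (ev (\<lambda>x y. sc (eps x) y) (cop q))"
      using E(2)[OF s] by (simp add: functional_ev functional_scale mult.commute)
    finally show ?thesis using E(4)[OF s q] by (auto simp: counit_left)
  qed
  have "\<Sigma> \<subseteq> span {X q s |q s. q \<in> E \<and> s \<in> E}"
  proof
    fix b assume b: "b \<in> \<Sigma>"
    have "T eps b \<in> V" unfolding V_def by (rule span_base) (use b eps_functional in blast)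
    then have bV: "b \<in> V" by (simp add: T_def counit_left)
    have q: "q \<in> span {X q s |q s. q \<in> E \<and> s \<in> E}" if q: "q \<in> E" for q
    proof -
      have "balanced (\<lambda>x y. sc (eps y) x)"
        using eps_functional
        by (auto simp: balanced_def functional_add functional_scale scale_left_distrib scale_right_distrib mult.commute)
      from cop_E[OF this q] have "q = (\<Sum>r\<in>E. sc (eps r) (X q r))" by (simp add: counit_right)
      also have "\<dots> \<in> span {X q s |q s. q \<in> E \<and> s \<in> E}"
        using q by (intro span_sum span_scale span_base) auto
      finally show ?thesis .
    qed
    show "b \<in> span {X q s |q s. q \<in> E \<and> s \<in> E}"
      by (subst expand[OF bV]) (intro span_sum span_scale q)
  qed
  from that[of E X, OF fin copX epsX this] show thesis .
qed

end

section \<open>Differential Hopf algebras and logarithmic derivatives\<close>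

locale dhopf = hopf sc cop eps S
  for sc :: "'k::field_char_0 \<Rightarrow> 'b::comm_ring_1 \<Rightarrow> 'b" and cop eps S +
  fixes scD :: "'k \<Rightarrow> 'd::ab_group_add \<Rightarrow> 'd" and br :: "'d \<Rightarrow> 'd \<Rightarrow> 'd" and \<theta> :: "'d \<Rightarrow> 'k \<Rightarrow> 'k"
    and D :: "'d \<Rightarrow> 'b \<Rightarrow> 'b" and bas :: "nat \<Rightarrow> 'd" and h :: nat
  assumes D_add: "D x (a + b) = D x a + D x b"
    and D_mult: "D x (a * b) = D x a * b + a * D x b"
    and D_scale: "D x (sc c a) = sc (\<theta> x c) a + sc c (D x a)"
    and D_plus: "D (x + y) a = D x a + D y a"
    and D_scD: "D (scD c x) a = sc c (D x a)"
    and D_br: "D (br x y) a = D x (D y a) - D y (D x a)"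
    and cop_D: "balanced f \<Longrightarrow> ev f (cop (D x a)) = ev (\<lambda>p q. f (D x p) q + f p (D x q)) (cop a)"
    and S_D: "S (D x a) = D x (S a)"
    and bas: "\<exists>c. x = (\<Sum>i<h. scD (c i) (bas i))"
begin

lemma D_0: "D x 0 = 0"
  using D_add[of x 0 0] by simp

lemma D_sum: "D x (sum f J) = (\<Sum>j\<in>J. D x (f j))"
  by (induction J rule: infinite_finite_induct) (auto simp: D_0 D_add)

lemma D_one: "D x 1 = 0"
  using D_mult[of x 1 1] by simp

lemma balanced_D: assumes "balanced f" shows "balanced (\<lambda>p q. f (D x p) q + f p (D x q))"
  using balanced_add[OF assms] balanced_scale[OF assms]
  by (auto simp: balanced_def D_add D_scale algebra_simps)

lemma cop_D_repr:
  assumes "balanced f" "repr a u"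
  shows "ev f (cop (D x a)) = ev (\<lambda>p q. f (D x p) q + f p (D x q)) u"
  unfolding cop_D[OF assms(1)] by (rule repr_D[OF assms(2) balanced_D[OF assms(1)]])

text \<open>The generators are the entries of the matrix \<open>X\<close> and of its inverse \<open>Y\<close>, together with the
  entries of the logarithmic derivatives \<open>Y * D x X\<close>.\<close>
lemma hopf_generators:
  assumes "finite \<Sigma>"
  obtains XS LS where "finite XS" "finite LS" "\<Sigma> \<subseteq> span XS"
    "\<And>a. a \<in> XS \<Longrightarrow> in_tensor XS XS a" "\<And>a. a \<in> XS \<Longrightarrow> S a \<in> XS"
    "\<And>l. l \<in> LS \<Longrightarrow> \<exists>u. set u \<subseteq> LS \<times> {a * b |a b. a \<in> XS \<and> b \<in> XS} \<and> repr l ((1, l) # u)"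
    "\<And>l. l \<in> LS \<Longrightarrow> \<exists>u x. set u \<subseteq> XS \<times> XS \<and> S l = ev (\<lambda>a b. a * D x b) u"
    "\<And>i a. i < h \<Longrightarrow> a \<in> XS \<Longrightarrow> \<exists>u c. set u \<subseteq> XS \<times> LS \<and> D (bas i) a = sc c (ev (\<lambda>a l. a * l) u)"
proof -
  obtain E :: "'b set" and X :: "'b \<Rightarrow> 'b \<Rightarrow> 'b" where fin: "finite E"
    and copX: "\<And>f q s. balanced f \<Longrightarrow> q \<in> E \<Longrightarrow> s \<in> E \<Longrightarrow> ev f (cop (X q s)) = (\<Sum>r\<in>E. f (X q r) (X r s))"
    and epsX: "\<And>q s. q \<in> E \<Longrightarrow> s \<in> E \<Longrightarrow> eps (X q s) = (if q = s then 1 else 0)"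
    and \<Sigma>: "\<Sigma> \<subseteq> span {X q s |q s. q \<in> E \<and> s \<in> E}"
    by (rule matrix_coefficients[OF assms]) (rule that, assumption+)
  obtain es where es: "set es = E" "distinct es" using fin finite_distinct_list by blast
  note es_sum = ev_map sum_list_distinct_conv_sum_set[OF es(2)] es(1)
  \<comment> \<open>The inverse matrix: as the counit of \<open>X\<close> is the identity matrix,
    the antipode laws read \<open>Y X = 1\<close> and \<open>X Y = 1\<close>.\<close>
  define Y where "Y q s = S (X q s)" for q s
  have YX: "(\<Sum>r\<in>E. Y q r * X r s) = (if q = s then 1 else 0)" if "q \<in> E" "s \<in> E" for q s
    using antipode_left[of "X q s"] copX[OF balanced_antipode that] that by (simp add: epsX Y_def)
  have balanced_antipode': "balanced (\<lambda>x y. x * S y)"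
    by (auto simp: balanced_def S_add S_scale ring_distribs scale_mult_right[symmetric] scale_mult[symmetric])
  have XY: "(\<Sum>r\<in>E. X q r * Y r s) = (if q = s then 1 else 0)" if "q \<in> E" "s \<in> E" for q s
    using antipode_right[of "X q s"] copX[OF balanced_antipode' that] that by (simp add: epsX Y_def)
  \<comment> \<open>The antipode applied to \<open>X Y = 1\<close> shows that \<open>S Y\<close> is
    a right inverse of \<open>Y\<close>; multiplication by \<open>X\<close> from the left identifies
    it with \<open>X\<close>.\<close>
  have SY: "S (Y q s) = X q s" if "q \<in> E" "s \<in> E" for q s
  proof -
    have "S (Y q s) = (\<Sum>t\<in>E. (if q = t then 1 else 0) * S (Y t s))"
      using that fin by (simp add: if_distrib[where f = "\<lambda>c. c * _"] cong: if_cong)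
    also have "\<dots> = (\<Sum>t\<in>E. (\<Sum>r\<in>E. X q r * Y r t) * S (Y t s))"
      using that by (intro sum.cong) (auto simp: XY)
    also have "\<dots> = (\<Sum>t\<in>E. \<Sum>r\<in>E. X q r * (Y r t * S (Y t s)))"
      by (simp add: sum_distrib_right mult.assoc)
    also have "\<dots> = (\<Sum>r\<in>E. X q r * (\<Sum>t\<in>E. Y r t * S (Y t s)))"
      by (subst sum.swap) (simp add: sum_distrib_left)
    also have "\<dots> = (\<Sum>r\<in>E. X q r * S (\<Sum>t\<in>E. X r t * Y t s))"
      by (simp add: S_sum S_mult Y_def)
    also have "\<dots> = (\<Sum>r\<in>E. if r = s then X q r else 0)"
      using that by (intro sum.cong) (auto simp: XY S_one S_0)
    finally show ?thesis using that fin by simp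
  qed
  have copY: "ev f (cop (Y q w)) = (\<Sum>v\<in>E. f (Y v w) (Y q v))"
    if f: "balanced f" and q: "q \<in> E" and w: "w \<in> E" for f q w
  proof -
    \<comment> \<open>\<open>?g s v\<close> multiplies by one term of the expected coproduct of
      \<open>Y s w\<close>. Summed over the coproduct of \<open>Y X\<close>, it is evaluated in two
      ways: \<open>Y X = 1\<close> leaves the expected value, while the coproduct of
      \<open>X\<close> and two uses of \<open>X Y = 1\<close> leave the actual coproduct of
      \<open>Y q w\<close>.\<close>
    let ?g = "\<lambda>s v x y. f (x * Y v w) (y * Y s v)"
    have bg: "balanced (?g s v)" for s v
      using f by (auto simp: balanced_def ring_distribs scale_mult[symmetric])
    have "(\<Sum>s\<in>E. \<Sum>v\<in>E. \<Sum>r\<in>E. ev (?g s v) (cop (Y q r * X r s))) =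
        (\<Sum>s\<in>E. \<Sum>v\<in>E. if s = q then f (Y v w) (Y q v) else 0)"
    proof (intro sum.cong HOL.refl)
      fix s v assume s: "s \<in> E" and v: "v \<in> E"
      have "(\<Sum>r\<in>E. ev (?g s v) (cop (Y q r * X r s))) = ev (?g s v) (cop (if q = s then 1 else 0))"
        unfolding cop_sum[OF bg, symmetric] YX[OF q s] ..
      then show "(\<Sum>r\<in>E. ev (?g s v) (cop (Y q r * X r s))) = (if s = q then f (Y v w) (Y q v) else 0)"
        by (auto simp: cop_0[OF bg] cop_one[OF bg])
    qed
    also have "\<dots> = (\<Sum>v\<in>E. f (Y v w) (Y q v))"
      using q fin by (subst sum.swap) simp
    finally have 1: "(\<Sum>s\<in>E. \<Sum>v\<in>E. \<Sum>r\<in>E. ev (?g s v) (cop (Y q r * X r s))) = (\<Sum>v\<in>E. f (Y v w) (Y q v))" .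
    have "(\<Sum>s\<in>E. \<Sum>v\<in>E. \<Sum>r\<in>E. ev (?g s v) (cop (Y q r * X r s))) =
        (\<Sum>r\<in>E. \<Sum>s\<in>E. \<Sum>v\<in>E. ev (?g s v) (cop (Y q r * X r s)))"
      by (subst (2) sum.swap) (subst sum.swap, rule HOL.refl)
    also have "\<dots> = (\<Sum>r\<in>E. ev (\<lambda>x y. if r = w then f x y else 0) (cop (Y q r)))"
    proof (intro sum.cong HOL.refl)
      fix r assume r: "r \<in> E"
      have "(\<Sum>s\<in>E. \<Sum>v\<in>E. ev (?g s v) (cop (Y q r * X r s))) =
          (\<Sum>s\<in>E. \<Sum>v\<in>E. ev (\<lambda>x y. \<Sum>u\<in>E. ?g s v (x * X r u) (y * X u s)) (cop (Y q r)))"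
      proof (intro sum.cong HOL.refl)
        fix s v assume s: "s \<in> E"
        have "balanced (\<lambda>x' y'. ?g s v (x * x') (y * y'))" for x y
          using f by (auto simp: balanced_def ring_distribs scale_mult_right[symmetric] scale_mult[symmetric])
        then show "ev (?g s v) (cop (Y q r * X r s)) =
            ev (\<lambda>x y. \<Sum>u\<in>E. ?g s v (x * X r u) (y * X u s)) (cop (Y q r))"
          unfolding cop_mult[OF bg] using copX[OF _ r s] by simp
      qed
      also have "\<dots> = ev (\<lambda>x y. \<Sum>s\<in>E. \<Sum>v\<in>E. \<Sum>u\<in>E. ?g s v (x * X r u) (y * X u s)) (cop (Y q r))"
        by (simp add: ev_sum)
      also have "\<dots> = ev (\<lambda>x y. if r = w then f x y else 0) (cop (Y q r))"
      proof (rule ev_cong)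
        fix x y
        have "(\<Sum>s\<in>E. \<Sum>v\<in>E. \<Sum>u\<in>E. ?g s v (x * X r u) (y * X u s)) =
            (\<Sum>v\<in>E. \<Sum>u\<in>E. \<Sum>s\<in>E. ?g s v (x * X r u) (y * X u s))"
          by (subst sum.swap[of _ E E]) (subst (2) sum.swap, rule HOL.refl)
        also have "\<dots> = (\<Sum>v\<in>E. \<Sum>u\<in>E. if u = v then f (x * (X r u * Y u w)) y else 0)"
        proof (intro sum.cong HOL.refl)
          fix v u assume v: "v \<in> E" and u: "u \<in> E"
          have "(\<Sum>s\<in>E. ?g s v (x * X r u) (y * X u s)) =
              f (x * X r u * Y v w) (y * (\<Sum>s\<in>E. X u s * Y s v))"
            by (simp add: sum_distrib_left balanced_sum[OF f] mult.assoc)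
          then show "(\<Sum>s\<in>E. ?g s v (x * X r u) (y * X u s)) =
              (if u = v then f (x * (X r u * Y u w)) y else 0)"
            using XY[OF u v] by (auto simp: balanced_0[OF f] mult.assoc)
        qed
        also have "\<dots> = (\<Sum>u\<in>E. f (x * (X r u * Y u w)) y)"
          using fin by simp
        also have "\<dots> = f (x * (\<Sum>u\<in>E. X r u * Y u w)) y"
          by (simp add: sum_distrib_left balanced_sum[OF f])
        also have "\<dots> = (if r = w then f x y else 0)"
          using XY[OF r w] by (auto simp: balanced_0[OF f])
        finally show "(\<Sum>s\<in>E. \<Sum>v\<in>E. \<Sum>u\<in>E. ?g s v (x * X r u) (y * X u s)) = (if r = w then f x y else 0)" .
      qed
      finally show "(\<Sum>s\<in>E. \<Sum>v\<in>E. ev (?g s v) (cop (Y q r * X r s))) =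
          ev (\<lambda>x y. if r = w then f x y else 0) (cop (Y q r))" .
    qed
    also have "\<dots> = (\<Sum>r\<in>E. if r = w then ev f (cop (Y q r)) else 0)"
    proof (rule sum.cong[OF HOL.refl])
      fix r
      have "ev (\<lambda>x y. 0) u = (0 :: 'b)" for u :: "('b \<times> 'b) list" by (induction u) auto
      then show "ev (\<lambda>x y. if r = w then f x y else 0) (cop (Y q r)) = (if r = w then ev f (cop (Y q r)) else 0)"
        by simp
    qed
    also have "\<dots> = ev f (cop (Y q w))" using fin w by simp
    finally show ?thesis using 1 by simp
  qed
  define lam where "lam x q s = (\<Sum>r\<in>E. Y q r * D x (X r s))" for x q s
  \<comment> \<open>The derivation falls on either tensor factor of the coproduct of
    \<open>X\<close>. On the right one, \<open>Y X = 1\<close> collapses the left factors to 1 and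
    \<open>1 \<otimes> lam\<close> remains; on the left one, \<open>lam\<close> appears, paired with
    right factors that contain no derivatives.\<close>
  have coplam: "ev f (cop (lam x q s)) = f 1 (lam x q s) + (\<Sum>v\<in>E. \<Sum>w\<in>E. f (lam x v w) (Y q v * X w s))"
    if f: "balanced f" and q: "q \<in> E" and s: "s \<in> E" for f x q s
  proof -
    let ?g = "\<lambda>r w a b. f (a * D x (X r w)) (b * X w s) + f (a * X r w) (b * D x (X w s))"
    have "ev f (cop (Y q r * D x (X r s))) = (\<Sum>v\<in>E. \<Sum>w\<in>E. ?g r w (Y v r) (Y q v))" if r: "r \<in> E" for r
    proof -
      have b: "balanced (\<lambda>x' y'. f (a * x') (b * y'))" for a b
        using f by (auto simp: balanced_def ring_distribs scale_mult_right[symmetric])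
      have b2: "balanced (\<lambda>a b. \<Sum>w\<in>E. ?g r w a b)"
        using f by (auto simp: balanced_def ring_distribs scale_mult[symmetric] sum.distrib)
      have rX: "repr (X r s) (map (\<lambda>w. (X r w, X w s)) es)"
        unfolding repr_def es_sum using copX[OF _ r s] by simp
      have "ev f (cop (Y q r * D x (X r s))) = ev (\<lambda>a b. \<Sum>w\<in>E. ?g r w a b) (cop (Y q r))"
        unfolding cop_mult[OF f] cop_D_repr[OF b rX] es_sum by simp
      also have "\<dots> = (\<Sum>v\<in>E. \<Sum>w\<in>E. ?g r w (Y v r) (Y q v))"
        by (rule copY[OF b2 q r])
      finally show ?thesis .
    qed
    then have "ev f (cop (lam x q s)) = (\<Sum>r\<in>E. \<Sum>v\<in>E. \<Sum>w\<in>E. ?g r w (Y v r) (Y q v))"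
      unfolding lam_def cop_sum[OF f] by (intro sum.cong) auto
    also have "\<dots> = (\<Sum>v\<in>E. \<Sum>w\<in>E. \<Sum>r\<in>E. ?g r w (Y v r) (Y q v))"
      by (subst sum.swap[of _ E E]) (subst (2) sum.swap, rule HOL.refl)
    also have "\<dots> = (\<Sum>v\<in>E. \<Sum>w\<in>E. f (lam x v w) (Y q v * X w s) + (if v = w then f 1 (Y q v * D x (X v s)) else 0))"
    proof (intro sum.cong HOL.refl)
      fix v w assume v: "v \<in> E" and w: "w \<in> E"
      have "(\<Sum>r\<in>E. ?g r w (Y v r) (Y q v)) =
          f (lam x v w) (Y q v * X w s) + f (\<Sum>r\<in>E. Y v r * X r w) (Y q v * D x (X w s))"
        by (simp add: sum.distrib lam_def balanced_sum[OF f])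
      then show "(\<Sum>r\<in>E. ?g r w (Y v r) (Y q v)) =
          f (lam x v w) (Y q v * X w s) + (if v = w then f 1 (Y q v * D x (X v s)) else 0)"
        using YX[OF v w] by (auto simp: balanced_0[OF f])
    qed
    also have "\<dots> = (\<Sum>v\<in>E. \<Sum>w\<in>E. f (lam x v w) (Y q v * X w s)) + (\<Sum>v\<in>E. f 1 (Y q v * D x (X v s)))"
      using fin by (simp add: sum.distrib)
    also have "(\<Sum>v\<in>E. f 1 (Y q v * D x (X v s))) = f 1 (lam x q s)"
      by (simp add: lam_def balanced_sum[OF f])
    finally show ?thesis by simp
  qed
  have DX: "D x (X q s) = (\<Sum>r\<in>E. X q r * lam x r s)" if "q \<in> E" "s \<in> E" for x q s
  proof -
    have "(\<Sum>r\<in>E. X q r * lam x r s) = (\<Sum>t\<in>E. (\<Sum>r\<in>E. X q r * Y r t) * D x (X t s))"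
      unfolding lam_def sum_distrib_left sum_distrib_right by (subst sum.swap) (simp add: mult.assoc)
    also have "\<dots> = (\<Sum>t\<in>E. if t = q then D x (X t s) else 0)"
      using that by (intro sum.cong) (auto simp: XY)
    finally show ?thesis using that fin by simp
  qed
  \<comment> \<open>Differentiate \<open>Y X = 1\<close> and multiply by \<open>Y\<close> from the
    right.\<close>
  have DY: "D x (Y q t) = sc (- 1) (\<Sum>s\<in>E. Y s t * lam x q s)" if q: "q \<in> E" and t: "t \<in> E" for x q t
  proof -
    have "(\<Sum>r\<in>E. D x (Y q r) * X r s) + lam x q s = 0" if s: "s \<in> E" for s
    proof -
      have "(\<Sum>r\<in>E. D x (Y q r) * X r s) + lam x q s = D x (\<Sum>r\<in>E. Y q r * X r s)"
        by (simp add: D_sum D_mult sum.distrib lam_def)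
      then show ?thesis using YX[OF q s] by (auto simp: D_one D_0)
    qed
    then have "(\<Sum>s\<in>E. ((\<Sum>r\<in>E. D x (Y q r) * X r s) + lam x q s) * Y s t) = 0" by simp
    moreover have "(\<Sum>s\<in>E. (\<Sum>r\<in>E. D x (Y q r) * X r s) * Y s t) = (\<Sum>r\<in>E. D x (Y q r) * (\<Sum>s\<in>E. X r s * Y s t))"
      unfolding sum_distrib_left sum_distrib_right by (subst sum.swap) (simp add: mult.assoc)
    moreover have "\<dots> = (\<Sum>r\<in>E. if r = t then D x (Y q r) else 0)"
      using t by (intro sum.cong) (auto simp: XY)
    ultimately have "D x (Y q t) + (\<Sum>s\<in>E. Y s t * lam x q s) = 0"
      using t fin by (simp add: ring_distribs sum.distrib mult.commute)
    then show ?thesis by (simp add: eq_neg_iff_add_eq_0)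
  qed
  define XS where "XS = (\<lambda>(q, s). X q s) ` (E \<times> E) \<union> (\<lambda>(q, s). Y q s) ` (E \<times> E)"
  define LS where "LS = (\<lambda>(i, q, s). lam (bas i) q s) ` ({..<h} \<times> E \<times> E)"
  have lamLS: "lam (bas i) q s \<in> LS" if "i < h" "q \<in> E" "s \<in> E" for i q s
    unfolding LS_def using that by (intro rev_image_eqI[of "(i, q, s)"]) auto
  show thesis
  proof (rule that[of XS LS])
    show "finite XS" "finite LS" using fin by (auto simp: XS_def LS_def)
    show "\<Sigma> \<subseteq> span XS"
      using \<Sigma> span_mono[of "{X q s |q s. q \<in> E \<and> s \<in> E}" XS] by (force simp: XS_def)
    show "S a \<in> XS" if "a \<in> XS" for a
      using that by (auto simp: XS_def SY Y_def[symmetric])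
    show "in_tensor XS XS a" if "a \<in> XS" for a
    proof -
      from that consider q s where "q \<in> E" "s \<in> E" "a = X q s" | q s where "q \<in> E" "s \<in> E" "a = Y q s"
        by (auto simp: XS_def)
      then show ?thesis
      proof cases
        case 1
        then have "repr a (map (\<lambda>r. (X q r, X r s)) es)"
          using copX by (simp add: repr_def es_sum)
        moreover have "set (map (\<lambda>r. (X q r, X r s)) es) \<subseteq> XS \<times> XS"
          using 1 es by (auto simp: XS_def)
        ultimately show ?thesis unfolding in_tensor_def by blast
      next
        case 2
        then have "repr a (map (\<lambda>r. (Y r s, Y q r)) es)"
          using copY by (simp add: repr_def es_sum)
        moreover have "set (map (\<lambda>r. (Y r s, Y q r)) es) \<subseteq> XS \<times> XS"
          using 2 es by (auto simp: XS_def)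
        ultimately show ?thesis unfolding in_tensor_def by blast
      qed
    qed
    show "\<exists>u. set u \<subseteq> LS \<times> {a * b |a b. a \<in> XS \<and> b \<in> XS} \<and> repr l ((1, l) # u)" if "l \<in> LS" for l
    proof -
      from that obtain i q s where l: "i < h" "q \<in> E" "s \<in> E" "l = lam (bas i) q s"
        by (auto simp: LS_def)
      let ?u = "concat (map (\<lambda>v. map (\<lambda>w. (lam (bas i) v w, Y q v * X w s)) es) es)"
      have "repr l ((1, l) # ?u)"
        unfolding repr_def l(4) using coplam[OF _ l(2,3)] by (simp add: ev_concat es_sum comp_def)
      moreover have "set ?u \<subseteq> LS \<times> {a * b |a b. a \<in> XS \<and> b \<in> XS}"
        using l es lamLS by (force simp: XS_def)
      ultimately show ?thesis by blast
    qed
    show "\<exists>u x. set u \<subseteq> XS \<times> XS \<and> S l = ev (\<lambda>a b. a * D x b) u" if "l \<in> LS" for l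
    proof -
      from that obtain i q s where l: "i < h" "q \<in> E" "s \<in> E" "l = lam (bas i) q s"
        by (auto simp: LS_def)
      have "S l = ev (\<lambda>a b. a * D (bas i) b) (map (\<lambda>r. (X q r, Y r s)) es)"
        using l SY by (simp add: es_sum lam_def S_sum S_mult S_D Y_def)
      moreover have "set (map (\<lambda>r. (X q r, Y r s)) es) \<subseteq> XS \<times> XS"
        using l es by (auto simp: XS_def)
      ultimately show ?thesis by blast
    qed
    \<comment> \<open>The scalar is 1 for an entry of \<open>X\<close> and -1 for an entry of its
      inverse.\<close>
    show "\<exists>u c. set u \<subseteq> XS \<times> LS \<and> D (bas i) a = sc c (ev (\<lambda>a l. a * l) u)" if i: "i < h" and "a \<in> XS" for i a
    proof -
      from \<open>a \<in> XS\<close> consider q s where "q \<in> E" "s \<in> E" "a = X q s" | q s where "q \<in> E" "s \<in> E" "a = Y q s"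
        by (auto simp: XS_def)
      then show ?thesis
      proof cases
        case 1
        have "D (bas i) a = sc 1 (ev (\<lambda>a l. a * l) (map (\<lambda>r. (X q r, lam (bas i) r s)) es))"
          using 1 DX by (simp add: es_sum)
        moreover have "set (map (\<lambda>r. (X q r, lam (bas i) r s)) es) \<subseteq> XS \<times> LS"
          using 1 i es lamLS by (auto simp: XS_def)
        ultimately show ?thesis by blast
      next
        case 2
        have "D (bas i) a = sc (- 1) (ev (\<lambda>a l. a * l) (map (\<lambda>r. (Y r s, lam (bas i) q r)) es))"
          unfolding es_sum 2(3) DY[OF 2(1,2)] by simp
        moreover have "set (map (\<lambda>r. (Y r s, lam (bas i) q r)) es) \<subseteq> XS \<times> LS"
          using 2 i es lamLS by (auto simp: XS_def)
        ultimately show ?thesis by blast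
      qed
    qed
  qed
qed

end

section \<open>Coproducts as lists\<close>

lemma dalg_of_type_sel [simp]:
  "carrier (dalg_of_type sc d) = UNIV" "x \<otimes>\<^bsub>dalg_of_type sc d\<^esub> y = x * y"
  "\<one>\<^bsub>dalg_of_type sc d\<^esub> = 1" "\<zero>\<^bsub>dalg_of_type sc d\<^esub> = 0" "x \<oplus>\<^bsub>dalg_of_type sc d\<^esub> y = x + y"
  "c \<odot>\<^bsub>dalg_of_type sc d\<^esub> x = sc c x" "der (dalg_of_type sc d) = d"
  by (simp_all add: dalg_of_type_def)

lemma tensor_sel:
  "carrier (tensor S T) = lists (carrier S \<times> carrier T) // tensor_rel S T"
  "\<zero>\<^bsub>tensor S T\<^esub> = tensor_rel S T `` {[]}"
  "\<one>\<^bsub>tensor S T\<^esub> = tensor_rel S T `` {[(\<one>\<^bsub>S\<^esub>, \<one>\<^bsub>T\<^esub>)]}"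
  "U \<oplus>\<^bsub>tensor S T\<^esub> V = (\<Union>u\<in>U. \<Union>v\<in>V. tensor_rel S T `` {u @ v})"
  "U \<otimes>\<^bsub>tensor S T\<^esub> V = (\<Union>u\<in>U. \<Union>v\<in>V.
       tensor_rel S T `` {[(a \<otimes>\<^bsub>S\<^esub> a', b \<otimes>\<^bsub>T\<^esub> b'). (a, b) \<leftarrow> u, (a', b') \<leftarrow> v]})"
  "c \<odot>\<^bsub>tensor S T\<^esub> U = (\<Union>u\<in>U. tensor_rel S T `` {[(c \<odot>\<^bsub>S\<^esub> a, b). (a, b) \<leftarrow> u]})"
  "der (tensor S T) x U = (\<Union>u\<in>U. tensor_rel S T ``
       {[(der S x a, b). (a, b) \<leftarrow> u] @ [(a, der T x b). (a, b) \<leftarrow> u]})"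
  by (simp_all add: tensor_def)

lemma class_eq: "(u, v) \<in> tensor_rel S T \<Longrightarrow> tensor_rel S T `` {u} = tensor_rel S T `` {v}"
  by (auto intro: tensor_rel.trans tensor_rel.sym)

lemma class_self: "u \<in> lists (carrier S \<times> carrier T) \<Longrightarrow> u \<in> tensor_rel S T `` {u}"
  by (auto intro: tensor_rel.refl)

lemma class_eqD:
  "tensor_rel S T `` {u} = tensor_rel S T `` {v} \<Longrightarrow> v \<in> lists (carrier S \<times> carrier T) \<Longrightarrow>
    (u, v) \<in> tensor_rel S T"
  using class_self by blast

text \<open>\<open>commute\<close> exchanges two blocks; framed by \<open>append\<close> it moves a
  single entry past a prefix, which generates all permutations.\<close>

lemma tensor_rel_mset:
  assumes "mset u = mset v" "u \<in> lists (carrier S \<times> carrier T)"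
  shows "(u, v) \<in> tensor_rel S T"
  using assms
proof (induction u arbitrary: v)
  case Nil
  then show ?case by (auto intro: tensor_rel.refl)
next
  case (Cons p u)
  have "p \<in> set v" using Cons.prems(1) by (metis list.set_intros(1) set_mset_mset)
  then obtain v1 v2 where v: "v = v1 @ p # v2" by (meson split_list)
  have "set v = set (p # u)" using Cons.prems(1) by (metis set_mset_mset)
  then have l: "v1 \<in> lists (carrier S \<times> carrier T)" "v2 \<in> lists (carrier S \<times> carrier T)"
    "[p] \<in> lists (carrier S \<times> carrier T)"
  proof -
    have "set v \<subseteq> carrier S \<times> carrier T" "p \<in> carrier S \<times> carrier T"
      using \<open>set v = set (p # u)\<close> Cons.prems(2) by (auto simp: in_lists_conv_set)
    then show "v1 \<in> lists (carrier S \<times> carrier T)" "v2 \<in> lists (carrier S \<times> carrier T)"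
      "[p] \<in> lists (carrier S \<times> carrier T)"
      unfolding v by (auto simp: in_lists_conv_set)
  qed
  have "(u, v1 @ v2) \<in> tensor_rel S T"
    using Cons.prems v by (intro Cons.IH) auto
  then have 1: "([p] @ u, [p] @ v1 @ v2) \<in> tensor_rel S T"
    using l by (intro tensor_rel.append tensor_rel.refl)
  have 2: "(([p] @ v1) @ v2, (v1 @ [p]) @ v2) \<in> tensor_rel S T"
    using l by (intro tensor_rel.append tensor_rel.commute tensor_rel.refl)
  show ?case using tensor_rel.trans[OF 1, of "(v1 @ [p]) @ v2"] 2 v by simp
qed

text \<open>The universal property on formal sums. The values lie in a commutative monoid, where
  additivity does not imply that zero goes to 0, so this is a separate condition.\<close>

lemma tensor_rel_ev:
  fixes f :: "'a \<Rightarrow> 'c \<Rightarrow> 'x::comm_monoid_add"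
  assumes "(u, v) \<in> tensor_rel S T"
    and "\<And>a a' b. a \<in> carrier S \<Longrightarrow> a' \<in> carrier S \<Longrightarrow> b \<in> carrier T \<Longrightarrow> f (a \<oplus>\<^bsub>S\<^esub> a') b = f a b + f a' b"
    and "\<And>a b b'. a \<in> carrier S \<Longrightarrow> b \<in> carrier T \<Longrightarrow> b' \<in> carrier T \<Longrightarrow> f a (b \<oplus>\<^bsub>T\<^esub> b') = f a b + f a b'"
    and "\<And>b. b \<in> carrier T \<Longrightarrow> f \<zero>\<^bsub>S\<^esub> b = 0"
    and "\<And>a b c. a \<in> carrier S \<Longrightarrow> b \<in> carrier T \<Longrightarrow> f (c \<odot>\<^bsub>S\<^esub> a) b = f a (c \<odot>\<^bsub>T\<^esub> b)"
  shows "ev f u = ev f v"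
  using assms(1) by induction (auto simp: assms(2-) add.commute)

text \<open>The universal property for maps into another tensor product, kept on lists:
  \<open>F\<close> sends a pure tensor to a formal sum, and concatenation extends it.\<close>

lemma tensor_rel_concat:
  assumes "(u, v) \<in> tensor_rel S T"
    and F: "\<And>a b. a \<in> carrier S \<Longrightarrow> b \<in> carrier T \<Longrightarrow> F (a, b) \<in> lists (carrier S' \<times> carrier T')"
    and "\<And>a a' b. a \<in> carrier S \<Longrightarrow> a' \<in> carrier S \<Longrightarrow> b \<in> carrier T \<Longrightarrow>
      (F (a \<oplus>\<^bsub>S\<^esub> a', b), F (a, b) @ F (a', b)) \<in> tensor_rel S' T'"
    and "\<And>a b b'. a \<in> carrier S \<Longrightarrow> b \<in> carrier T \<Longrightarrow> b' \<in> carrier T \<Longrightarrow>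
      (F (a, b \<oplus>\<^bsub>T\<^esub> b'), F (a, b) @ F (a, b')) \<in> tensor_rel S' T'"
    and "\<And>b. b \<in> carrier T \<Longrightarrow> (F (\<zero>\<^bsub>S\<^esub>, b), []) \<in> tensor_rel S' T'"
    and "\<And>a b c. a \<in> carrier S \<Longrightarrow> b \<in> carrier T \<Longrightarrow>
      (F (c \<odot>\<^bsub>S\<^esub> a, b), F (a, c \<odot>\<^bsub>T\<^esub> b)) \<in> tensor_rel S' T'"
  shows "(concat (map F u), concat (map F v)) \<in> tensor_rel S' T'"
proof -
  have L: "concat (map F u) \<in> lists (carrier S' \<times> carrier T')" if "u \<in> lists (carrier S \<times> carrier T)" for u
    using that F by (induction u) auto
  show ?thesis
    using assms(1)
  proof induction
    case (refl u)
    then show ?case by (intro tensor_rel.refl L)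
  next
    case (sym u v)
    then show ?case by (rule_tac tensor_rel.sym)
  next
    case (trans u v w)
    then show ?case by (rule_tac tensor_rel.trans)
  next
    case (append u u' v v')
    then show ?case by (simp add: tensor_rel.append)
  next
    case (commute u v)
    then show ?case using L[of u] L[of v] by (simp add: tensor_rel.commute)
  qed (use assms in auto)
qed

lemma tensor_rel_closed:
  assumes "(u, v) \<in> tensor_rel S T"
    and "\<And>a a'. a \<in> carrier S \<Longrightarrow> a' \<in> carrier S \<Longrightarrow> a \<oplus>\<^bsub>S\<^esub> a' \<in> carrier S" "\<zero>\<^bsub>S\<^esub> \<in> carrier S"
      "\<And>c a. a \<in> carrier S \<Longrightarrow> c \<odot>\<^bsub>S\<^esub> a \<in> carrier S"
    and "\<And>b b'. b \<in> carrier T \<Longrightarrow> b' \<in> carrier T \<Longrightarrow> b \<oplus>\<^bsub>T\<^esub> b' \<in> carrier T"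
      "\<And>c b. b \<in> carrier T \<Longrightarrow> c \<odot>\<^bsub>T\<^esub> b \<in> carrier T"
  shows "u \<in> lists (carrier S \<times> carrier T) \<and> v \<in> lists (carrier S \<times> carrier T)"
  using assms(1) by induction (auto simp: assms(2-))

lemma tensor_add_class:
  assumes "u \<in> lists (carrier S \<times> carrier T)" "v \<in> lists (carrier S \<times> carrier T)"
  shows "tensor_rel S T `` {u} \<oplus>\<^bsub>tensor S T\<^esub> tensor_rel S T `` {v} = tensor_rel S T `` {u @ v}"
proof -
  have "tensor_rel S T `` {u' @ v'} = tensor_rel S T `` {u @ v}"
    if "(u, u') \<in> tensor_rel S T" "(v, v') \<in> tensor_rel S T" for u' v'
    using that by (intro class_eq tensor_rel.sym[OF tensor_rel.append])
  then show ?thesis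
    using class_self[OF assms(1)] class_self[OF assms(2)] unfolding tensor_sel by blast
qed

text \<open>\<open>tensor_lift\<close> takes the unique element of an image over all
  representatives; \<open>cong\<close> makes this image a singleton, computed from any one of
  them.\<close>

lemma tensor_lift_tensor:
  assumes u: "u \<in> lists (carrier S \<times> carrier T)"
    and closed: "\<And>v. (u, v) \<in> tensor_rel S T \<Longrightarrow> v \<in> lists (carrier S \<times> carrier T)"
    and f: "\<And>a b. a \<in> carrier S \<Longrightarrow> b \<in> carrier T \<Longrightarrow> f a b = tensor_rel S' T' `` {F (a, b)}"
    and F: "\<And>a b. a \<in> carrier S \<Longrightarrow> b \<in> carrier T \<Longrightarrow> F (a, b) \<in> lists (carrier S' \<times> carrier T')"
    and cong: "\<And>v. (u, v) \<in> tensor_rel S T \<Longrightarrow> (concat (map F u), concat (map F v)) \<in> tensor_rel S' T'"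
  shows "tensor_lift (tensor S' T') f (tensor_rel S T `` {u}) = tensor_rel S' T' `` {concat (map F u)}"
proof -
  have *: "concat (map F v) \<in> lists (carrier S' \<times> carrier T') \<and>
    foldr (\<lambda>(b, c) m. f b c \<oplus>\<^bsub>tensor S' T'\<^esub> m) v \<zero>\<^bsub>tensor S' T'\<^esub> = tensor_rel S' T' `` {concat (map F v)}"
    if "v \<in> lists (carrier S \<times> carrier T)" for v
    using that
  proof (induction v)
    case Nil
    then show ?case by (simp add: tensor_sel)
  next
    case (Cons p v)
    then show ?case using F f by (cases p) (auto simp: tensor_add_class)
  qed
  have "(\<lambda>u. foldr (\<lambda>(b, c) m. f b c \<oplus>\<^bsub>tensor S' T'\<^esub> m) u \<zero>\<^bsub>tensor S' T'\<^esub>) ` (tensor_rel S T `` {u}) =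
      (\<lambda>_. tensor_rel S' T' `` {concat (map F u)}) ` (tensor_rel S T `` {u})"
    using * closed cong class_eq[OF tensor_rel.sym[OF cong]] by (intro image_cong) auto
  also have "\<dots> = {tensor_rel S' T' `` {concat (map F u)}}"
    using class_self[OF u] by (intro image_constant)
  finally show ?thesis unfolding tensor_lift_def by simp
qed

lemma tensor_lift_typed:
  assumes "\<And>v. (u, v) \<in> tensor_rel S T \<Longrightarrow> ev f u = ev f v" "u \<in> lists (carrier S \<times> carrier T)"
  shows "tensor_lift (dalg_of_type sc d) f (tensor_rel S T `` {u}) = ev f u"
proof -
  have *: "foldr (\<lambda>(b, c) m. f b c \<oplus>\<^bsub>dalg_of_type sc d\<^esub> m) v \<zero>\<^bsub>dalg_of_type sc d\<^esub> = ev f v" for v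
    by (induction v) (auto simp: case_prod_beta)
  have "(\<lambda>u. foldr (\<lambda>(b, c) m. f b c \<oplus>\<^bsub>dalg_of_type sc d\<^esub> m) u \<zero>\<^bsub>dalg_of_type sc d\<^esub>) ` (tensor_rel S T `` {u}) =
      (\<lambda>_. ev f u) ` (tensor_rel S T `` {u})"
    unfolding * using assms(1) by (intro image_cong) auto
  also have "\<dots> = {ev f u}"
    using class_self[OF assms(2)] by (intro image_constant)
  finally show ?thesis unfolding tensor_lift_def by (simp only: the_elem_eq)
qed

lemma tensor_map_typed:
  fixes sc1 :: "'k \<Rightarrow> 'a1::comm_ring_1 \<Rightarrow> 'a1" and sc2 :: "'k \<Rightarrow> 'a2::comm_ring_1 \<Rightarrow> 'a2"
  assumes "\<And>a a'. f (a + a') = f a \<oplus>\<^bsub>S'\<^esub> f a'" "\<And>c a. f (sc1 c a) = c \<odot>\<^bsub>S'\<^esub> f a" "f 0 = \<zero>\<^bsub>S'\<^esub>"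
    "\<And>a. f a \<in> carrier S'"
    and "\<And>a a'. g (a + a') = g a \<oplus>\<^bsub>T'\<^esub> g a'" "\<And>c a. g (sc2 c a) = c \<odot>\<^bsub>T'\<^esub> g a" "\<And>a. g a \<in> carrier T'"
  shows "tensor_map S' T' f g (tensor_rel (dalg_of_type sc1 d1) (dalg_of_type sc2 d2) `` {u}) =
    tensor_rel S' T' `` {map (\<lambda>(a, b). (f a, g b)) u}"
proof -
  let ?F = "\<lambda>(a, b). [(f a, g b)]"
  have "(concat (map ?F u), concat (map ?F v)) \<in> tensor_rel S' T'"
    if "(u, v) \<in> tensor_rel (dalg_of_type sc1 d1) (dalg_of_type sc2 d2)" for v
    by (rule tensor_rel_concat[OF that]) (auto simp: assms intro: tensor_rel.intros)
  moreover have "concat (map ?F u) = map (\<lambda>(a, b). (f a, g b)) u"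
    by (induction u) auto
  ultimately show ?thesis
    unfolding tensor_map_def
    by (subst tensor_lift_tensor[where F = ?F]) (auto simp: pure_tensor_def assms)
qed

definition rep :: "'a set \<Rightarrow> 'a" where
  "rep V = (SOME v. v \<in> V)"

lemma tensor_carrierD:
  assumes "V \<in> carrier (tensor (dalg_of_type sc1 d1) (dalg_of_type sc2 d2))"
  shows "V = tensor_rel (dalg_of_type sc1 d1) (dalg_of_type sc2 d2) `` {rep V}" "rep V \<in> V"
    "w \<in> V \<Longrightarrow> (rep V, w) \<in> tensor_rel (dalg_of_type sc1 d1) (dalg_of_type sc2 d2)"
proof -
  let ?R = "tensor_rel (dalg_of_type sc1 d1) (dalg_of_type sc2 d2)"
  obtain v where v: "V = ?R `` {v}" using assms unfolding tensor_sel by (auto elim: quotientE)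
  have "v \<in> V" unfolding v by (rule class_self) simp
  then show r: "rep V \<in> V" unfolding rep_def by (rule someI)
  then have "(v, rep V) \<in> ?R" using v by auto
  then show V: "V = ?R `` {rep V}" unfolding v by (rule class_eq)
  show "(rep V, w) \<in> ?R" if "w \<in> V" using that V by auto
qed

context scalar_algebra
begin

lemma tensor_ev:
  assumes "balanced f" "(u, v) \<in> tensor_rel (dalg_of_type sc d) (dalg_of_type sc d)"
  shows "ev f u = ev f v"
  by (rule tensor_rel_ev[OF assms(2)]) (auto simp: balanced_add[OF assms(1)] balanced_0[OF assms(1)] balanced_scale[OF assms(1)])

lemma smult_class:
  fixes d :: "'d \<Rightarrow> 'b \<Rightarrow> 'b"
  defines "B \<equiv> dalg_of_type sc d"
  shows "c \<odot>\<^bsub>tensor B B\<^esub> (tensor_rel B B `` {u}) = tensor_rel B B `` {map (\<lambda>(a, b). (sc c a, b)) u}"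
proof -
  let ?R = "tensor_rel B B" and ?F = "\<lambda>(a, b). [(sc c a, b)]"
  have F: "concat (map ?F w) = map (\<lambda>(a, b). (sc c a, b)) w" for w
    by (induction w) auto
  have balanced: "([(sc c (sc c' a), b)], [(sc c a, sc c' b)]) \<in> ?R" for a b c'
    using tensor_rel.balanced[of "sc c a" B b B c'] by (simp add: mult.commute B_def)
  have cong: "(concat (map ?F w), concat (map ?F v)) \<in> ?R" if "(w, v) \<in> ?R" for w v
    using that
  proof (rule tensor_rel_concat)
    fix a a' b b'
    show "?F (a, b) \<in> lists (carrier B \<times> carrier B)" by (simp add: B_def)
    show "(?F (a \<oplus>\<^bsub>B\<^esub> a', b), ?F (a, b) @ ?F (a', b)) \<in> ?R"
      using tensor_rel.add_left[of "sc c a" B "sc c a'" b B] by (simp add: scale_right_distrib B_def)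
    show "(?F (a, b \<oplus>\<^bsub>B\<^esub> b'), ?F (a, b) @ ?F (a, b')) \<in> ?R"
      using tensor_rel.add_right[of "sc c a" B b B b'] by (simp add: B_def)
    show "(?F (\<zero>\<^bsub>B\<^esub>, b), []) \<in> ?R"
      using tensor_rel.zero[of b B B] by (simp add: B_def)
    show "(?F (c' \<odot>\<^bsub>B\<^esub> a, b), ?F (a, c' \<odot>\<^bsub>B\<^esub> b)) \<in> ?R" for c'
      using balanced by (simp add: B_def)
  qed
  have *: "?R `` {map (\<lambda>(a, b). (sc c a, b)) v} = ?R `` {map (\<lambda>(a, b). (sc c a, b)) u}" if "(u, v) \<in> ?R" for v
    using class_eq[OF tensor_rel.sym[OF cong[OF that]]] unfolding F .
  have u: "u \<in> ?R `` {u}" by (rule class_self) (simp add: B_def)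
  have "c \<odot>\<^bsub>tensor B B\<^esub> (?R `` {u}) = (\<Union>v\<in>?R `` {u}. ?R `` {map (\<lambda>(a, b). (sc c a, b)) v})"
    unfolding tensor_sel(6) by (simp add: B_def)
  also have "\<dots> = (\<Union>v\<in>?R `` {u}. ?R `` {map (\<lambda>(a, b). (sc c a, b)) u})"
    using * by (intro SUP_cong) auto
  also have "\<dots> = ?R `` {map (\<lambda>(a, b). (sc c a, b)) u}"
    using u by blast
  finally show ?thesis .
qed

lemma pure_tensor_rules:
  fixes d :: "'d \<Rightarrow> 'b \<Rightarrow> 'b"
  defines "B \<equiv> dalg_of_type sc d"
  shows "pure_tensor B B a b \<in> carrier (tensor B B)"
    and "pure_tensor B B (a + a') b = pure_tensor B B a b \<oplus>\<^bsub>tensor B B\<^esub> pure_tensor B B a' b"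
    and "pure_tensor B B a (b + b') = pure_tensor B B a b \<oplus>\<^bsub>tensor B B\<^esub> pure_tensor B B a b'"
    and "pure_tensor B B 0 b = \<zero>\<^bsub>tensor B B\<^esub>"
    and "pure_tensor B B (sc c a) b = pure_tensor B B a (sc c b)"
    and "c \<odot>\<^bsub>tensor B B\<^esub> pure_tensor B B a b = pure_tensor B B (sc c a) b"
proof -
  show "pure_tensor B B a b \<in> carrier (tensor B B)"
    by (simp add: pure_tensor_def tensor_sel B_def quotientI)
  show "pure_tensor B B (a + a') b = pure_tensor B B a b \<oplus>\<^bsub>tensor B B\<^esub> pure_tensor B B a' b"
    using class_eq[OF tensor_rel.add_left[of a B a' b B]]
    by (simp add: pure_tensor_def tensor_add_class B_def)
  show "pure_tensor B B a (b + b') = pure_tensor B B a b \<oplus>\<^bsub>tensor B B\<^esub> pure_tensor B B a b'"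
    using class_eq[OF tensor_rel.add_right[of a B b B b']]
    by (simp add: pure_tensor_def tensor_add_class B_def)
  show "pure_tensor B B 0 b = \<zero>\<^bsub>tensor B B\<^esub>"
    using class_eq[OF tensor_rel.zero[of b B B]] by (simp add: pure_tensor_def tensor_sel B_def)
  show "pure_tensor B B (sc c a) b = pure_tensor B B a (sc c b)"
    using class_eq[OF tensor_rel.balanced[of a B b B c]] by (simp add: pure_tensor_def B_def)
  show "c \<odot>\<^bsub>tensor B B\<^esub> pure_tensor B B a b = pure_tensor B B (sc c a) b"
    using smult_class[of d c "[(a, b)]"] by (simp add: pure_tensor_def B_def)
qed

text \<open>The associator is a lift inside a lift. \<open>F1\<close> is the inner map on a pure
  tensor, and \<open>F2\<close> the outer one, which has to choose a representative of a class; by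
  \<open>F2_class\<close> the choice does not matter up to the relation.\<close>

lemma tensor_assoc_class:
  fixes d :: "'d \<Rightarrow> 'b \<Rightarrow> 'b"
  defines "B \<equiv> dalg_of_type sc d"
  assumes u: "u \<in> lists (UNIV \<times> carrier (tensor B B))"
  shows "tensor_assoc B B B (tensor_rel B (tensor B B) `` {u}) =
    tensor_rel (tensor B B) B `` {concat (map (\<lambda>(a, V). map (\<lambda>(b, c). (pure_tensor B B a b, c)) (rep V)) u)}"
proof -
  let ?R = "tensor_rel B B" and ?R3 = "tensor_rel (tensor B B) B" and ?p = "pure_tensor B B"
  note pure = pure_tensor_rules[of d, folded B_def]
  have [simp]: "carrier B = UNIV" "a \<oplus>\<^bsub>B\<^esub> b = a + b" "c \<odot>\<^bsub>B\<^esub> a = sc c a" "\<zero>\<^bsub>B\<^esub> = 0" for a b :: 'b and c :: 'k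
    by (simp_all add: B_def)
  define F1 where "F1 a = (\<lambda>(b, c :: 'b). [(?p a b, c)])" for a
  define F2 where "F2 = (\<lambda>(a, V). concat (map (F1 a) (rep V)))"
  have F1_map: "concat (map (F1 a) w) = map (\<lambda>(b, c). (?p a b, c)) w" for a w
    by (induction w) (auto simp: F1_def)
  have L: "concat (map (F1 a) w) \<in> lists (carrier (tensor B B) \<times> carrier B)" for a w
    by (induction w) (auto simp: F1_def pure)
  have F1: "(concat (map (F1 a) v), concat (map (F1 a) w)) \<in> ?R3" if "(v, w) \<in> ?R" for a v w
    using that
  proof (rule tensor_rel_concat)
    fix b b' c
    show "F1 a (b, c) \<in> lists (carrier (tensor B B) \<times> carrier B)" by (simp add: F1_def pure)
    show "(F1 a (b \<oplus>\<^bsub>B\<^esub> b', c), F1 a (b, c) @ F1 a (b', c)) \<in> ?R3"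
      by (simp add: F1_def pure(3)) (rule tensor_rel.add_left, simp_all add: pure)
    show "(F1 a (\<zero>\<^bsub>B\<^esub>, c), []) \<in> ?R3"
    proof -
      have "?p a 0 = \<zero>\<^bsub>tensor B B\<^esub>" using pure(5)[where c = 0 and a = a] pure(4) by simp
      then show ?thesis by (simp add: F1_def) (rule tensor_rel.zero, simp)
    qed
  next
    fix b c c' :: 'b
    show "(F1 a (b, c \<oplus>\<^bsub>B\<^esub> c'), F1 a (b, c) @ F1 a (b, c')) \<in> ?R3"
      using tensor_rel.add_right[of "?p a b" "tensor B B" c B c'] by (simp add: F1_def pure)
  next
    fix b c and k :: 'k
    show "(F1 a (k \<odot>\<^bsub>B\<^esub> b, c), F1 a (b, k \<odot>\<^bsub>B\<^esub> c)) \<in> ?R3"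
      using tensor_rel.balanced[of "?p a b" "tensor B B" c B k] by (simp add: F1_def pure)
  qed
  have inner: "tensor_lift (tensor (tensor B B) B) (\<lambda>b c. pure_tensor (tensor B B) B (?p a b) c) V =
      ?R3 `` {F2 (a, V)}" if "V \<in> carrier (tensor B B)" for a V
  proof -
    have V: "V = ?R `` {rep V}" using tensor_carrierD(1)[of V sc d sc d] that by (simp add: B_def)
    have "tensor_lift (tensor (tensor B B) B) (\<lambda>b c. pure_tensor (tensor B B) B (?p a b) c) (?R `` {rep V}) =
        ?R3 `` {concat (map (F1 a) (rep V))}"
      by (rule tensor_lift_tensor) (auto simp: F1 pure_tensor_def[of "tensor B B"], auto simp: F1_def pure)
    then show ?thesis using V by (simp add: F2_def)
  qed
  have F2_class: "(F2 (a, V), concat (map (F1 a) w)) \<in> ?R3" if "V \<in> carrier (tensor B B)" "w \<in> V" for a V w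
    unfolding F2_def using F1 tensor_carrierD(3)[of V sc d sc d w] that by (simp add: B_def)
  have repR: "rep V \<in> V" "V = ?R `` {rep V}" if "V \<in> carrier (tensor B B)" for V
    using tensor_carrierD[of V sc d sc d] that by (simp_all add: B_def)
  have class_carrier: "?R `` {w} \<in> carrier (tensor B B)" for w by (simp add: tensor_sel quotientI)
  have class_self': "w \<in> ?R `` {w}" for w by (rule class_self) simp
  have F2: "(concat (map F2 u), concat (map F2 v)) \<in> ?R3" if "(u, v) \<in> tensor_rel B (tensor B B)" for v
    using that
  proof (rule tensor_rel_concat)
    fix a V
    show "F2 (a, V) \<in> lists (carrier (tensor B B) \<times> carrier B)" using L by (simp add: F2_def)
  next
    fix a a' V
    \<comment> \<open>Splitting every entry interleaves the two sums, so the entries are permuted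
      afterwards.\<close>
    have "(concat (map (F1 (a + a')) w), concat (map (F1 a) w) @ concat (map (F1 a') w)) \<in> ?R3" for w
    proof (induction w)
      case Nil
      then show ?case by (simp add: tensor_rel.refl)
    next
      case (Cons p w)
      obtain b c where p: "p = (b, c)" by (cases p)
      have 1: "([(?p (a + a') b, c)], [(?p a b, c), (?p a' b, c)]) \<in> ?R3"
        unfolding pure(2) by (rule tensor_rel.add_left) (simp_all add: pure)
      have 2: "([(?p a b, c), (?p a' b, c)] @ concat (map (F1 a) w) @ concat (map (F1 a') w),
        concat (map (F1 a) (p # w)) @ concat (map (F1 a') (p # w))) \<in> ?R3"
        by (rule tensor_rel_mset) (use L[of a w] L[of a' w] in \<open>auto simp: p F1_def pure\<close>)
      show ?case
        using tensor_rel.trans[OF tensor_rel.append[OF 1 Cons.IH] 2] by (simp add: p F1_def)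
    qed
    then show "(F2 (a \<oplus>\<^bsub>B\<^esub> a', V), F2 (a, V) @ F2 (a', V)) \<in> ?R3" by (simp add: F2_def)
  next
    fix a V V' assume V: "V \<in> carrier (tensor B B)" "V' \<in> carrier (tensor B B)"
    have s: "V \<oplus>\<^bsub>tensor B B\<^esub> V' = ?R `` {rep V @ rep V'}"
      using tensor_add_class[of "rep V" B B "rep V'"] repR(2)[OF V(1)] repR(2)[OF V(2)] by simp
    have "(F2 (a, V \<oplus>\<^bsub>tensor B B\<^esub> V'), concat (map (F1 a) (rep V @ rep V'))) \<in> ?R3"
      unfolding s by (rule F2_class[OF class_carrier class_self'])
    then show "(F2 (a, V \<oplus>\<^bsub>tensor B B\<^esub> V'), F2 (a, V) @ F2 (a, V')) \<in> ?R3" by (simp add: F2_def)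
  next
    fix V
    have "(concat (map (F1 0) w), []) \<in> ?R3" for w
    proof (induction w)
      case (Cons p w)
      obtain b c where p: "p = (b, c)" by (cases p)
      have "([(?p 0 b, c)], []) \<in> ?R3" unfolding pure(4) by (rule tensor_rel.zero) simp
      then show ?case using tensor_rel.append[OF _ Cons.IH] by (fastforce simp: p F1_def)
    qed (simp add: tensor_rel.refl)
    then show "(F2 (\<zero>\<^bsub>B\<^esub>, V), []) \<in> ?R3" by (simp add: F2_def)
  next
    fix a V and c :: 'k assume V: "V \<in> carrier (tensor B B)"
    \<comment> \<open>The scalar is carried into the class \<open>V\<close>. The representative
      chosen for the scaled class may differ from the scaled representative \<open>?w\<close>, so
      \<open>F2_class\<close> is applied.\<close>
    let ?w = "map (\<lambda>(b, b'). (sc c b, b')) (rep V)"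
    have "F2 (sc c a, V) = concat (map (F1 a) ?w)"
      unfolding F2_def F1_map by (simp add: F1_map pure(5) case_prod_beta comp_def)
    moreover have "c \<odot>\<^bsub>tensor B B\<^esub> V = ?R `` {?w}"
      using smult_class[of d c "rep V"] repR(2)[OF V] by (simp add: B_def)
    ultimately have "(F2 (a, c \<odot>\<^bsub>tensor B B\<^esub> V), F2 (sc c a, V)) \<in> ?R3"
      using F2_class[OF class_carrier class_self', of a ?w] F1_map by simp
    then show "(F2 (c \<odot>\<^bsub>B\<^esub> a, V), F2 (a, c \<odot>\<^bsub>tensor B B\<^esub> V)) \<in> ?R3"
      by (simp add: tensor_rel.sym)
  qed
  have cu: "v \<in> lists (carrier B \<times> carrier (tensor B B))" if "(u, v) \<in> tensor_rel B (tensor B B)" for v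
  proof (rule tensor_rel_closed[OF that, THEN conjunct2])
    show "V \<oplus>\<^bsub>tensor B B\<^esub> V' \<in> carrier (tensor B B)"
      if "V \<in> carrier (tensor B B)" "V' \<in> carrier (tensor B B)" for V V'
      using tensor_add_class[of "rep V" B B "rep V'"] repR(2)[OF that(1)] repR(2)[OF that(2)] class_carrier by simp
    show "c \<odot>\<^bsub>tensor B B\<^esub> V \<in> carrier (tensor B B)" if "V \<in> carrier (tensor B B)" for V c
      using smult_class[of d c "rep V"] repR(2)[OF that] class_carrier by (simp add: B_def)
  qed simp_all
  show ?thesis
    unfolding tensor_assoc_def Let_def
    by (subst tensor_lift_tensor[where F = F2])
      (use u F2 inner L cu in \<open>auto simp: F2_def F1_map\<close>)
qed

end

context differential_field
begin

text \<open>The record axioms as equations between operations on types. The rule for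
  \<open>d x (sc c a)\<close> combines the product rule with the known derivative of
  \<open>sc c 1\<close>.\<close>

lemma typed_algebra:
  fixes sc :: "'k \<Rightarrow> 'b::comm_ring_1 \<Rightarrow> 'b"
  assumes "D_algebra (dalg_of_type sc d)"
  shows "scalar_algebra sc"
    and "d x (a + b) = d x a + d x b" and "d x (a * b) = d x a * b + a * d x b"
    and "d (x + y) a = d x a + d y a" and "d (scD c x) a = sc c (d x a)"
    and "d (br x y) a = d x (d y a) - d y (d x a)"
    and "d x (sc c 1) = sc (\<theta> x c) 1"
    and "d x (sc c a) = sc (\<theta> x c) a + sc c (d x a)"
proof -
  let ?B = "dalg_of_type sc d"
  have alg: "algebra K ?B" and lie: "lie_action scD br ?B" and
    const: "\<And>x c. d x (sc c 1) = sc (\<theta> x c) 1"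
    using assms unfolding D_algebra_def by auto
  have m: "module K ?B"
    using alg by (simp add: algebra_def)
  show sa: "scalar_algebra sc"
  proof
    show "sc a (x + y) = sc a x + sc a y" for a x y
      using module.smult_r_distr[OF m, of a x y] by (simp add: K_def)
    show "sc (a + b) x = sc a x + sc b x" for a b x
      using module.smult_l_distr[OF m, of a b x] by (simp add: K_def)
    show "sc a (sc b x) = sc (a * b) x" for a b x
      using module.smult_assoc1[OF m, of a b x] by (simp add: K_def)
    show "sc 1 x = x" for x
      using module.smult_one[OF m, of x] by (simp add: K_def)
    show "sc c (a * b) = sc c a * b" for c a b
      using algebra.smult_assoc2[OF alg, of c a b] by (simp add: K_def)
  qed
  have minus: "x \<ominus>\<^bsub>?B\<^esub> y = x - y" for x y
  proof -
    have ag: "abelian_group ?B" using m by (simp add: module_def)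
    have "(x \<ominus>\<^bsub>?B\<^esub> y) \<oplus>\<^bsub>?B\<^esub> y = x"
      using abelian_group.r_neg[OF ag, of y] abelian_group.l_neg[OF ag, of y]
      by (simp add: a_minus_def)
    then show ?thesis by (simp add: eq_diff_eq)
  qed
  have der: "derivation ?B (d x)" for x
    using lie unfolding lie_action_def by simp
  show "d x (a + b) = d x a + d x b" and dm: "d x (a * b) = d x a * b + a * d x b" for x a b
    using der[of x] unfolding derivation_def by simp_all
  show "d (x + y) a = d x a + d y a" and "d (scD c x) a = sc c (d x a)"
    and "d (br x y) a = d x (d y a) - d y (d x a)"
    using lie unfolding lie_action_def by (simp_all add: minus)
  show "d x (sc c 1) = sc (\<theta> x c) 1" by (rule const)
  show "d x (sc c a) = sc (\<theta> x c) a + sc c (d x a)"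
    using dm[of x "sc c 1" a] const[of x c] by (simp add: scalar_algebra.scale_one_mult[OF sa])
qed

lemma finite_spanning:
  obtains bas :: "nat \<Rightarrow> 'd" and h where "\<And>x. \<exists>c. x = (\<Sum>i<h. scD (c i) (bas i))"
proof -
  obtain Bs where "finite_dimensional_vector_space scD Bs" using finite_dim by blast
  then interpret V: finite_dimensional_vector_space scD Bs .
  obtain bs where bs: "set bs = Bs" "distinct bs" using V.finite_Basis finite_distinct_list by blast
  have "\<exists>c. x = (\<Sum>i<length bs. scD (c i) (bs ! i))" for x
  proof -
    have "x \<in> V.span Bs" by (simp add: V.span_Basis)
    then obtain u where "x = (\<Sum>b\<in>Bs. scD (u b) b)"
      using V.span_finite[OF V.finite_Basis] by auto
    also have "\<dots> = (\<Sum>i<length bs. scD (u (bs ! i)) (bs ! i))"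
      using bij_betw_nth[OF bs(2) HOL.refl bs(1)[symmetric]]
      by (intro sum.reindex_bij_betw[symmetric])
    finally show ?thesis by (intro exI[of _ "\<lambda>i. u (bs ! i)"])
  qed
  then show thesis by (rule that)
qed

end

text \<open>An identity between classes becomes an identity of values of \<open>ev\<close> by
  exhibiting a convenient representative in the class and comparing it with the chosen one.\<close>

lemma dhopf_of_D_Hopf_algebra:
  fixes scD :: "'k::field_char_0 \<Rightarrow> 'd::ab_group_add \<Rightarrow> 'd" and sc :: "'k \<Rightarrow> 'b::comm_ring_1 \<Rightarrow> 'b"
  assumes "D_Hopf_algebra scD br \<theta> (dalg_of_type sc d) \<Delta> \<epsilon> antipode"
    and bas: "\<And>x. \<exists>c. x = (\<Sum>i<h. scD (c i) (bas i))"
  shows "dhopf sc (\<lambda>b. rep (\<Delta> b)) \<epsilon> antipode scD br \<theta> d bas h"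
proof -
  define B where "B = dalg_of_type sc d"
  interpret H: D_Hopf_algebra scD br \<theta> B \<Delta> \<epsilon> antipode using assms(1) by (simp add: B_def)
  note typed = H.typed_algebra[OF H.D_algebra_B[unfolded B_def]]
  interpret A: scalar_algebra sc by (rule typed(1))
  let ?R = "tensor_rel B B"
  have [simp]: "carrier B = UNIV" "a \<oplus>\<^bsub>B\<^esub> b = a + b" "c \<odot>\<^bsub>B\<^esub> a = sc c a" "\<zero>\<^bsub>B\<^esub> = 0"
    "a \<otimes>\<^bsub>B\<^esub> b = a * b" "\<one>\<^bsub>B\<^esub> = 1" "der B = d" for a b :: 'b and c :: 'k
    by (simp_all add: B_def)
  have mult_B: "(\<otimes>\<^bsub>B\<^esub>) = (*)" by (intro ext) simp
  have [simp]: "carrier H.K = UNIV" "a \<oplus>\<^bsub>H.K\<^esub> b = a + b" "c \<odot>\<^bsub>H.K\<^esub> a = c * a" "\<zero>\<^bsub>H.K\<^esub> = 0"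
    "a \<otimes>\<^bsub>H.K\<^esub> b = a * b" "\<one>\<^bsub>H.K\<^esub> = 1" for a b c :: 'k
    by (simp_all add: H.K_def)
  define cop where "cop b = rep (\<Delta> b)" for b
  have \<Delta>_hom: "\<Delta> b \<in> carrier (tensor B B)" "\<Delta> (a + b) = \<Delta> a \<oplus>\<^bsub>tensor B B\<^esub> \<Delta> b"
    "\<Delta> (a * b) = \<Delta> a \<otimes>\<^bsub>tensor B B\<^esub> \<Delta> b" "\<Delta> 1 = \<one>\<^bsub>tensor B B\<^esub>"
    "\<Delta> (sc c a) = c \<odot>\<^bsub>tensor B B\<^esub> \<Delta> a" "\<Delta> (d x a) = der (tensor B B) x (\<Delta> a)" for a b c x
    using H.comult_hom by (auto simp: D_hom_def ring_hom_def)
  have cop: "\<Delta> b = ?R `` {cop b}" "cop b \<in> \<Delta> b" for b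
    using tensor_carrierD[of "\<Delta> b" sc d sc d] \<Delta>_hom(1) by (simp_all add: cop_def B_def)
  have mem: "A.balanced f \<Longrightarrow> ev f (cop b) = ev f w" if "w \<in> \<Delta> b" for b w and f :: "'b \<Rightarrow> 'b \<Rightarrow> 'b"
    using that A.tensor_ev[of f "cop b" w d] cop(1)[of b] by (auto simp: B_def)
  have self: "w \<in> ?R `` {w}" for w by (rule class_self) simp
  have \<epsilon>_hom: "\<epsilon> (a + b) = \<epsilon> a + \<epsilon> b" "\<epsilon> (a * b) = \<epsilon> a * \<epsilon> b" "\<epsilon> 1 = 1" "\<epsilon> (sc c a) = c * \<epsilon> a" for a b c
    using H.counit_hom by (auto simp: D_hom_def ring_hom_def)
  have \<epsilon>0: "\<epsilon> 0 = 0" using \<epsilon>_hom(1)[of 0 0] by simp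
  have S_hom: "antipode (a + b) = antipode a + antipode b" "antipode (a * b) = antipode a * antipode b"
    "antipode 1 = 1" "antipode (sc c a) = sc c (antipode a)" "antipode (d x a) = d x (antipode a)" for a b c x
    using H.antipode_hom by (auto simp: D_hom_def ring_hom_def)
  have S0: "antipode 0 = 0" using S_hom(1)[of 0 0] by simp
  have ev_list: "ev f (map (\<lambda>(a, b). (g a, g' b)) u) = ev (\<lambda>x y. f (g x) (g' y)) u"
    for f :: "'x \<Rightarrow> 'y \<Rightarrow> 'z::comm_monoid_add" and g :: "'u \<Rightarrow> 'x" and g' :: "'w \<Rightarrow> 'y" and u
    by (induction u) auto
  \<comment> \<open>Both antipode laws at once, with the antipode and the identity as
    \<open>g\<close> and \<open>g'\<close> in either order.\<close>
  have ant: "tensor_lift B (\<otimes>\<^bsub>B\<^esub>) (tensor_map B B g g' (\<Delta> b)) = ev (\<lambda>x y. g x * g' y) (cop b)"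
    if g: "\<And>a b. g (a + b) = g a + g b" "\<And>c a. g (sc c a) = sc c (g a)" "g 0 = 0"
      and g': "\<And>a b. g' (a + b) = g' a + g' b" "\<And>c a. g' (sc c a) = sc c (g' a)" for g g' b
  proof -
    have "tensor_map B B g g' (\<Delta> b) = ?R `` {map (\<lambda>(a, b). (g a, g' b)) (cop b)}"
      unfolding cop(1)[of b] unfolding B_def
      by (rule tensor_map_typed) (auto simp: g g')
    also have "tensor_lift B (\<otimes>\<^bsub>B\<^esub>) \<dots> = ev (\<otimes>\<^bsub>B\<^esub>) (map (\<lambda>(a, b). (g a, g' b)) (cop b))"
      unfolding B_def
    proof (rule tensor_lift_typed)
      fix v assume "(map (\<lambda>(a, b). (g a, g' b)) (cop b), v) \<in> tensor_rel (dalg_of_type sc d) (dalg_of_type sc d)"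
      then show "ev (\<otimes>\<^bsub>dalg_of_type sc d\<^esub>) (map (\<lambda>(a, b). (g a, g' b)) (cop b)) = ev (\<otimes>\<^bsub>dalg_of_type sc d\<^esub>) v"
        by (rule tensor_rel_ev) (auto simp: ring_distribs A.scale_mult_right[symmetric] A.scale_mult[symmetric])
    qed simp
    finally show ?thesis by (simp add: ev_list mult_B)
  qed
  show ?thesis
    unfolding cop_def[symmetric]
  proof
    fix f :: "'b \<Rightarrow> 'b \<Rightarrow> 'b" and a b c x assume f: "A.balanced f"
    have "cop a @ cop b \<in> \<Delta> (a + b)"
      unfolding \<Delta>_hom(2) tensor_sel using cop(2)[of a] cop(2)[of b] self by blast
    then show "ev f (cop (a + b)) = ev f (cop a) + ev f (cop b)"
      using mem[OF _ f] by simp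
    have "map (\<lambda>(a, b). (sc c a, b)) (cop a) \<in> \<Delta> (sc c a)"
      unfolding \<Delta>_hom(5) tensor_sel using cop(2)[of a] self by auto
    from mem[OF this f] show "ev f (cop (sc c a)) = ev (\<lambda>x y. f (sc c x) y) (cop a)"
      using ev_list[of f "sc c" "\<lambda>y. y"] by simp
    have "[(p * p', q * q'). (p, q) \<leftarrow> cop a, (p', q') \<leftarrow> cop b] \<in> \<Delta> (a * b)"
      unfolding \<Delta>_hom(3) tensor_sel
      by (rule UN_I[OF cop(2)[of a]], rule UN_I[OF cop(2)[of b]]) (use self in \<open>simp add: case_prod_beta\<close>)
    from mem[OF this f]
    show "ev f (cop (a * b)) = ev (\<lambda>x y. ev (\<lambda>x' y'. f (x * x') (y * y')) (cop b)) (cop a)"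
      by (simp add: ev_concat) (simp add: ev_def comp_def case_prod_beta)
    have "[(1, 1)] \<in> \<Delta> 1" unfolding \<Delta>_hom(4) tensor_sel using self by simp
    from mem[OF this f] show "ev f (cop 1) = f 1 1" by simp
    have "map (\<lambda>(a, b). (d x a, b)) (cop a) @ map (\<lambda>(a, b). (a, d x b)) (cop a) \<in> \<Delta> (d x a)"
      unfolding \<Delta>_hom(6) tensor_sel using cop(2)[of a] self by auto
    from mem[OF this f]
    show "ev f (cop (d x a)) = ev (\<lambda>p q. f (d x p) q + f p (d x q)) (cop a)"
      using ev_list[of f "d x" "\<lambda>y. y"] ev_list[of f "\<lambda>y. y" "d x"] by (simp add: ev_add_fun)
  next
    fix g :: "'b \<Rightarrow> 'b \<Rightarrow> 'b \<Rightarrow> 'b" and b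
    assume g: "\<And>z. A.balanced (\<lambda>x y. g x y z)" "\<And>x. A.balanced (\<lambda>y z. g x y z)"
    let ?l1 = "map (\<lambda>(x, z). (\<Delta> x, z)) (cop b)" and ?l0 = "map (\<lambda>(x, y). (x, \<Delta> y)) (cop b)"
    let ?l2 = "concat (map (\<lambda>(a, V). map (\<lambda>(b, c). (pure_tensor B B a b, c)) (rep V)) ?l0)"
    \<comment> \<open>The homomorphism property of \<open>\<Delta>\<close> does not mention 0, so
      this is obtained from scalar multiplication by 0.\<close>
    have zero: "\<Delta> 0 = \<zero>\<^bsub>tensor B B\<^esub>"
    proof -
      have "\<Delta> 0 = ?R `` {map (\<lambda>(a, b). (sc 0 a, b)) (cop 0)}"
        using \<Delta>_hom(5)[of 0 0] A.smult_class[of d 0 "cop 0"] cop(1)[of 0] by (simp add: B_def)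
      also have "\<dots> = ?R `` {[]}"
      proof (rule class_eq)
        show "(map (\<lambda>(a, b). (sc 0 a, b)) u, []) \<in> ?R" for u
        proof (induction u)
          case (Cons p u)
          have "([(0, snd p)], []) \<in> ?R" using tensor_rel.zero[of "snd p" B B] by simp
          from tensor_rel.append[OF this Cons] show ?case by (simp add: case_prod_beta)
        qed (simp add: tensor_rel.refl)
      qed
      finally show ?thesis by (simp add: tensor_sel)
    qed
    have "tensor_map (tensor B B) B \<Delta> (\<lambda>a. a) (\<Delta> b) = tensor_rel (tensor B B) B `` {?l1}"
      unfolding cop(1)[of b] unfolding B_def
      by (rule tensor_map_typed) (use \<Delta>_hom zero in \<open>auto simp: B_def\<close>)
    moreover have "tensor_map B (tensor B B) (\<lambda>a. a) \<Delta> (\<Delta> b) = tensor_rel B (tensor B B) `` {?l0}"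
      unfolding cop(1)[of b] unfolding B_def
      by (rule tensor_map_typed) (use \<Delta>_hom in \<open>auto simp: B_def\<close>)
    moreover have "tensor_assoc B B B (tensor_rel B (tensor B B) `` {?l0}) = tensor_rel (tensor B B) B `` {?l2}"
      unfolding B_def by (rule A.tensor_assoc_class) (use \<Delta>_hom(1) in \<open>auto simp: B_def\<close>)
    ultimately have "tensor_rel (tensor B B) B `` {?l1} = tensor_rel (tensor B B) B `` {?l2}"
      using H.coassoc[of b] by simp
    moreover have "?l2 \<in> lists (carrier (tensor B B) \<times> carrier B)"
      using A.pure_tensor_rules(1)[of d] by (auto simp: B_def)
    ultimately have rel: "(?l1, ?l2) \<in> tensor_rel (tensor B B) B" by (rule class_eqD)
    \<comment> \<open>The map \<open>g\<close> is read as a map on pairs of a class in the first two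
      factors and an element of the third; it is then applied to both sides of the coassociativity
      relation.\<close>
    let ?e = "\<lambda>V z. ev (\<lambda>p q. g p q z) (rep V)"
    have class_ev: "ev (\<lambda>p q. g p q z) (rep (?R `` {w})) = ev (\<lambda>p q. g p q z) w" for w z
    proof -
      have "?R `` {w} \<in> carrier (tensor B B)" by (simp add: tensor_sel quotientI)
      then have "(rep (?R `` {w}), w) \<in> ?R"
        using tensor_carrierD(3)[of "?R `` {w}" sc d sc d w] self by (simp add: B_def)
      then show ?thesis using A.tensor_ev[OF g(1)] by (simp add: B_def)
    qed
    have repV: "V = ?R `` {rep V}" if "V \<in> carrier (tensor B B)" for V
      using tensor_carrierD(1)[of V sc d sc d] that by (simp add: B_def)
    have "ev ?e ?l1 = ev ?e ?l2"
    proof (rule tensor_rel_ev[OF rel])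
      fix V V' z assume V: "V \<in> carrier (tensor B B)" "V' \<in> carrier (tensor B B)"
      have "V \<oplus>\<^bsub>tensor B B\<^esub> V' = ?R `` {rep V @ rep V'}"
        using tensor_add_class[of "rep V" B B "rep V'"] repV[OF V(1)] repV[OF V(2)] by simp
      then show "?e (V \<oplus>\<^bsub>tensor B B\<^esub> V') z = ?e V z + ?e V' z" by (simp add: class_ev)
    next
      fix V z z' show "?e V (z \<oplus>\<^bsub>B\<^esub> z') = ?e V z + ?e V z'"
        using A.balanced_add(2)[OF g(2)] by (simp add: ev_add_fun)
    next
      fix z show "?e \<zero>\<^bsub>tensor B B\<^esub> z = 0" by (simp add: tensor_sel class_ev)
    next
      fix V z and c :: 'k assume V: "V \<in> carrier (tensor B B)"
      have "c \<odot>\<^bsub>tensor B B\<^esub> V = ?R `` {map (\<lambda>(a, b). (sc c a, b)) (rep V)}"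
        using A.smult_class[of d c "rep V"] repV[OF V] by (simp add: B_def)
      then have "?e (c \<odot>\<^bsub>tensor B B\<^esub> V) z = ev (\<lambda>p q. g (sc c p) q z) (rep V)"
        using ev_list[of "\<lambda>p q. g p q z" "sc c" "\<lambda>y. y"] by (simp add: class_ev)
      also have "\<dots> = ?e V (c \<odot>\<^bsub>B\<^esub> z)"
        using A.balanced_scale[OF g(1)] A.balanced_scale[OF g(2)] by simp
      finally show "?e (c \<odot>\<^bsub>tensor B B\<^esub> V) z = ?e V (c \<odot>\<^bsub>B\<^esub> z)" .
    qed
    also have "ev ?e ?l2 = ev (\<lambda>x y. ev (\<lambda>p q. g x p q) (cop y)) (cop b)"
    proof -
      have "ev ?e (map (\<lambda>(b, c). (pure_tensor B B x b, c)) w) = ev (\<lambda>p q. g x p q) w" for x w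
        by (induction w) (auto simp: pure_tensor_def class_ev)
      then have "ev ?e (concat (map (\<lambda>(a, V). map (\<lambda>(b, c). (pure_tensor B B a b, c)) (rep V))
          (map (\<lambda>(x, y). (x, \<Delta> y)) u))) = ev (\<lambda>x y. ev (\<lambda>p q. g x p q) (cop y)) u" for u
        by (induction u) (auto simp: cop_def)
      then show ?thesis .
    qed
    also have "ev ?e ?l1 = ev (\<lambda>x z. ev (\<lambda>p q. g p q z) (cop x)) (cop b)"
      using ev_list[of ?e \<Delta> "\<lambda>z. z"] by (simp add: cop_def)
    finally show "ev (\<lambda>x z. ev (\<lambda>p q. g p q z) (cop x)) (cop b) =
      ev (\<lambda>x y. ev (\<lambda>p q. g x p q) (cop y)) (cop b)" .
  next
    fix b
    show "ev (\<lambda>x y. antipode x * y) (cop b) = sc (\<epsilon> b) 1"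
      using H.antipode_left[of b, unfolded mult_B] ant[unfolded mult_B, of antipode "\<lambda>a. a" b] by (simp add: S_hom S0)
    show "ev (\<lambda>x y. x * antipode y) (cop b) = sc (\<epsilon> b) 1"
      using H.antipode_right[of b, unfolded mult_B] ant[unfolded mult_B, of "\<lambda>a. a" antipode b] by (simp add: S_hom S0)
    have "tensor_map H.K B \<epsilon> (\<lambda>a. a) (\<Delta> b) = tensor_rel H.K B `` {map (\<lambda>(a, b). (\<epsilon> a, b)) (cop b)}"
      unfolding cop(1)[of b] unfolding B_def
      by (rule tensor_map_typed) (auto simp: \<epsilon>_hom \<epsilon>0)
    moreover have "tensor_lift B (\<lambda>c a. c \<odot>\<^bsub>B\<^esub> a) (tensor_rel H.K B `` {u}) = ev (\<lambda>c a. c \<odot>\<^bsub>B\<^esub> a) u" for u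
      unfolding B_def
    proof (rule tensor_lift_typed)
      fix v assume "(u, v) \<in> tensor_rel H.K (dalg_of_type sc d)"
      then show "ev (smult (dalg_of_type sc d)) u = ev (smult (dalg_of_type sc d)) v"
        by (rule tensor_rel_ev) (auto simp: A.scale_left_distrib A.scale_right_distrib mult.commute)
    qed simp
    ultimately show "ev (\<lambda>x y. sc (\<epsilon> x) y) (cop b) = b"
      using H.counit_left[of b] ev_list[of sc \<epsilon> "\<lambda>y. y" "cop b"] by simp
    have "tensor_map B H.K (\<lambda>a. a) \<epsilon> (\<Delta> b) = tensor_rel B H.K `` {map (\<lambda>(a, b). (a, \<epsilon> b)) (cop b)}"
      unfolding cop(1)[of b] unfolding B_def
      by (rule tensor_map_typed) (auto simp: \<epsilon>_hom)
    moreover have "tensor_lift B (\<lambda>a c. c \<odot>\<^bsub>B\<^esub> a) (tensor_rel B H.K `` {u}) = ev (\<lambda>a c. c \<odot>\<^bsub>B\<^esub> a) u" for u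
      unfolding B_def
    proof (rule tensor_lift_typed)
      fix v assume "(u, v) \<in> tensor_rel (dalg_of_type sc d) H.K"
      then show "ev (\<lambda>a c. c \<odot>\<^bsub>dalg_of_type sc d\<^esub> a) u = ev (\<lambda>a c. c \<odot>\<^bsub>dalg_of_type sc d\<^esub> a) v"
        by (rule tensor_rel_ev) (auto simp: A.scale_left_distrib A.scale_right_distrib mult.commute)
    qed simp
    ultimately show "ev (\<lambda>x y. sc (\<epsilon> y) x) (cop b) = b"
      using H.counit_right[of b] ev_list[of "\<lambda>a c. sc c a" "\<lambda>y. y" \<epsilon> "cop b"] by simp
  next
    show "A.functional \<epsilon>" by (simp add: A.functional_def \<epsilon>_hom)
  qed (simp_all add: \<epsilon>_hom S_hom typed bas)
qed

section \<open>Dickson's lemma\<close>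

lemma nat_seq_mono_subseq: "\<exists>r::nat \<Rightarrow> nat. strict_mono r \<and> (\<forall>i j. i \<le> j \<longrightarrow> g (r i) \<le> (g (r j) :: nat))"
proof -
  obtain f where f: "strict_mono f" "monoseq (\<lambda>n. g (f n))" using seq_monosub by blast
  show ?thesis
  proof (cases "\<forall>m. \<forall>n\<ge>m. g (f m) \<le> g (f n)")
    case True
    then show ?thesis using f(1) by blast
  next
    case False
    then have dec: "g (f n) \<le> g (f m)" if "m \<le> n" for m n
      using f(2) that unfolding monoseq_def by blast
    \<comment> \<open>A decreasing sequence of natural numbers is constant from the place of its
      minimum on.\<close>
    obtain n0 where n0: "\<And>n. g (f n0) \<le> g (f n)"
      using ex_has_least_nat[of "\<lambda>_. True" _ "\<lambda>n. g (f n)"] by blast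
    have "strict_mono (\<lambda>n. f (n + n0))" using f(1) by (auto simp: strict_mono_def)
    moreover have "g (f (i + n0)) \<le> g (f (j + n0))" for i j
      using n0[of "j + n0"] dec[of n0 "i + n0"] by simp
    ultimately show ?thesis by (intro exI[of _ "\<lambda>n. f (n + n0)"]) simp
  qed
qed

text \<open>The subsequence is thinned out once for each variable.\<close>

lemma count_mono_subseq:
  fixes p :: nat
  shows "\<exists>r::nat \<Rightarrow> nat. strict_mono r \<and> (\<forall>i j. i \<le> j \<longrightarrow> (\<forall>k<p. count (f (r i)) k \<le> count (f (r j)) k))"
proof (induction p)
  case 0
  show ?case by (rule exI[of _ id]) (simp add: strict_mono_def)
next
  case (Suc p)
  then obtain r :: "nat \<Rightarrow> nat" where r: "strict_mono r" "\<And>i j k. i \<le> j \<Longrightarrow> k < p \<Longrightarrow> count (f (r i)) k \<le> count (f (r j)) k"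
    by blast
  obtain s :: "nat \<Rightarrow> nat" where s: "strict_mono s" "\<And>i j. i \<le> j \<Longrightarrow> count (f (r (s i))) p \<le> count (f (r (s j))) p"
    using nat_seq_mono_subseq[of "\<lambda>n. count (f (r n)) p"] by blast
  have "strict_mono (r \<circ> s)" using r(1) s(1) by (simp add: strict_mono_o)
  moreover have "count (f ((r \<circ> s) i)) k \<le> count (f ((r \<circ> s) j)) k" if "i \<le> j" "k < Suc p" for i j k
    using that s(2)[OF that(1)] r(2)[of "s i" "s j" k] strict_mono_less_eq[OF s(1)]
    by (cases "k = p") auto
  ultimately show ?case by blast
qed

text \<open>\<open>M\<close> consists of the minimal elements. Were it infinite, a subsequence
  monotone in every count would contain two comparable ones at different places, which minimality
  makes equal.\<close>

lemma dickson:
  fixes U :: "nat multiset set"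
  assumes U: "\<And>\<mu>. \<mu> \<in> U \<Longrightarrow> set_mset \<mu> \<subseteq> {..<p}"
  obtains M where "finite M" "M \<subseteq> U" "\<And>\<mu>. \<mu> \<in> U \<Longrightarrow> \<exists>\<nu>\<in>M. \<nu> \<subseteq># \<mu>"
proof -
  define M where "M = {\<mu> \<in> U. \<forall>\<nu>\<in>U. \<nu> \<subseteq># \<mu> \<longrightarrow> \<nu> = \<mu>}"
  have "\<exists>\<nu>\<in>M. \<nu> \<subseteq># \<mu>" if "\<mu> \<in> U" for \<mu>
    using that
  proof (induction "size \<mu>" arbitrary: \<mu> rule: less_induct)
    case less
    show ?case
    proof (cases "\<mu> \<in> M")
      case False
      then obtain \<nu> where \<nu>: "\<nu> \<in> U" "\<nu> \<subset># \<mu>" using less.prems by (auto simp: M_def subset_mset.less_le)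
      then obtain \<nu>' where "\<nu>' \<in> M" "\<nu>' \<subseteq># \<nu>" using less.hyps mset_subset_size by blast
      then show ?thesis using \<nu>(2) by (meson subset_mset.less_imp_le subset_mset.order_trans)
    qed auto
  qed
  moreover have "finite M"
  proof (rule ccontr)
    assume "infinite M"
    then obtain f :: "nat \<Rightarrow> nat multiset" where f: "inj f" "range f \<subseteq> M"
      using infinite_countable_subset by blast
    obtain r :: "nat \<Rightarrow> nat" where r: "strict_mono r"
        "\<And>i j k. i \<le> j \<Longrightarrow> k < p \<Longrightarrow> count (f (r i)) k \<le> count (f (r j)) k"
      using count_mono_subseq[of p f] by blast
    have fM: "f i \<in> M" for i using f(2) by blast
    have "count (f (r 0)) k \<le> count (f (r 1)) k" for k
    proof (cases "k < p")
      case False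
      then have "k \<notin># f (r 0)" using U[of "f (r 0)"] fM by (auto simp: M_def)
      then show ?thesis by (simp add: not_in_iff)
    qed (use r(2) in simp)
    then have "f (r 0) \<subseteq># f (r 1)" by (simp add: subseteq_mset_def)
    then have "f (r 0) = f (r 1)" using fM unfolding M_def by blast
    then have "r 0 = r 1" using f(1) by (simp add: inj_eq)
    then show False using r(1) by (metis strict_mono_eq zero_neq_one)
  qed
  ultimately show thesis using that[of M] by (auto simp: M_def)
qed

section \<open>Congruences on differential terms\<close>

definition list_of :: "'a multiset \<Rightarrow> 'a list" where
  "list_of M = (SOME xs. mset xs = M)"

lemma mset_list_of [simp]: "mset (list_of M) = M"
  unfolding list_of_def by (rule someI_ex) (rule ex_mset)

lemma list_of_empty [simp]: "list_of {#} = []"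
  by (metis mset_list_of mset_zero_iff)

text \<open>The variables below \<open>p\<close> stand for generators of the Hopf algebra of order 0 and the next \<open>q\<close> for the
  logarithmic derivatives; all others are set to zero, so that the congruence lives on all terms.\<close>
locale term_cong = differential_field scD br \<theta>
  for scD :: "'k::field \<Rightarrow> 'd::ab_group_add \<Rightarrow> 'd" and br \<theta> +
  fixes cong :: "(nat, 'k, 'd) dterm \<Rightarrow> (nat, 'k, 'd) dterm \<Rightarrow> bool" (infix \<open>\<sim>\<close> 50)
    and p q :: nat and bas :: "nat \<Rightarrow> 'd" and h :: nat
  assumes cong_eq: "s \<approx> t \<Longrightarrow> s \<sim> t"
    and cong_sym: "s \<sim> t \<Longrightarrow> t \<sim> s"
    and cong_trans: "s \<sim> t \<Longrightarrow> t \<sim> u \<Longrightarrow> s \<sim> u"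
    and cong_plus: "s \<sim> s' \<Longrightarrow> t \<sim> t' \<Longrightarrow> Plus s t \<sim> Plus s' t'"
    and cong_times: "s \<sim> s' \<Longrightarrow> t \<sim> t' \<Longrightarrow> Times s t \<sim> Times s' t'"
    and cong_der: "s \<sim> s' \<Longrightarrow> Der x s \<sim> Der x s'"
    and cong_var: "p + q \<le> j \<Longrightarrow> Var j \<sim> Const 0"
    and bas: "\<exists>c. x = (\<Sum>i<h. scD (c i) (bas i))"
begin

text \<open>Choosing representatives turns the congruence into an equality, on which the simplifier can
  calculate as in a commutative ring.\<close>
definition nf :: "(nat, 'k, 'd) dterm \<Rightarrow> (nat, 'k, 'd) dterm" where
  "nf t = (SOME u. t \<sim> u)"

lemma cong_refl: "t \<sim> t" by (rule cong_eq[OF dterm_eq.refl])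

lemma nf_cong: "t \<sim> nf t" unfolding nf_def by (rule someI[of _ t]) (rule cong_refl)

lemma cong_iff: "s \<sim> t \<longleftrightarrow> nf s = nf t"
proof
  assume "s \<sim> t"
  then have "(\<lambda>u. s \<sim> u) = (\<lambda>u. t \<sim> u)" using cong_sym cong_trans by blast
  then show "nf s = nf t" by (simp add: nf_def)
next
  assume "nf s = nf t"
  then show "s \<sim> t" using nf_cong[of s] nf_cong[of t] cong_sym cong_trans by metis
qed

definition pl (infixl \<open>\<oplus>\<oplus>\<close> 65) where "pl s t = nf (Plus s t)"
definition tm (infixl \<open>\<otimes>\<otimes>\<close> 70) where "tm s t = nf (Times s t)"
definition dr where "dr x t = nf (Der x t)"
definition cn where "cn c = nf (Const c)"

lemma nf_nf [simp]: "nf (nf t) = nf t" using nf_cong[of t] by (simp add: cong_iff)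

lemma nf_push [simp]: "nf (Plus s t) = nf s \<oplus>\<oplus> nf t" "nf (Times s t) = nf s \<otimes>\<otimes> nf t"
    "nf (Der x t) = dr x (nf t)" "nf (Const c) = cn c"
    "nf (s \<oplus>\<oplus> t) = s \<oplus>\<oplus> t" "nf (s \<otimes>\<otimes> t) = s \<otimes>\<otimes> t" "nf (dr x t) = dr x t" "nf (cn c) = cn c"
  using cong_plus[OF nf_cong nf_cong] cong_times[OF nf_cong nf_cong] cong_der[OF nf_cong]
  by (simp_all add: pl_def tm_def dr_def cn_def cong_iff)

text \<open>The operations normalise only their result; these rules allow an argument to be replaced
  by a congruent one, so they are operations on congruence classes.\<close>

lemma absorb: "nf s \<oplus>\<oplus> t = s \<oplus>\<oplus> t" "s \<oplus>\<oplus> nf t = s \<oplus>\<oplus> t" "nf s \<otimes>\<otimes> t = s \<otimes>\<otimes> t" "s \<otimes>\<otimes> nf t = s \<otimes>\<otimes> t"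
  "dr x (nf t) = dr x t"
  unfolding pl_def tm_def dr_def using nf_push(1-3)
  by (metis nf_nf pl_def tm_def dr_def)+

lemma eq_nf: "s \<approx> t \<Longrightarrow> nf s = nf t" using cong_eq cong_iff by blast

lemma ring_rules:
  "(s \<oplus>\<oplus> t) \<oplus>\<oplus> u = s \<oplus>\<oplus> (t \<oplus>\<oplus> u)" "s \<oplus>\<oplus> t = t \<oplus>\<oplus> s" "(s \<otimes>\<otimes> t) \<otimes>\<otimes> u = s \<otimes>\<otimes> (t \<otimes>\<otimes> u)" "s \<otimes>\<otimes> t = t \<otimes>\<otimes> s"
  "(s \<oplus>\<oplus> t) \<otimes>\<otimes> u = s \<otimes>\<otimes> u \<oplus>\<oplus> t \<otimes>\<otimes> u"
  using eq_nf[OF Plus_assoc[of s t u]] eq_nf[OF Plus_commute[of s t]] eq_nf[OF Times_assoc[of s t u]]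
    eq_nf[OF Times_commute[of s t]] eq_nf[OF distrib[of s t u]]
  by (simp_all add: absorb)

lemma ring_distrib: "u \<otimes>\<otimes> (s \<oplus>\<oplus> t) = u \<otimes>\<otimes> s \<oplus>\<oplus> u \<otimes>\<otimes> t"
  by (metis ring_rules(4,5))

lemma ring_lcomm: "s \<oplus>\<oplus> (t \<oplus>\<oplus> u) = t \<oplus>\<oplus> (s \<oplus>\<oplus> u)" "s \<otimes>\<otimes> (t \<otimes>\<otimes> u) = t \<otimes>\<otimes> (s \<otimes>\<otimes> u)"
  by (metis ring_rules(1,2), metis ring_rules(3,4))

lemmas ring_ac = ring_rules ring_distrib ring_lcomm

lemma const_rules:
  "cn 0 \<oplus>\<oplus> s = nf s" "s \<oplus>\<oplus> cn 0 = nf s" "cn 1 \<otimes>\<otimes> s = nf s" "s \<otimes>\<otimes> cn 1 = nf s"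
  "cn (- 1) \<otimes>\<otimes> s \<oplus>\<oplus> s = cn 0" "cn a \<oplus>\<oplus> cn b = cn (a + b)" "cn a \<otimes>\<otimes> cn b = cn (a * b)"
  using eq_nf[OF Plus_zero[of s]] eq_nf[OF Times_one[of s]] eq_nf[OF Plus_minus[of s]]
    eq_nf[OF Const_plus[of a b]] eq_nf[OF Const_times[of a b]]
  by (simp_all add: absorb ring_rules(2,4))

lemma const_lmult: "cn a \<otimes>\<otimes> (cn b \<otimes>\<otimes> s) = cn (a * b) \<otimes>\<otimes> s"
  by (metis ring_rules(3) const_rules(7))

lemma times_0: "cn 0 \<otimes>\<otimes> s = cn 0"
proof -
  have "cn 0 \<otimes>\<otimes> s = (cn (- 1) \<oplus>\<oplus> cn 1) \<otimes>\<otimes> s" by (simp add: const_rules)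
  also have "\<dots> = cn (- 1) \<otimes>\<otimes> s \<oplus>\<oplus> s" by (simp only: ring_rules(5) const_rules(3) absorb)
  finally show ?thesis by (simp add: const_rules)
qed

lemma der_rules:
  "dr x (s \<oplus>\<oplus> t) = dr x s \<oplus>\<oplus> dr x t" "dr x (s \<otimes>\<otimes> t) = dr x s \<otimes>\<otimes> t \<oplus>\<oplus> s \<otimes>\<otimes> dr x t"
  "dr x (cn a) = cn (\<theta> x a)" "dr (x + y) s = dr x s \<oplus>\<oplus> dr y s" "dr (scD a x) s = cn a \<otimes>\<otimes> dr x s"
  using eq_nf[OF Der_Plus[of x s t]] eq_nf[OF Der_Times[of x s t]] eq_nf[OF Der_Const[of x a]]
    eq_nf[OF Der_add[of x y s]] eq_nf[OF Der_scale[of a x s]]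
  by (simp_all add: absorb)

lemma der_bracket: "dr (br x y) s = dr x (dr y s) \<oplus>\<oplus> cn (- 1) \<otimes>\<otimes> dr y (dr x s)"
  using eq_nf[OF Der_bracket[of x y s]] by (simp add: absorb)

text \<open>Exchanging two derivations costs one application of their bracket, which is a single
  derivation and hence a term of smaller order.\<close>

lemma der_commute: "dr x (dr y s) = dr (br x y) s \<oplus>\<oplus> dr y (dr x s)"
  unfolding der_bracket ring_rules(1) const_rules(5) by (simp add: const_rules)

text \<open>Derivations do not commute, so a multiset of them is applied in sorted order; by
  \<open>zl_commute\<close>, sorting in a further derivation costs only terms of smaller
  order.\<close>

definition zt :: "nat multiset \<Rightarrow> nat \<Rightarrow> (nat, 'k, 'd) dterm" where
  "zt \<beta> l = foldr (\<lambda>i. Der (bas i)) (sorted_list_of_multiset \<beta>) (Var (p + l))"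

text \<open>Polynomials of order at most \<open>m\<close>. The variable \<open>p + l\<close> stands
  for a logarithmic derivative, already of order 1, so \<open>zt \<beta> l\<close> has order
  \<open>size \<beta> + 1\<close> and the bound on the size is strict.\<close>

inductive_set pol :: "nat \<Rightarrow> (nat, 'k, 'd) dterm set" for m where
  pol_Const: "Const c \<in> pol m"
| pol_Var: "j < p \<Longrightarrow> Var j \<in> pol m"
| pol_zt: "\<lbrakk>set_mset \<beta> \<subseteq> {..<h}; l < q; size \<beta> < m\<rbrakk> \<Longrightarrow> zt \<beta> l \<in> pol m"
| pol_Plus: "\<lbrakk>s \<in> pol m; t \<in> pol m\<rbrakk> \<Longrightarrow> Plus s t \<in> pol m"
| pol_Times: "\<lbrakk>s \<in> pol m; t \<in> pol m\<rbrakk> \<Longrightarrow> Times s t \<in> pol m"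

definition sat :: "(nat, 'k, 'd) dterm set \<Rightarrow> (nat, 'k, 'd) dterm set" where
  "sat A = {t. \<exists>s\<in>A. nf t = nf s}"

lemma sat_base: "t \<in> A \<Longrightarrow> t \<in> sat A" by (auto simp: sat_def)

lemma sat_nf: "nf t = nf s \<Longrightarrow> s \<in> sat A \<Longrightarrow> t \<in> sat A" by (auto simp: sat_def)

lemma sat_nf_iff: "nf t \<in> sat A \<longleftrightarrow> t \<in> sat A" by (auto simp: sat_def)

lemma pol_mono: "m \<le> m' \<Longrightarrow> t \<in> pol m \<Longrightarrow> t \<in> pol m'"
  by (rotate_tac, induction rule: pol.induct) (auto intro: pol.intros)

lemma sat_pol_mono: "m \<le> m' \<Longrightarrow> t \<in> sat (pol m) \<Longrightarrow> t \<in> sat (pol m')"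
  by (auto simp: sat_def intro: pol_mono)

lemma sat_pol_plus: assumes "s \<in> sat (pol m)" "t \<in> sat (pol m)" shows "s \<oplus>\<oplus> t \<in> sat (pol m)"
proof -
  from assms obtain s' t' where "s' \<in> pol m" "t' \<in> pol m" "nf s = nf s'" "nf t = nf t'" by (auto simp: sat_def)
  then show ?thesis unfolding sat_def by (auto intro!: bexI[of _ "Plus s' t'"] pol_Plus) (metis absorb(1,2))
qed

lemma sat_pol_times: assumes "s \<in> sat (pol m)" "t \<in> sat (pol m)" shows "s \<otimes>\<otimes> t \<in> sat (pol m)"
proof -
  from assms obtain s' t' where "s' \<in> pol m" "t' \<in> pol m" "nf s = nf s'" "nf t = nf t'" by (auto simp: sat_def)
  then show ?thesis unfolding sat_def by (auto intro!: bexI[of _ "Times s' t'"] pol_Times) (metis absorb(3,4))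
qed

lemma sat_pol_cn: "cn c \<in> sat (pol m)"
  using sat_base[OF pol_Const[of c m]] sat_nf[of "cn c" "Const c"] by simp

lemma der_basis:
  assumes "\<And>s t. s \<in> Q \<Longrightarrow> t \<in> Q \<Longrightarrow> s \<oplus>\<oplus> t \<in> Q" "\<And>c s. s \<in> Q \<Longrightarrow> cn c \<otimes>\<otimes> s \<in> Q" "cn 0 \<in> Q"
    and "\<And>i. i < h \<Longrightarrow> dr (bas i) t \<in> Q"
  shows "dr x t \<in> Q"
proof -
  obtain c where x: "x = (\<Sum>i<h. scD (c i) (bas i))" using bas by blast
  have "n \<le> h \<Longrightarrow> dr (\<Sum>i<n. scD (c i) (bas i)) t \<in> Q" for n
  proof (induction n)
    case 0
    \<comment> \<open>The empty sum is the zero derivation; written as \<open>scD 0 (bas 0)\<close>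
      it is seen to act as zero.\<close>
    have "vector_space scD" using finite_dim by (auto simp: finite_dimensional_vector_space_def)
    then interpret V: vector_space scD .
    have "scD 0 (bas 0) = 0" by simp
    then show ?case using der_rules(5)[of 0 "bas 0" t] assms(3) by (simp add: times_0)
  next
    case (Suc n)
    then show ?case using assms(1,2,4) by (simp add: der_rules)
  qed
  then show ?thesis unfolding x by simp
qed

end

text \<open>A bound for the order, read off from the syntax. It is counted as in \<open>pol\<close>,
  hence 1 for the variables of the logarithmic derivatives.\<close>

primrec weight :: "nat \<Rightarrow> (nat, 'k, 'd) dterm \<Rightarrow> nat" where
  "weight p (Var j) = (if j < p then 0 else 1)"
| "weight p (Const c) = 0"
| "weight p (Plus s t) = max (weight p s) (weight p t)"
| "weight p (Times s t) = max (weight p s) (weight p t)"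
| "weight p (Der x t) = Suc (weight p t)"

text \<open>The condition expresses the derivatives of the order 0 generators through these
  generators and the logarithmic derivatives themselves. It is what makes every term congruent to an
  element of \<open>pol\<close>, see \<open>all_pol\<close>.\<close>

locale der_term_cong = term_cong scD br \<theta> cong p q bas h
  for scD :: "'k::field \<Rightarrow> 'd::ab_group_add \<Rightarrow> 'd" and br \<theta>
    and cong :: "(nat, 'k, 'd) dterm \<Rightarrow> (nat, 'k, 'd) dterm \<Rightarrow> bool" (infix \<open>\<sim>\<close> 50)
    and p q bas h +
  assumes der_var: "\<lbrakk>i < h; j < p\<rbrakk> \<Longrightarrow> \<exists>t\<in>pol 1. Der (bas i) (Var j) \<sim> t"
begin

declare absorb [simp]

definition zl :: "nat list \<Rightarrow> nat \<Rightarrow> (nat, 'k, 'd) dterm" where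
  "zl xs l = foldr (\<lambda>i. Der (bas i)) xs (Var (p + l))"

lemma zl_Cons: "zl (i # xs) l = Der (bas i) (zl xs l)"
  by (simp add: zl_def)

lemma zt_zl: "sorted xs \<Longrightarrow> zl xs l = zt (mset xs) l"
  by (simp add: zl_def zt_def sorted_sort_id)

lemma zl_pol: "sorted xs \<Longrightarrow> set xs \<subseteq> {..<h} \<Longrightarrow> l < q \<Longrightarrow> length xs < m \<Longrightarrow> zl xs l \<in> pol m"
  by (simp add: zt_zl pol_zt)

lemma der_basis_pol:
  assumes "\<And>i. i < h \<Longrightarrow> dr (bas i) t \<in> sat (pol m)"
  shows "dr x t \<in> sat (pol m)"
  by (rule der_basis[OF _ _ sat_pol_cn assms]) (auto intro: sat_pol_plus sat_pol_times sat_pol_cn)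

text \<open>Insertion of a derivation into a sorted product. Each exchange leaves a bracket of
  smaller order, which is expanded in the spanning family. The remainder is differentiated in turn;
  the first hypothesis, provided by the induction in \<open>der_pol\<close>, covers its
  order.\<close>

lemma zl_commute:
  assumes "\<And>k t x. k \<le> length xs \<Longrightarrow> t \<in> pol k \<Longrightarrow> dr x t \<in> sat (pol (Suc k))"
    and "sorted xs" "set xs \<subseteq> {..<h}" "l < q" "i < h"
  shows "\<exists>r\<in>sat (pol (Suc (length xs))). dr (bas i) (zl xs l) = zl (insort i xs) l \<oplus>\<oplus> r"
  using assms
proof (induction xs arbitrary: i)
  case Nil
  show ?case
    by (rule bexI[of _ "cn 0", OF _ sat_pol_cn]) (simp add: zl_Cons const_rules)
next
  case (Cons b ys)
  show ?case
  proof (cases "i \<le> b")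
    case True
    then show ?thesis
      using absorb(5)[of "bas i" "Der (bas b) (zl ys l)"]
      by (intro bexI[of _ "cn 0", OF _ sat_pol_cn]) (simp add: zl_Cons const_rules)
  next
    case False
    let ?m = "Suc (length ys)"
    have IH: "\<exists>r\<in>sat (pol ?m). dr (bas i) (zl ys l) = zl (insort i ys) l \<oplus>\<oplus> r" if "i < h" for i
      using Cons.prems that by (intro Cons.IH) auto
    obtain r where r: "r \<in> sat (pol ?m)" "dr (bas i) (zl ys l) = zl (insort i ys) l \<oplus>\<oplus> r"
      using IH Cons.prems(5) by blast
    have 1: "dr (br (bas i) (bas b)) (zl ys l) \<in> sat (pol (Suc ?m))"
    proof (rule der_basis_pol)
      fix j assume j: "j < h"
      obtain r' where r': "r' \<in> sat (pol ?m)" "dr (bas j) (zl ys l) = zl (insort j ys) l \<oplus>\<oplus> r'"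
        using IH[OF j] by blast
      have "zl (insort j ys) l \<in> pol (Suc ?m)"
        using Cons.prems j by (intro zl_pol) (auto simp: sorted_insort set_insort_key)
      then show "dr (bas j) (zl ys l) \<in> sat (pol (Suc ?m))"
        unfolding r' using sat_pol_mono[of ?m "Suc ?m" r'] r'(1) by (intro sat_pol_plus[OF sat_base]) auto
    qed
    obtain r0 where r0: "r0 \<in> pol ?m" "nf r = nf r0" using r(1) by (auto simp: sat_def)
    have "dr (bas b) r0 \<in> sat (pol (Suc ?m))"
      using Cons.prems(1)[of ?m] r0(1) by simp
    then have 2: "dr (bas b) r \<in> sat (pol (Suc ?m))"
      using r0(2) absorb(5)[of "bas b" r] absorb(5)[of "bas b" r0] by simp
    have "dr (bas i) (zl (b # ys) l) = dr (br (bas i) (bas b)) (zl ys l) \<oplus>\<oplus> dr (bas b) (dr (bas i) (zl ys l))"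
      unfolding zl_Cons using der_commute[of "bas i" "bas b" "zl ys l"]
      by (metis absorb(5) nf_push(3))
    also have "\<dots> = zl (insort i (b # ys)) l \<oplus>\<oplus> (dr (br (bas i) (bas b)) (zl ys l) \<oplus>\<oplus> dr (bas b) r)"
    proof -
      have "zl (insort i (b # ys)) l \<oplus>\<oplus> u = dr (bas b) (zl (insort i ys) l) \<oplus>\<oplus> u" for u
        using False absorb(1)[of "zl (insort i (b # ys)) l" u] by (simp add: zl_Cons)
      then show ?thesis by (simp add: r(2) der_rules ring_ac)
    qed
    finally show ?thesis using sat_pol_plus[OF 1 2] by auto
  qed
qed

text \<open>Induction on \<open>m\<close> and, inside it, on the polynomial. For
  \<open>zt \<beta> l\<close> the derivation is sorted in by \<open>zl_commute\<close>, whose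
  hypothesis concerns only orders up to \<open>size \<beta>\<close>, which is less than
  \<open>m\<close>.\<close>

lemma der_pol: "t \<in> pol m \<Longrightarrow> dr x t \<in> sat (pol (Suc m))"
proof (induction m arbitrary: t x rule: less_induct)
  case (less m)
  from less.prems show ?case
  proof (induction arbitrary: x rule: pol.induct)
    case (pol_Const c)
    have "dr x (Const c) = cn (\<theta> x c)"
      using der_rules(3)[of x c] absorb(5)[of x "Const c"] by simp
    then show ?case by (simp add: sat_pol_cn)
  next
    case (pol_Var j)
    show ?case
    proof (rule der_basis_pol)
      fix i assume "i < h"
      then obtain t where t: "t \<in> pol 1" "Der (bas i) (Var j) \<sim> t" using der_var pol_Var by blast
      then have "dr (bas i) (Var j) = nf t" by (simp add: cong_iff)
      then show "dr (bas i) (Var j) \<in> sat (pol (Suc m))"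
        using pol_mono[of 1 "Suc m" t] t(1) by (simp add: sat_nf_iff sat_base)
    qed
  next
    case (pol_zt \<beta> l)
    show ?case
    proof (rule der_basis_pol)
      fix i assume i: "i < h"
      let ?xs = "sorted_list_of_multiset \<beta>"
      have len: "length ?xs = size \<beta>" by (metis mset_sorted_list_of_multiset size_mset)
      have "zt \<beta> l = zl ?xs l" by (simp add: zt_zl sorted_sorted_list_of_multiset)
      moreover have "\<exists>r\<in>sat (pol (Suc (length ?xs))). dr (bas i) (zl ?xs l) = zl (insort i ?xs) l \<oplus>\<oplus> r"
        by (rule zl_commute) (use pol_zt i less.IH len in auto)
      ultimately obtain r where r: "r \<in> sat (pol (Suc (size \<beta>)))" "dr (bas i) (zt \<beta> l) = zl (insort i ?xs) l \<oplus>\<oplus> r"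
        using len by auto
      have "zl (insort i ?xs) l \<in> pol (Suc m)"
        using pol_zt i by (intro zl_pol) (auto simp: sorted_insort set_insort_key len)
      moreover have "r \<in> sat (pol (Suc m))"
        using r(1) pol_zt(3) by (auto elim: sat_pol_mono[rotated])
      ultimately show "dr (bas i) (zt \<beta> l) \<in> sat (pol (Suc m))"
        unfolding r(2) by (intro sat_pol_plus[OF sat_base])
    qed
  next
    case (pol_Plus s t)
    have "dr x (Plus s t) = dr x s \<oplus>\<oplus> dr x t"
      using absorb(5)[of x "Plus s t"] by (simp add: der_rules)
    then show ?case using pol_Plus.IH by (simp add: sat_pol_plus)
  next
    case (pol_Times s t)
    have "dr x (Times s t) = dr x s \<otimes>\<otimes> t \<oplus>\<oplus> s \<otimes>\<otimes> dr x t"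
      using absorb(5)[of x "Times s t"] by (simp add: der_rules)
    moreover have "s \<in> sat (pol (Suc m))" "t \<in> sat (pol (Suc m))"
      using pol_Times.hyps pol_mono[of m "Suc m"] by (auto intro: sat_base)
    ultimately show ?case using pol_Times.IH by (simp add: sat_pol_plus sat_pol_times)
  qed
qed

lemma der_sat_pol: "t \<in> sat (pol m) \<Longrightarrow> dr x t \<in> sat (pol (Suc m))"
proof -
  assume "t \<in> sat (pol m)"
  then obtain s where s: "s \<in> pol m" "nf t = nf s" by (auto simp: sat_def)
  then have "dr x t = dr x s" using absorb(5)[of x t] absorb(5)[of x s] by simp
  then show ?thesis using der_pol[OF s(1)] by simp
qed

lemma zt_commute:
  assumes "set_mset \<beta> \<subseteq> {..<h}" "l < q" "i < h"
  shows "\<exists>r\<in>sat (pol (Suc (size \<beta>))). dr (bas i) (zt \<beta> l) = zt (add_mset i \<beta>) l \<oplus>\<oplus> r"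
proof -
  let ?xs = "sorted_list_of_multiset \<beta>"
  have "\<exists>r\<in>sat (pol (Suc (length ?xs))). dr (bas i) (zl ?xs l) = zl (insort i ?xs) l \<oplus>\<oplus> r"
    using assms by (intro zl_commute der_pol) auto
  moreover have "length ?xs = size \<beta>" by (metis mset_sorted_list_of_multiset size_mset)
  moreover have "zl (insort i ?xs) l = zt (add_mset i \<beta>) l" by (simp add: zt_def zl_def)
  ultimately show ?thesis by (simp add: zl_def zt_def)
qed

lemma all_pol: "t \<in> sat (pol (weight p t))"
proof (induction t)
  case (Var j)
  show ?case
  proof (cases "j < p + q")
    case True
    show ?thesis
    proof (cases "j < p")
      case False
      then have "zt {#} (j - p) \<in> pol 1" using True by (intro pol_zt) auto
      then show ?thesis using False by (simp add: zt_def sat_base)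
    qed (simp add: pol_Var sat_base)
  next
    case False
    then have "nf (Var j) = nf (Const 0)" using cong_var cong_iff by simp
    then show ?thesis by (rule sat_nf) (simp add: sat_base pol_Const)
  qed
next
  case (Const c)
  then show ?case by (simp add: sat_base pol_Const)
next
  case (Plus s t)
  then have "s \<oplus>\<oplus> t \<in> sat (pol (weight p (Plus s t)))"
    by (intro sat_pol_plus) (auto elim: sat_pol_mono[rotated])
  then show ?case by (rule sat_nf[rotated]) simp
next
  case (Times s t)
  then have "s \<otimes>\<otimes> t \<in> sat (pol (weight p (Times s t)))"
    by (intro sat_pol_times) (auto elim: sat_pol_mono[rotated])
  then show ?case by (rule sat_nf[rotated]) simp
next
  case (Der x t)
  then have "dr x t \<in> sat (pol (weight p (Der x t)))" using der_sat_pol by simp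
  then show ?case by (rule sat_nf[rotated]) simp
qed

text \<open>The admissible right sides of a relation for \<open>zt \<beta> l\<close>: arbitrary
  polynomials of smaller order, but in the same order only combinations, with constant coefficients,
  of preceding derivatives. These are compared by the multiset order and then by the
  variable.\<close>

inductive_set low :: "nat multiset \<Rightarrow> nat \<Rightarrow> (nat, 'k, 'd) dterm set" for \<beta> l where
  low_pol: "t \<in> pol (size \<beta>) \<Longrightarrow> t \<in> low \<beta> l"
| low_zt: "\<lbrakk>set_mset \<beta>' \<subseteq> {..<h}; l' < q; size \<beta>' = size \<beta>; \<beta>' < \<beta> \<or> \<beta>' = \<beta> \<and> l' < l\<rbrakk> \<Longrightarrow>
    Times (Const c) (zt \<beta>' l') \<in> low \<beta> l"
| low_Plus: "\<lbrakk>s \<in> low \<beta> l; t \<in> low \<beta> l\<rbrakk> \<Longrightarrow> Plus s t \<in> low \<beta> l"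

definition dep :: "nat multiset \<Rightarrow> nat \<Rightarrow> bool" where
  "dep \<beta> l \<longleftrightarrow> (\<exists>t\<in>low \<beta> l. zt \<beta> l \<sim> t)"

lemma sat_low_plus: assumes "s \<in> sat (low \<beta> l)" "t \<in> sat (low \<beta> l)" shows "s \<oplus>\<oplus> t \<in> sat (low \<beta> l)"
proof -
  from assms obtain s' t' where "s' \<in> low \<beta> l" "t' \<in> low \<beta> l" "nf s = nf s'" "nf t = nf t'" by (auto simp: sat_def)
  then show ?thesis unfolding sat_def by (auto intro!: bexI[of _ "Plus s' t'"] low_Plus) (metis absorb(1,2))
qed

lemma sat_pol_low: "t \<in> sat (pol (size \<beta>)) \<Longrightarrow> t \<in> sat (low \<beta> l)"
  by (auto simp: sat_def intro: low_pol)

text \<open>Adding \<open>i\<close> preserves the multiset order strictly, so preceding derivatives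
  go to preceding ones. The corrections, from sorting in the derivation and from differentiating the
  constant \<open>c\<close>, have smaller order.\<close>

lemma low_der:
  assumes "i < h" "t \<in> low \<beta> l"
  shows "dr (bas i) t \<in> sat (low (add_mset i \<beta>) l)"
  using assms(2)
proof induction
  case (low_pol t)
  then show ?case using der_pol[of t "size \<beta>" "bas i"] by (intro sat_pol_low) simp
next
  case (low_zt \<beta>' l' c)
  obtain r where r: "r \<in> sat (pol (Suc (size \<beta>')))" "dr (bas i) (zt \<beta>' l') = zt (add_mset i \<beta>') l' \<oplus>\<oplus> r"
    using zt_commute[OF low_zt(1,2) assms(1)] by blast
  have eq: "dr (bas i) (Times (Const c) (zt \<beta>' l')) =
      cn c \<otimes>\<otimes> zt (add_mset i \<beta>') l' \<oplus>\<oplus> (cn (\<theta> (bas i) c) \<otimes>\<otimes> zt \<beta>' l' \<oplus>\<oplus> cn c \<otimes>\<otimes> r)"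
    using absorb(5)[of "bas i" "Times (Const c) (zt \<beta>' l')"] by (simp add: der_rules r(2) ring_ac)
  have "Times (Const c) (zt (add_mset i \<beta>') l') \<in> low (add_mset i \<beta>) l"
    using low_zt assms(1) by (intro low.low_zt) auto
  then have 1: "cn c \<otimes>\<otimes> zt (add_mset i \<beta>') l' \<in> sat (low (add_mset i \<beta>) l)"
    by (intro sat_nf[OF _ sat_base]) auto
  have "zt \<beta>' l' \<in> sat (pol (size (add_mset i \<beta>)))"
    using low_zt by (intro sat_base pol_zt) auto
  moreover have "r \<in> sat (pol (size (add_mset i \<beta>)))" using r(1) low_zt(3) by simp
  ultimately have "cn (\<theta> (bas i) c) \<otimes>\<otimes> zt \<beta>' l' \<oplus>\<oplus> cn c \<otimes>\<otimes> r \<in> sat (pol (size (add_mset i \<beta>)))"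
    by (intro sat_pol_plus sat_pol_times sat_pol_cn)
  then show ?case unfolding eq by (intro sat_low_plus 1 sat_pol_low)
next
  case (low_Plus s t)
  have "dr (bas i) (Plus s t) = dr (bas i) s \<oplus>\<oplus> dr (bas i) t"
    using absorb(5)[of "bas i" "Plus s t"] by (simp add: der_rules)
  then show ?case using low_Plus.IH by (simp add: sat_low_plus)
qed

text \<open>A relation with leading coefficient 1 is differentiated into another one, up to terms of
  smaller order. Therefore relations for the minimal dependent derivatives suffice.\<close>

lemma dep_add:
  assumes "dep \<beta> l" "set_mset \<beta> \<subseteq> {..<h}" "l < q" "i < h"
  shows "dep (add_mset i \<beta>) l"
proof -
  obtain t where t: "t \<in> low \<beta> l" "zt \<beta> l \<sim> t" using assms(1) by (auto simp: dep_def)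
  obtain r where r: "r \<in> sat (pol (Suc (size \<beta>)))" "dr (bas i) (zt \<beta> l) = zt (add_mset i \<beta>) l \<oplus>\<oplus> r"
    using zt_commute[OF assms(2,3,4)] by blast
  have "dr (bas i) t = zt (add_mset i \<beta>) l \<oplus>\<oplus> r"
    using t(2) absorb(5)[of "bas i" t] absorb(5)[of "bas i" "zt \<beta> l"] r(2) by (simp add: cong_iff)
  then have "dr (bas i) t \<oplus>\<oplus> cn (- 1) \<otimes>\<otimes> r = zt (add_mset i \<beta>) l \<oplus>\<oplus> (cn (- 1) \<otimes>\<otimes> r \<oplus>\<oplus> r)"
    by (simp add: ring_ac)
  then have "nf (zt (add_mset i \<beta>) l) = dr (bas i) t \<oplus>\<oplus> cn (- 1) \<otimes>\<otimes> r"
    by (simp only: const_rules)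
  moreover have "dr (bas i) t \<oplus>\<oplus> cn (- 1) \<otimes>\<otimes> r \<in> sat (low (add_mset i \<beta>) l)"
    using sat_pol_times[OF sat_pol_cn, of r "size (add_mset i \<beta>)"] r(1)
    by (intro sat_low_plus[OF low_der[OF assms(4) t(1)]] sat_pol_low) auto
  ultimately have "zt (add_mset i \<beta>) l \<in> sat (low (add_mset i \<beta>) l)"
    by (metis sat_nf_iff)
  then show ?thesis by (auto simp: dep_def sat_def cong_iff)
qed

end

section \<open>Normal forms\<close>

definition prodt :: "('v, 'k::field, 'd) dterm list \<Rightarrow> ('v, 'k, 'd) dterm" where
  "prodt ts = foldr Times ts (Const 1)"

definition sumt :: "('v, 'k::field, 'd) dterm list \<Rightarrow> ('v, 'k, 'd) dterm" where
  "sumt ts = foldr Plus ts (Const 0)"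

definition mt :: "('i \<Rightarrow> ('v, 'k::field, 'd) dterm) \<Rightarrow> 'i multiset \<Rightarrow> ('v, 'k, 'd) dterm" where
  "mt f M = prodt (map f (list_of M))"

text \<open>A linear combination is a list in which a key may be repeated: sums are then
  concatenations, and coefficients are collected only at the end, by \<open>csum\<close>.\<close>

definition lc :: "('i \<Rightarrow> ('v, 'k::field, 'd) dterm) \<Rightarrow> ('k \<times> 'i) list \<Rightarrow> ('v, 'k, 'd) dterm" where
  "lc f L = sumt (map (\<lambda>(c, k). Times (Const c) (f k)) L)"

definition csum :: "'i \<Rightarrow> ('k::comm_monoid_add \<times> 'i) list \<Rightarrow> 'k" where
  "csum k L = (\<Sum>(c, k')\<leftarrow>L. if k' = k then c else 0)"

abbreviation "xmon \<equiv> mt Var"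

context der_term_cong
begin

abbreviation "zmon \<equiv> mt (\<lambda>(\<beta>, l). zt \<beta> l)"

lemma nf_prodt_Cons: "nf (prodt (t # ts)) = t \<otimes>\<otimes> prodt ts"
  by (simp add: prodt_def)

lemma nf_prodt_split: "nf (prodt (us @ t # vs)) = t \<otimes>\<otimes> prodt (us @ vs)"
proof (induction us)
  case (Cons u us)
  have "nf (prodt ((u # us) @ t # vs)) = u \<otimes>\<otimes> nf (prodt (us @ t # vs))"
    by (simp add: nf_prodt_Cons)
  also have "\<dots> = t \<otimes>\<otimes> (u \<otimes>\<otimes> prodt (us @ vs))" unfolding Cons by (rule ring_lcomm)
  also have "\<dots> = t \<otimes>\<otimes> prodt ((u # us) @ vs)" using nf_prodt_Cons[of u "us @ vs"] by (metis absorb(4) append_Cons)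
  finally show ?case .
qed (simp add: nf_prodt_Cons)

lemma prodt_perm: "mset us = mset vs \<Longrightarrow> nf (prodt us) = nf (prodt vs)"
proof (induction us arbitrary: vs)
  case (Cons u us)
  have "u \<in> set vs" using Cons.prems by (metis list.set_intros(1) set_mset_mset)
  then obtain v1 v2 where v: "vs = v1 @ u # v2" by (meson split_list)
  have "nf (prodt us) = nf (prodt (v1 @ v2))" using Cons.prems v by (intro Cons.IH) simp
  then have "u \<otimes>\<otimes> prodt us = u \<otimes>\<otimes> prodt (v1 @ v2)" by (metis absorb(4))
  then show ?case unfolding v nf_prodt_split nf_prodt_Cons .
qed simp

lemma mt_empty [simp]: "nf (mt f {#}) = cn 1"
  by (simp add: mt_def prodt_def)

lemma mt_add [simp]: "nf (mt f (add_mset i M)) = f i \<otimes>\<otimes> mt f M"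
proof -
  have "nf (mt f (add_mset i M)) = nf (prodt (f i # map f (list_of M)))"
    unfolding mt_def by (rule prodt_perm) simp
  then show ?thesis by (simp add: nf_prodt_Cons mt_def)
qed

lemma mt_add_times: "mt f (add_mset i M) \<otimes>\<otimes> t = f i \<otimes>\<otimes> (mt f M \<otimes>\<otimes> t)"
  using absorb(3)[of "mt f (add_mset i M)" t] by (simp add: ring_rules(3))

lemma mt_union: "mt f (M + N) \<otimes>\<otimes> t = mt f M \<otimes>\<otimes> (mt f N \<otimes>\<otimes> t)"
proof (induction M)
  case empty
  show ?case using absorb(3)[of "mt f {#}" "mt f N \<otimes>\<otimes> t"] by (simp add: const_rules)
next
  case (add i M)
  then show ?case by (simp add: mt_add_times)
qed

lemma Const_times: "Const c \<otimes>\<otimes> t = cn c \<otimes>\<otimes> t" "t \<otimes>\<otimes> Const c = t \<otimes>\<otimes> cn c"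
  "Const c \<oplus>\<oplus> t = cn c \<oplus>\<oplus> t" "t \<oplus>\<oplus> Const c = t \<oplus>\<oplus> cn c"
  using absorb(3)[of "Const c" t] absorb(4)[of t "Const c"] absorb(1)[of "Const c" t] absorb(2)[of t "Const c"]
  by simp_all

lemma cong_sub: "s \<otimes>\<otimes> t = s' \<otimes>\<otimes> t" "t \<otimes>\<otimes> s = t \<otimes>\<otimes> s'" "s \<oplus>\<oplus> t = s' \<oplus>\<oplus> t" "t \<oplus>\<oplus> s = t \<oplus>\<oplus> s'"
  if "nf s = nf s'"
  using that by (metis absorb(3), metis absorb(4), metis absorb(1), metis absorb(2))

text \<open>The analogue of \<open>low\<close> in order 0, for monomials instead of derivatives. A
  monomial with \<open>depx\<close> is the leading monomial of a polynomial relation, so the others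
  are the standard monomials of Groebner basis theory.\<close>

inductive_set lowx :: "nat multiset \<Rightarrow> (nat, 'k, 'd) dterm set" for \<mu> where
  lowx_0: "Const 0 \<in> lowx \<mu>"
| lowx_mon: "\<lbrakk>set_mset \<nu> \<subseteq> {..<p}; \<nu> < \<mu>\<rbrakk> \<Longrightarrow> Times (Const c) (xmon \<nu>) \<in> lowx \<mu>"
| lowx_Plus: "\<lbrakk>s \<in> lowx \<mu>; t \<in> lowx \<mu>\<rbrakk> \<Longrightarrow> Plus s t \<in> lowx \<mu>"

definition depx :: "nat multiset \<Rightarrow> bool" where
  "depx \<mu> \<longleftrightarrow> (\<exists>t\<in>lowx \<mu>. xmon \<mu> \<sim> t)"

lemma lowx_times:
  assumes "t \<in> lowx \<mu>" "j < p"
  shows "\<exists>t'\<in>lowx (add_mset j \<mu>). Var j \<otimes>\<otimes> t = nf t'"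
  using assms(1)
proof induction
  case lowx_0
  show ?case
    by (rule bexI[OF _ lowx.lowx_0]) (simp add: Const_times times_0 ring_rules(4)[of "Var j"])
next
  case (lowx_mon \<nu> c)
  have "Var j \<otimes>\<otimes> Times (Const c) (xmon \<nu>) = nf (Times (Const c) (xmon (add_mset j \<nu>)))"
    using absorb(4)[of "Var j" "Times (Const c) (xmon \<nu>)"] by (simp add: ring_lcomm(2)[of "Var j"])
  moreover have "Times (Const c) (xmon (add_mset j \<nu>)) \<in> lowx (add_mset j \<mu>)"
    using lowx_mon assms(2) by (intro lowx.lowx_mon) auto
  ultimately show ?case by blast
next
  case (lowx_Plus s t)
  then obtain s' t' where st: "s' \<in> lowx (add_mset j \<mu>)" "Var j \<otimes>\<otimes> s = nf s'"
    "t' \<in> lowx (add_mset j \<mu>)" "Var j \<otimes>\<otimes> t = nf t'" by blast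
  have "Var j \<otimes>\<otimes> Plus s t = nf (Plus s' t')"
    using absorb(4)[of "Var j" "Plus s t"] st(2,4) by (simp add: ring_distrib)
  then show ?case using lowx.lowx_Plus[OF st(1,3)] by blast
qed

text \<open>A relation is multiplied by a variable, which respects the multiset order.\<close>

lemma depx_add:
  assumes "depx \<mu>" "j < p"
  shows "depx (add_mset j \<mu>)"
proof -
  obtain t where t: "t \<in> lowx \<mu>" "xmon \<mu> \<sim> t" using assms(1) by (auto simp: depx_def)
  obtain t' where t': "t' \<in> lowx (add_mset j \<mu>)" "Var j \<otimes>\<otimes> t = nf t'" using lowx_times[OF t(1) assms(2)] by blast
  have "nf (xmon (add_mset j \<mu>)) = nf t'"
    using t(2) t'(2) cong_sub(2)[of "xmon \<mu>" t "Var j"] by (simp add: cong_iff)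
  then show ?thesis using t'(1) by (auto simp: depx_def cong_iff)
qed

lemma nf_sumt_Cons: "nf (sumt (t # ts)) = t \<oplus>\<oplus> sumt ts"
  by (simp add: sumt_def)

lemma nf_sumt_append: "nf (sumt (ts @ us)) = sumt ts \<oplus>\<oplus> sumt us"
proof (induction ts)
  case Nil
  show ?case by (simp add: sumt_def const_rules Const_times)
next
  case (Cons t ts)
  have "nf (sumt ((t # ts) @ us)) = t \<oplus>\<oplus> nf (sumt (ts @ us))"
    by (simp add: nf_sumt_Cons)
  also have "\<dots> = nf (sumt (t # ts)) \<oplus>\<oplus> sumt us" unfolding Cons nf_sumt_Cons by (simp only: ring_rules(1))
  finally show ?case by simp
qed

lemma nf_lc_Cons: "nf (lc f ((c, k) # L)) = cn c \<otimes>\<otimes> f k \<oplus>\<oplus> lc f L"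
proof -
  have "nf (lc f ((c, k) # L)) = nf (Times (Const c) (f k)) \<oplus>\<oplus> lc f L"
    unfolding lc_def by (simp only: list.map prod.case nf_sumt_Cons absorb(1))
  then show ?thesis by simp
qed

lemma lc_collect: "nf (lc f L) = cn (csum k L) \<otimes>\<otimes> f k \<oplus>\<oplus> lc f (filter (\<lambda>(c, k'). k' \<noteq> k) L)"
proof (induction L)
  case Nil
  show ?case by (simp add: lc_def sumt_def csum_def times_0 const_rules Const_times)
next
  case (Cons a L)
  obtain c k' where a: "a = (c, k')" by (cases a)
  have IH: "cn c \<otimes>\<otimes> f k' \<oplus>\<oplus> lc f L =
      cn c \<otimes>\<otimes> f k' \<oplus>\<oplus> (cn (csum k L) \<otimes>\<otimes> f k \<oplus>\<oplus> lc f (filter (\<lambda>(c, k'). k' \<noteq> k) L))"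
    by (rule HOL.trans[OF cong_sub(4)[of _ "cn (csum k L) \<otimes>\<otimes> f k \<oplus>\<oplus> lc f (filter (\<lambda>(c, k'). k' \<noteq> k) L)"]])
      (simp_all add: Cons)
  show ?case
  proof (cases "k' = k")
    case True
    have "cn c \<otimes>\<otimes> f k \<oplus>\<oplus> cn (csum k L) \<otimes>\<otimes> f k = cn (c + csum k L) \<otimes>\<otimes> f k"
      by (simp only: ring_rules(5)[symmetric] const_rules)
    then show ?thesis
      using IH True unfolding a nf_lc_Cons by (simp add: csum_def ring_rules(1)[symmetric])
  next
    case False
    have eq: "nf (lc f (filter (\<lambda>(c, k'). k' \<noteq> k) (a # L))) =
        cn c \<otimes>\<otimes> f k' \<oplus>\<oplus> lc f (filter (\<lambda>(c, k'). k' \<noteq> k) L)"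
      using False by (simp add: a nf_lc_Cons)
    have "cn (csum k (a # L)) \<otimes>\<otimes> f k \<oplus>\<oplus> lc f (filter (\<lambda>(c, k'). k' \<noteq> k) (a # L)) =
        cn (csum k L) \<otimes>\<otimes> f k \<oplus>\<oplus> (cn c \<otimes>\<otimes> f k' \<oplus>\<oplus> lc f (filter (\<lambda>(c, k'). k' \<noteq> k) L))"
      using False absorb(2)[of "cn (csum k L) \<otimes>\<otimes> f k" "lc f (filter (\<lambda>(c, k'). k' \<noteq> k) (a # L))"]
      unfolding eq by (simp add: a csum_def)
    then show ?thesis using IH unfolding a nf_lc_Cons by (simp add: ring_lcomm(1))
  qed
qed

text \<open>All entries of one key are removed at a time: together they contribute their total
  coefficient, which is zero, and the totals of the other keys do not change.\<close>

lemma lc_collapse: "(\<And>k. csum k L = 0) \<Longrightarrow> nf (lc f L) = cn 0"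
proof (induction "length L" arbitrary: L rule: less_induct)
  case less
  show ?case
  proof (cases L)
    case Nil
    then show ?thesis by (simp add: lc_def sumt_def)
  next
    case (Cons a L')
    obtain c k where a: "a = (c, k)" by (cases a)
    let ?F = "filter (\<lambda>(c, k'). k' \<noteq> k) L"
    have "csum k' ?F = (if k' = k then 0 else csum k' L)" for k'
      unfolding csum_def by (induction L) auto
    then have c: "csum k' ?F = 0" for k' using less.prems by simp
    have "length ?F < length L"
      using length_filter_le[of _ L'] by (simp add: Cons a le_imp_less_Suc)
    then have "nf (lc f ?F) = cn 0" using c by (rule less.hyps)
    then show ?thesis
      unfolding lc_collect[of f L k] less.prems times_0 by (simp add: const_rules)
  qed
qed

end

text \<open>Reducibility outside \<open>N\<close> and \<open>I\<close> is asked of the present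
  congruence. In the application the two sets come from another congruence, equality of values in
  the Hopf algebra, and it is there that their monomials are independent.\<close>

locale normal_form = der_term_cong scD br \<theta> cong p q bas h
  for scD :: "'k::field \<Rightarrow> 'd::ab_group_add \<Rightarrow> 'd" and br \<theta>
    and cong :: "(nat, 'k, 'd) dterm \<Rightarrow> (nat, 'k, 'd) dterm \<Rightarrow> bool" (infix \<open>\<sim>\<close> 50)
    and p q bas h +
  fixes N :: "nat multiset set" and I :: "(nat multiset \<times> nat) set"
  assumes depx: "\<lbrakk>set_mset \<mu> \<subseteq> {..<p}; \<mu> \<notin> N\<rbrakk> \<Longrightarrow> depx \<mu>"
    and dep: "\<lbrakk>set_mset \<beta> \<subseteq> {..<h}; l < q; (\<beta>, l) \<notin> I\<rbrakk> \<Longrightarrow> dep \<beta> l"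
begin

definition mon :: "nat multiset \<times> (nat multiset \<times> nat) multiset \<Rightarrow> (nat, 'k, 'd) dterm" where
  "mon = (\<lambda>(\<mu>, P). Times (xmon \<mu>) (zmon P))"

definition keys :: "(nat multiset \<times> (nat multiset \<times> nat) multiset) set" where
  "keys = {(\<mu>, P). \<mu> \<in> N \<and> set_mset \<mu> \<subseteq> {..<p} \<and> set_mset P \<subseteq> I}"

definition NF :: "(nat, 'k, 'd) dterm set" where
  "NF = {t. \<exists>L. snd ` set L \<subseteq> keys \<and> nf t = nf (lc mon L)}"

lemma NF_nf: "nf s = nf t \<Longrightarrow> t \<in> NF \<Longrightarrow> s \<in> NF" by (auto simp: NF_def)

lemma NF_plus: assumes "s \<in> NF" "t \<in> NF" shows "s \<oplus>\<oplus> t \<in> NF"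
proof -
  from assms obtain L M where "snd ` set L \<subseteq> keys" "nf s = nf (lc mon L)" "snd ` set M \<subseteq> keys" "nf t = nf (lc mon M)"
    by (auto simp: NF_def)
  moreover have "s \<oplus>\<oplus> t = nf (lc mon (L @ M))"
    using calculation absorb(1,2) nf_sumt_append by (metis lc_def map_append)
  ultimately have "snd ` set (L @ M) \<subseteq> keys \<and> nf (s \<oplus>\<oplus> t) = nf (lc mon (L @ M))"
    by (simp add: image_Un)
  then show ?thesis unfolding NF_def by blast
qed

lemma NF_0: "cn 0 \<in> NF"
  unfolding NF_def by (auto intro!: exI[of _ "[]"] simp: lc_def sumt_def)

text \<open>Well-founded induction on \<open>\<mu>\<close> in the multiset order: a monomial outside
  \<open>N\<close> is replaced by smaller ones, while \<open>zmon P\<close> stays untouched.\<close>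

lemma NF_mon:
  assumes "set_mset \<mu> \<subseteq> {..<p}" "set_mset P \<subseteq> I"
  shows "cn c \<otimes>\<otimes> (xmon \<mu> \<otimes>\<otimes> zmon P) \<in> NF"
  using assms(1)
proof (induction \<mu> arbitrary: c rule: less_induct)
  case (less \<mu>)
  show ?case
  proof (cases "\<mu> \<in> N")
    case True
    have "nf (lc mon [(c, (\<mu>, P))]) = cn c \<otimes>\<otimes> nf (mon (\<mu>, P))"
      unfolding nf_lc_Cons by (simp add: lc_def sumt_def Const_times const_rules)
    then have "nf (cn c \<otimes>\<otimes> (xmon \<mu> \<otimes>\<otimes> zmon P)) = nf (lc mon [(c, (\<mu>, P))])"
      by (simp only: mon_def prod.case nf_push absorb)
    moreover have "snd ` set [(c, (\<mu>, P))] \<subseteq> keys" using True less.prems assms(2) by (simp add: keys_def)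
    ultimately show ?thesis unfolding NF_def by blast
  next
    case False
    then obtain t where t: "t \<in> lowx \<mu>" "nf (xmon \<mu>) = nf t"
      using depx[OF less.prems] by (auto simp: depx_def cong_iff)
    have "cn c \<otimes>\<otimes> (t \<otimes>\<otimes> zmon P) \<in> NF" using t(1)
    proof induction
      case lowx_0
      show ?case by (simp add: Const_times times_0 ring_rules(4)[of "cn c" "cn 0"] NF_0)
    next
      case (lowx_mon \<nu> c')
      have "cn c \<otimes>\<otimes> (Times (Const c') (xmon \<nu>) \<otimes>\<otimes> zmon P) = cn (c * c') \<otimes>\<otimes> (xmon \<nu> \<otimes>\<otimes> zmon P)"
        using absorb(3)[of "Times (Const c') (xmon \<nu>)" "zmon P", symmetric]
        by (simp add: ring_rules(3) const_lmult)
      then show ?case using less.IH lowx_mon by simp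
    next
      case (lowx_Plus s t)
      have "cn c \<otimes>\<otimes> (Plus s t \<otimes>\<otimes> zmon P) = cn c \<otimes>\<otimes> (s \<otimes>\<otimes> zmon P) \<oplus>\<oplus> cn c \<otimes>\<otimes> (t \<otimes>\<otimes> zmon P)"
        using absorb(3)[of "Plus s t" "zmon P", symmetric] by (simp add: ring_rules(5) ring_distrib)
      then show ?case using lowx_Plus.IH by (simp add: NF_plus)
    qed
    then show ?thesis using cong_sub(1)[OF t(2), of "zmon P"] by simp
  qed
qed

text \<open>Every multiset over \<open>I\<close> is admissible in a key, so the product of the
  \<open>zmon\<close> parts is already normal and only the product of the \<open>xmon\<close> parts
  is reduced again.\<close>

lemma NF_times_mon:
  assumes "s \<in> NF" "k \<in> keys"
  shows "cn c \<otimes>\<otimes> mon k \<otimes>\<otimes> s \<in> NF"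
proof -
  obtain L where L: "snd ` set L \<subseteq> keys" "nf s = nf (lc mon L)" using assms(1) by (auto simp: NF_def)
  obtain \<mu> P where k: "k = (\<mu>, P)" by (cases k)
  have mon: "nf (mon (\<mu>, P)) = xmon \<mu> \<otimes>\<otimes> zmon P" for \<mu> P by (simp add: mon_def)
  have "cn c \<otimes>\<otimes> mon k \<otimes>\<otimes> lc mon L \<in> NF" using L(1)
  proof (induction L)
    case Nil
    show ?case
      by (simp add: lc_def sumt_def Const_times times_0 ring_rules(4)[of _ "cn 0"] NF_0)
  next
    case (Cons a L)
    obtain c' \<nu> Q where a: "a = (c', (\<nu>, Q))" by (cases a) auto
    let ?k = "cn c \<otimes>\<otimes> mon k"
    have "?k \<otimes>\<otimes> lc mon (a # L) = ?k \<otimes>\<otimes> nf (lc mon (a # L))" by simp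
    also have "\<dots> = ?k \<otimes>\<otimes> (cn c' \<otimes>\<otimes> mon (\<nu>, Q)) \<oplus>\<oplus> ?k \<otimes>\<otimes> lc mon L"
      unfolding a nf_lc_Cons by (rule ring_distrib)
    also have "?k \<otimes>\<otimes> (cn c' \<otimes>\<otimes> mon (\<nu>, Q)) = cn (c * c') \<otimes>\<otimes> (nf (mon k) \<otimes>\<otimes> nf (mon (\<nu>, Q)))"
      by (simp add: ring_rules(3) ring_lcomm(2)[of "mon k" "cn c'"] const_lmult)
    also have "nf (mon k) \<otimes>\<otimes> nf (mon (\<nu>, Q)) = xmon (\<mu> + \<nu>) \<otimes>\<otimes> zmon (P + Q)"
    proof -
      have 1: "xmon (\<mu> + \<nu>) \<otimes>\<otimes> zmon (P + Q) = xmon \<mu> \<otimes>\<otimes> (xmon \<nu> \<otimes>\<otimes> zmon (P + Q))" by (rule mt_union)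
      have "zmon (P + Q) \<otimes>\<otimes> xmon \<nu> = zmon P \<otimes>\<otimes> (zmon Q \<otimes>\<otimes> xmon \<nu>)" by (rule mt_union)
      then have 2: "xmon \<nu> \<otimes>\<otimes> zmon (P + Q) = zmon P \<otimes>\<otimes> (xmon \<nu> \<otimes>\<otimes> zmon Q)"
        by (simp only: ring_rules(4))
      show ?thesis unfolding k mon 1 2 by (simp only: ring_rules(3))
    qed
    finally have eq: "?k \<otimes>\<otimes> lc mon (a # L) = cn (c * c') \<otimes>\<otimes> (xmon (\<mu> + \<nu>) \<otimes>\<otimes> zmon (P + Q)) \<oplus>\<oplus> ?k \<otimes>\<otimes> lc mon L" .
    have "(\<nu>, Q) \<in> keys" "(\<mu>, P) \<in> keys" using Cons.prems assms(2) by (auto simp: a k)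
    then have "cn (c * c') \<otimes>\<otimes> (xmon (\<mu> + \<nu>) \<otimes>\<otimes> zmon (P + Q)) \<in> NF"
      by (intro NF_mon) (auto simp: keys_def)
    then show ?case unfolding eq using Cons by (intro NF_plus) auto
  qed
  then show ?thesis using cong_sub(2)[OF L(2)] by simp
qed

lemma NF_times: assumes "s \<in> NF" "t \<in> NF" shows "s \<otimes>\<otimes> t \<in> NF"
proof -
  obtain L where L: "snd ` set L \<subseteq> keys" "nf s = nf (lc mon L)" using assms(1) by (auto simp: NF_def)
  have "lc mon L \<otimes>\<otimes> t \<in> NF" using L(1)
  proof (induction L)
    case Nil
    show ?case by (simp add: lc_def sumt_def Const_times times_0 NF_0)
  next
    case (Cons a L)
    obtain c k where a: "a = (c, k)" by (cases a)
    have "lc mon (a # L) \<otimes>\<otimes> t = nf (lc mon (a # L)) \<otimes>\<otimes> t" by simp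
    also have "\<dots> = cn c \<otimes>\<otimes> mon k \<otimes>\<otimes> t \<oplus>\<oplus> lc mon L \<otimes>\<otimes> t"
      unfolding a nf_lc_Cons by (rule ring_rules(5))
    finally show ?case
      using Cons NF_times_mon[OF assms(2), of k c] by (simp add: a NF_plus)
  qed
  then show ?thesis using cong_sub(1)[OF L(2)] by simp
qed

lemma NF_cn: "cn c \<in> NF"
proof -
  have "cn c \<otimes>\<otimes> (xmon {#} \<otimes>\<otimes> zmon {#}) = cn c"
    using absorb(3)[of "xmon {#}" "zmon {#}", symmetric] by (simp add: const_rules)
  then show ?thesis using NF_mon[of "{#}" "{#}" c] by simp
qed

lemma NF_var: assumes "j < p" shows "Var j \<in> NF"
proof -
  have "cn 1 \<otimes>\<otimes> (xmon {#j#} \<otimes>\<otimes> zmon {#}) = nf (Var j)"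
    using absorb(4)[of "xmon {#j#}" "zmon {#}"] absorb(4)[of "Var j" "xmon {#}"] by (simp add: const_rules)
  then show ?thesis
    using NF_mon[of "{#j#}" "{#}" 1] assms NF_nf[of "Var j" "nf (Var j)"] by simp
qed

lemma NF_zt_indep: assumes "(\<beta>, l) \<in> I" shows "zt \<beta> l \<in> NF"
proof -
  have "cn 1 \<otimes>\<otimes> (xmon {#} \<otimes>\<otimes> zmon {#(\<beta>, l)#}) = nf (zt \<beta> l)"
    using absorb(3)[of "xmon {#}" "zmon {#(\<beta>, l)#}"] absorb(4)[of "zt \<beta> l" "zmon {#}"] by (simp add: const_rules)
  then show ?thesis
    using NF_mon[of "{#}" "{#(\<beta>, l)#}" 1] assms NF_nf[of "zt \<beta> l" "nf (zt \<beta> l)"] by simp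
qed

lemma NF_pol:
  assumes "\<And>\<beta> l. set_mset \<beta> \<subseteq> {..<h} \<Longrightarrow> l < q \<Longrightarrow> size \<beta> < m \<Longrightarrow> zt \<beta> l \<in> NF" "t \<in> pol m"
  shows "t \<in> NF"
  using assms(2)
proof induction
  case (pol_Const c)
  then show ?case using NF_nf[of "Const c" "cn c"] NF_cn by simp
next
  case (pol_Plus s t)
  then show ?case using NF_nf[of "Plus s t" "s \<oplus>\<oplus> t"] NF_plus by simp
next
  case (pol_Times s t)
  then show ?case using NF_nf[of "Times s t" "s \<otimes>\<otimes> t"] NF_times by simp
qed (use assms NF_var in auto)

text \<open>Three nested inductions follow the order in \<open>low\<close>: on the size of
  \<open>\<beta>\<close>, on \<open>\<beta>\<close> in the multiset order, and on
  \<open>l\<close>.\<close>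

lemma NF_zt: "set_mset \<beta> \<subseteq> {..<h} \<Longrightarrow> l < q \<Longrightarrow> zt \<beta> l \<in> NF"
proof (induction "size \<beta>" arbitrary: \<beta> l rule: less_induct)
  case less
  define n where "n = size \<beta>"
  have small: "zt \<beta>' l' \<in> NF" if "set_mset \<beta>' \<subseteq> {..<h}" "l' < q" "size \<beta>' < n" for \<beta>' l'
    using less.hyps that by (simp add: n_def)
  have "zt \<beta> l \<in> NF" if "set_mset \<beta> \<subseteq> {..<h}" "l < q" "size \<beta> = n" for \<beta> l
    using that
  proof (induction \<beta> arbitrary: l rule: less_induct)
    case (less \<beta>)
    note IH1 = less.IH
    from less.prems show ?case
    proof (induction l rule: less_induct)
      case (less l)
      show ?case
      proof (cases "(\<beta>, l) \<in> I")
        case True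
        then show ?thesis by (rule NF_zt_indep)
      next
        case False
        then obtain t where t: "t \<in> low \<beta> l" "nf (zt \<beta> l) = nf t"
          using dep[OF less.prems(1,2)] by (auto simp: dep_def cong_iff)
        have "t \<in> NF" using t(1)
        proof induction
          case (low_pol t)
          then show ?case using NF_pol[of n t] small less.prems(3) by simp
        next
          case (low_zt \<beta>' l' c)
          have "zt \<beta>' l' \<in> NF" using low_zt IH1[of \<beta>' l'] less.IH[of l'] less.prems by auto
          then have "cn c \<otimes>\<otimes> zt \<beta>' l' \<in> NF" by (intro NF_times NF_cn)
          then show ?case by (rule NF_nf[rotated]) simp
        next
          case (low_Plus s t)
          then show ?case using NF_nf[of "Plus s t" "s \<oplus>\<oplus> t"] NF_plus by simp
        qed
        then show ?thesis by (rule NF_nf[OF t(2)])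
      qed
    qed
  qed
  then show ?case using less.prems n_def by simp
qed

lemma normal_form:
  obtains L where "snd ` set L \<subseteq> keys" "t \<sim> lc mon L"
proof -
  obtain s where s: "s \<in> pol (weight p t)" "nf t = nf s" using all_pol[of t] by (auto simp: sat_def)
  have "s \<in> NF" by (rule NF_pol[OF _ s(1)]) (rule NF_zt)
  then have "t \<in> NF" by (rule NF_nf[OF s(2)])
  then show thesis using that by (auto simp: NF_def cong_iff)
qed

end

section \<open>Independence of the normal monomials\<close>

context hopf
begin

lemma in_tensor_mono: "in_tensor P Q a \<Longrightarrow> P \<subseteq> P' \<Longrightarrow> Q \<subseteq> Q' \<Longrightarrow> in_tensor P' Q' a"
  unfolding in_tensor_def by blast

lemma repr_add: assumes "repr a u" "repr b v" shows "repr (a + b) (u @ v)"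
  unfolding repr_def using cop_add repr_D[OF assms(1)] repr_D[OF assms(2)] by simp

lemma repr_mult: assumes "repr a u" "repr b v"
  shows "repr (a * b) (concat (map (\<lambda>p. map (\<lambda>q. (fst p * fst q, snd p * snd q)) v) u))"
  unfolding repr_def using cop_mult_repr[OF assms]
  by (simp add: ev_concat ev_map) (simp add: ev_def comp_def ev_map)

lemma repr_const: "repr (sc c 1) [(sc c 1, 1)]"
  unfolding repr_def
proof (intro allI impI)
  fix f assume f: "balanced f"
  have "balanced (\<lambda>x y. f (sc c x) y)"
    using f by (auto simp: balanced_def scale_right_distrib) (metis mult.commute scale_scale)
  then show "ev f (cop (sc c 1)) = ev f [(sc c 1, 1)]"
    using cop_scale[OF f, of c 1] cop_one by simp
qed

lemma in_tensor_add:
  assumes "in_tensor P Q a" "in_tensor P Q b" shows "in_tensor P Q (a + b)"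
proof -
  obtain u v where "set u \<subseteq> P \<times> Q" "repr a u" "set v \<subseteq> P \<times> Q" "repr b v"
    using assms unfolding in_tensor_def by blast
  then have "set (u @ v) \<subseteq> P \<times> Q" "repr (a + b) (u @ v)" by (auto intro: repr_add)
  then show ?thesis unfolding in_tensor_def by blast
qed

lemma in_tensor_mult:
  assumes "in_tensor P Q a" "in_tensor P Q b" "\<And>x y. x \<in> P \<Longrightarrow> y \<in> P \<Longrightarrow> x * y \<in> P" "\<And>x y. x \<in> Q \<Longrightarrow> y \<in> Q \<Longrightarrow> x * y \<in> Q"
  shows "in_tensor P Q (a * b)"
proof -
  obtain u v where u: "set u \<subseteq> P \<times> Q" "repr a u" and v: "set v \<subseteq> P \<times> Q" "repr b v"
    using assms unfolding in_tensor_def by blast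
  have "set (concat (map (\<lambda>p. map (\<lambda>q. (fst p * fst q, snd p * snd q)) v) u)) \<subseteq> P \<times> Q"
    using u(1) v(1) assms(3,4) by fastforce
  then show ?thesis unfolding in_tensor_def using repr_mult[OF u(2) v(2)] by blast
qed

end

context dhopf
begin

lemma repr_derivative: assumes "repr a u"
  shows "repr (D x a) (map (\<lambda>p. (D x (fst p), snd p)) u @ map (\<lambda>p. (fst p, D x (snd p))) u)"
  unfolding repr_def using cop_D_repr[OF _ assms]
  by (simp add: ev_add_fun) (simp add: ev_def comp_def)

lemma in_tensor_D:
  assumes "in_tensor P Q a" "P \<subseteq> P'" "Q \<subseteq> Q'" "\<And>y. y \<in> P \<Longrightarrow> D x y \<in> P'" "\<And>y. y \<in> Q \<Longrightarrow> D x y \<in> Q'"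
  shows "in_tensor P' Q' (D x a)"
proof -
  obtain u where u: "set u \<subseteq> P \<times> Q" "repr a u"
    using assms unfolding in_tensor_def by blast
  have "set (map (\<lambda>p. (D x (fst p), snd p)) u @ map (\<lambda>p. (fst p, D x (snd p))) u) \<subseteq> P' \<times> Q'"
  proof
    fix r assume "r \<in> set (map (\<lambda>p. (D x (fst p), snd p)) u @ map (\<lambda>p. (fst p, D x (snd p))) u)"
    then obtain w where w: "w \<in> set u" "r = (D x (fst w), snd w) \<or> r = (fst w, D x (snd w))" by auto
    have "fst w \<in> P" "snd w \<in> Q" using w(1) u(1) by (auto simp: mem_Times_iff)
    then have "fst w \<in> P'" "D x (fst w) \<in> P'" "snd w \<in> Q'" "D x (snd w) \<in> Q'"
      using assms(2,3) by (auto intro: assms(4,5))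
    then show "r \<in> P' \<times> Q'" using w(2) by auto
  qed
  then show ?thesis unfolding in_tensor_def using repr_derivative[OF u(2)] by blast
qed

lemma D_const: "D x (sc c 1) = sc (\<theta> x c) 1"
  by (simp add: D_scale D_one)

end

primrec val :: "('k \<Rightarrow> 'b::comm_ring_1 \<Rightarrow> 'b) \<Rightarrow> ('d \<Rightarrow> 'b \<Rightarrow> 'b) \<Rightarrow> (nat \<Rightarrow> 'b) \<Rightarrow> (nat, 'k, 'd) dterm \<Rightarrow> 'b" where
  "val sc D gen (Var j) = gen j"
| "val sc D gen (Const c) = sc c 1"
| "val sc D gen (Plus s t) = val sc D gen s + val sc D gen t"
| "val sc D gen (Times s t) = val sc D gen s * val sc D gen t"
| "val sc D gen (Der x t) = D x (val sc D gen t)"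

lemma sum_list_collect:
  fixes f :: "'i \<Rightarrow> 'b::comm_ring_1" and sc :: "'k::field \<Rightarrow> 'b \<Rightarrow> 'b"
  assumes "vector_space sc" "finite K" "snd ` set L \<subseteq> K"
  shows "(\<Sum>(c, k)\<leftarrow>L. sc c (f k)) = (\<Sum>k\<in>K. sc (csum k L) (f k))"
proof -
  interpret vector_space sc by (rule assms(1))
  show ?thesis using assms(3)
  proof (induction L)
    case Nil
    then show ?case by (simp add: csum_def)
  next
    case (Cons a L)
    obtain c k where a: "a = (c, k)" by (cases a)
    have "(\<Sum>k'\<in>K. sc (csum k' (a # L)) (f k')) =
        (\<Sum>k'\<in>K. (if k' = k then sc c (f k') else 0) + sc (csum k' L) (f k'))"
      by (rule sum.cong) (auto simp: csum_def a scale_left_distrib)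
    also have "\<dots> = sc c (f k) + (\<Sum>k'\<in>K. sc (csum k' L) (f k'))"
      using assms(2) Cons.prems by (simp add: sum.distrib a)
    finally show ?case using Cons by (simp add: a)
  qed
qed

locale generated_dhopf = dhopf sc cop eps S scD br \<theta> D bas h + differential_field scD br \<theta>
  for sc :: "'k::field_char_0 \<Rightarrow> 'b::comm_ring_1 \<Rightarrow> 'b" and cop eps S
    and scD :: "'k \<Rightarrow> 'd::ab_group_add \<Rightarrow> 'd" and br \<theta> D bas h +
  fixes gen :: "nat \<Rightarrow> 'b" and p q :: nat
  assumes gen_0: "p + q \<le> j \<Longrightarrow> gen j = 0"
    and x_tensor: "j < p \<Longrightarrow> in_tensor (gen ` {..<p}) (gen ` {..<p}) (gen j)"
    and x_S: "j < p \<Longrightarrow> S (gen j) \<in> gen ` {..<p}"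
    and z_tensor: "l < q \<Longrightarrow> \<exists>u. set u \<subseteq> (\<lambda>l. gen (p + l)) ` {..<q} \<times>
      {a * b |a b. a \<in> gen ` {..<p} \<and> b \<in> gen ` {..<p}} \<and> repr (gen (p + l)) ((1, gen (p + l)) # u)"
    and z_S: "l < q \<Longrightarrow> \<exists>u x. set u \<subseteq> gen ` {..<p} \<times> gen ` {..<p} \<and>
      S (gen (p + l)) = ev (\<lambda>a b. a * D x b) u"
    and x_D: "i < h \<Longrightarrow> j < p \<Longrightarrow> \<exists>u c. set u \<subseteq> gen ` {..<p} \<times> (\<lambda>l. gen (p + l)) ` {..<q} \<and>
      D (bas i) (gen j) = sc c (ev (\<lambda>a l. a * l) u)"
begin

abbreviation "v \<equiv> val sc D gen"

lemma val_cong: "s \<approx> t \<Longrightarrow> v s = v t"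
  by (induction rule: dterm_eq.induct)
    (auto simp: algebra_simps D_add D_mult D_plus D_scD D_br D_const scale_left_distrib
      scale_mult[symmetric] scale_one_mult)

text \<open>Equality of values: \<open>V\<close> contains all relations that hold in the algebra, in
  contrast to the congruence generated by finitely many of them with which it is compared
  later.\<close>

sublocale V: term_cong scD br \<theta> "\<lambda>s t. v s = v t" p q bas h
  by unfold_locales (auto simp: val_cong gen_0 bas)

lemma V_zt: "v (V.zt \<beta> l) = foldr (\<lambda>i. D (bas i)) (sorted_list_of_multiset \<beta>) (gen (p + l))"
proof -
  have "v (foldr (\<lambda>i. Der (bas i)) xs (Var (p + l))) = foldr (\<lambda>i. D (bas i)) xs (gen (p + l))" for xs
    by (induction xs) auto
  then show ?thesis by (simp add: V.zt_def)
qed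

sublocale V: der_term_cong scD br \<theta> "\<lambda>s t. v s = v t" p q bas h
proof
  fix i j assume "i < h" "j < p"
  then obtain u c where u: "set u \<subseteq> gen ` {..<p} \<times> (\<lambda>l. gen (p + l)) ` {..<q}"
    "D (bas i) (gen j) = sc c (ev (\<lambda>a l. a * l) u)" using x_D by blast
  have "\<exists>t\<in>V.pol 1. v t = ev (\<lambda>a l. a * l) u" using u(1)
  proof (induction u)
    case Nil
    show ?case by (rule bexI[of _ "Const 0"]) (auto intro: V.pol_Const)
  next
    case (Cons a u)
    then obtain t k l where t: "t \<in> V.pol 1" "v t = ev (\<lambda>a l. a * l) u" "k < p" "l < q" "a = (gen k, gen (p + l))"
      by auto
    have "Plus (Times (Var k) (V.zt {#} l)) t \<in> V.pol 1"
      using t by (intro V.pol.intros) auto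
    moreover have "v (Plus (Times (Var k) (V.zt {#} l)) t) = ev (\<lambda>a l. a * l) (a # u)"
      using t by (simp add: V_zt)
    ultimately show ?case by blast
  qed
  then obtain t where t: "t \<in> V.pol 1" "v t = ev (\<lambda>a l. a * l) u" by blast
  have "Times (Const c) t \<in> V.pol 1" using t by (intro V.pol.intros)
  moreover have "v (Der (bas i) (Var j)) = v (Times (Const c) t)"
    using u(2) t(2) by (simp add: scale_one_mult)
  ultimately show "\<exists>t\<in>V.pol 1. v (Der (bas i) (Var j)) = v t" by blast
qed

text \<open>In terms of weight, the compatibility with derivations, coproduct and antipode can be
  checked on the syntax; \<open>A_pol\<close> adds the description by polynomials in derivatives of
  bounded order.\<close>

definition A :: "nat \<Rightarrow> 'b set" where
  "A m = v ` {t. weight p t \<le> m}"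

lemma A_base: "weight p t \<le> m \<Longrightarrow> v t \<in> A m"
  by (auto simp: A_def)

lemma A_mono: "m \<le> m' \<Longrightarrow> A m \<subseteq> A m'"
  by (auto simp: A_def)

lemma A_const: "sc c 1 \<in> A m"
  using A_base[of "Const c" m] by simp

lemma A_add: "a \<in> A m \<Longrightarrow> b \<in> A m \<Longrightarrow> a + b \<in> A m"
  unfolding A_def using A_base[of "Plus _ _" m] by (force simp: A_def)

lemma A_mult: "a \<in> A m \<Longrightarrow> b \<in> A m \<Longrightarrow> a * b \<in> A m"
  unfolding A_def using A_base[of "Times _ _" m] by (force simp: A_def)

lemma A_D: "a \<in> A m \<Longrightarrow> D x a \<in> A (Suc m)"
  unfolding A_def using A_base[of "Der x _" "Suc m"] by (force simp: A_def)

lemma A_0: "0 \<in> A m"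
  using A_const[of 0] by simp

lemma A_gen: "j < p \<Longrightarrow> gen j \<in> A m" "gen j \<in> A (Suc m)"
  using A_base[of "Var j" m] A_base[of "Var j" "Suc m"] by (auto split: if_splits)

text \<open>Coproduct and antipode are compatible with all term constructors, so the variables
  decide. The antipode of a logarithmic derivative is a sum of products \<open>a * D x b\<close>
  with \<open>a\<close> and \<open>b\<close> of order 0, hence again of order at most 1.\<close>

lemma A_S_tens: "S (v t) \<in> A (weight p t) \<and> in_tensor (A (weight p t)) (A (weight p t)) (v t)"
proof (induction t)
  case (Var j)
  have xA: "gen ` {..<p} \<subseteq> A m" for m using A_gen(1) by auto
  consider "j < p" | l where "l < q" "j = p + l" | "p + q \<le> j"
    by (metis add_less_cancel_left le_add_diff_inverse not_le)
  then show ?case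
  proof cases
    case 1
    then have "S (gen j) \<in> A 0" "in_tensor (A 0) (A 0) (gen j)"
      using x_S xA in_tensor_mono[OF x_tensor xA xA] by auto
    then show ?thesis using 1 by simp
  next
    case 2
    obtain u where u: "set u \<subseteq> (\<lambda>l. gen (p + l)) ` {..<q} \<times>
      {a * b |a b. a \<in> gen ` {..<p} \<and> b \<in> gen ` {..<p}}" "repr (gen (p + l)) ((1, gen (p + l)) # u)"
      using z_tensor[OF 2(1)] by blast
    have "set ((1, gen (p + l)) # u) \<subseteq> A 1 \<times> A 1"
      using u(1) A_gen(2)[of _ 0] A_mult[of _ 1] xA[of 1] A_const[of 1] by (auto simp: One_nat_def)
    then have t: "in_tensor (A 1) (A 1) (gen j)" unfolding in_tensor_def using u(2) 2(2) by blast
    obtain w x where w: "set w \<subseteq> gen ` {..<p} \<times> gen ` {..<p}" "S (gen (p + l)) = ev (\<lambda>a b. a * D x b) w"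
      using z_S[OF 2(1)] by blast
    have "S (gen j) \<in> A 1"
      unfolding 2(2) w(2)
    proof (rule ev_mem)
      fix a b assume "(a, b) \<in> set w"
      then have "a \<in> A 1" "b \<in> A 0" using w(1) xA by auto
      then show "a * D x b \<in> A 1" using A_D[of b 0 x] by (intro A_mult) simp_all
    qed (auto intro: A_0 A_add)
    then show ?thesis using t 2 by simp
  next
    case 3
    have "in_tensor (A 1) (A 1) (sc 0 1)"
      unfolding in_tensor_def using repr_const[of 0] A_const[of 1 1] A_0 by (intro exI[of _ "[(sc 0 1, 1)]"]) auto
    then show ?thesis using 3 by (simp add: gen_0 S_0 A_0)
  qed
next
  case (Const c)
  have "in_tensor (A 0) (A 0) (sc c 1)"
    unfolding in_tensor_def using repr_const[of c] A_const[of c 0] A_const[of 1 0] by (intro exI[of _ "[(sc c 1, 1)]"]) auto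
  then show ?case by (simp add: S_scale S_one A_const)
next
  case (Plus s t)
  let ?m = "max (weight p s) (weight p t)"
  have m: "A (weight p s) \<subseteq> A ?m" "A (weight p t) \<subseteq> A ?m" by (auto intro!: A_mono)
  have "S (v s) \<in> A ?m" "S (v t) \<in> A ?m" using Plus m by blast+
  moreover have "in_tensor (A ?m) (A ?m) (v s)" "in_tensor (A ?m) (A ?m) (v t)"
    using Plus in_tensor_mono m by meson+
  ultimately show ?case by (simp add: S_add A_add in_tensor_add)
next
  case (Times s t)
  let ?m = "max (weight p s) (weight p t)"
  have m: "A (weight p s) \<subseteq> A ?m" "A (weight p t) \<subseteq> A ?m" by (auto intro!: A_mono)
  have "S (v s) \<in> A ?m" "S (v t) \<in> A ?m" using Times m by blast+
  moreover have "in_tensor (A ?m) (A ?m) (v s)" "in_tensor (A ?m) (A ?m) (v t)"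
    using Times in_tensor_mono m by meson+
  ultimately show ?case by (simp add: S_mult A_mult in_tensor_mult)
next
  case (Der x t)
  have "A (weight p t) \<subseteq> A (Suc (weight p t))" by (rule A_mono) simp
  then show ?case using Der by (auto simp: S_D intro: A_D in_tensor_D)
qed

lemma A_hopf: "hopf_subalgebra (A m)"
  unfolding hopf_subalgebra_def
proof (intro conjI ballI allI)
  fix a assume "a \<in> A m"
  then obtain t where t: "a = v t" "weight p t \<le> m" by (auto simp: A_def)
  have "A (weight p t) \<subseteq> A m" by (rule A_mono[OF t(2)])
  then show "S a \<in> A m" "in_tensor (A m) (A m) a"
    using A_S_tens[of t] in_tensor_mono unfolding t(1) by blast+
qed (auto intro: A_const A_add A_mult)

lemma A_subspace: "subspace (A m)"
  by (rule hopf_subalgebra_subspace[OF A_hopf])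

lemma A_pol: "A m = v ` V.pol m"
proof
  show "A m \<subseteq> v ` V.pol m"
  proof
    fix a assume "a \<in> A m"
    then obtain t where t: "a = v t" "weight p t \<le> m" by (auto simp: A_def)
    obtain s where "s \<in> V.pol (weight p t)" "v t = v s"
      using V.all_pol[of t] by (auto simp: V.sat_def V.cong_iff[symmetric])
    then show "a \<in> v ` V.pol m" using t V.pol_mono by blast
  qed
  show "v ` V.pol m \<subseteq> A m"
  proof
    fix a assume "a \<in> v ` V.pol m"
    then obtain t where "t \<in> V.pol m" "a = v t" by blast
    moreover have "v t \<in> A m" if "t \<in> V.pol m" for t
      using that
    proof induction
      case (pol_zt \<beta> l)
      have "weight p (foldr (\<lambda>i. Der (bas i)) xs (Var (p + l) :: (nat, 'k, 'd) dterm)) = Suc (length xs)" for xs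
        by (induction xs) auto
      moreover have "length (sorted_list_of_multiset \<beta>) = size \<beta>" by (metis mset_sorted_list_of_multiset size_mset)
      ultimately have "weight p (V.zt \<beta> l) \<le> m" using pol_zt by (simp add: V.zt_def)
      then show ?case by (rule A_base)
    qed (auto intro: A_const A_gen A_add A_mult)
    ultimately show "a \<in> A m" by simp
  qed
qed

definition I :: "nat \<Rightarrow> (nat multiset \<times> nat) set" where
  "I m = {(\<beta>, l). set_mset \<beta> \<subseteq> {..<h} \<and> l < q \<and> size \<beta> = m \<and> \<not> V.dep \<beta> l}"

definition z :: "nat multiset \<times> nat \<Rightarrow> 'b" where
  "z = (\<lambda>(\<beta>, l). v (V.zt \<beta> l))"

text \<open>A derivation sends \<open>1 \<otimes> z\<close> to \<open>1 \<otimes> D z\<close>,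
  because it kills 1; so the leading term keeps its shape, and elsewhere the order of the right
  factors rises by at most one. At the start these are products of two matrix entries, of order
  0.\<close>

lemma z_comodule:
  assumes "l < q"
  shows "\<exists>u. set u \<subseteq> UNIV \<times> A (size \<beta>) \<and> repr (z (\<beta>, l)) ((1, z (\<beta>, l)) # u)"
proof -
  let ?f = "\<lambda>xs. foldr (\<lambda>i. D (bas i)) xs (gen (p + l))"
  have "\<exists>u. set u \<subseteq> UNIV \<times> A (length xs) \<and> repr (?f xs) ((1, ?f xs) # u)" for xs
  proof (induction xs)
    case Nil
    obtain u where u: "set u \<subseteq> (\<lambda>l. gen (p + l)) ` {..<q} \<times>
      {a * b |a b. a \<in> gen ` {..<p} \<and> b \<in> gen ` {..<p}}" "repr (gen (p + l)) ((1, gen (p + l)) # u)"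
      using z_tensor[OF assms] by blast
    have "set u \<subseteq> UNIV \<times> A 0"
    proof
      fix r assume "r \<in> set u"
      then obtain c d where "snd r = c * d" "c \<in> gen ` {..<p}" "d \<in> gen ` {..<p}"
        using u(1) by (cases r) auto
      then have "snd r \<in> A 0" by (auto intro!: A_mult A_gen)
      then show "r \<in> UNIV \<times> A 0" by (cases r) simp
    qed
    then show ?case using u(2) by auto
  next
    case (Cons i xs)
    let ?D = "D (bas i)"
    obtain u where u: "set u \<subseteq> UNIV \<times> A (length xs)" "repr (?f xs) ((1, ?f xs) # u)" using Cons by blast
    let ?w = "map (\<lambda>p. (?D (fst p), snd p)) u @ map (\<lambda>p. (fst p, ?D (snd p))) u"
    have "repr (?D (?f xs)) ((1, ?D (?f xs)) # ?w)"
      unfolding repr_def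
    proof (intro allI impI)
      fix f assume f: "balanced f"
      show "ev f (cop (?D (?f xs))) = ev f ((1, ?D (?f xs)) # ?w)"
        using repr_D[OF repr_derivative[OF u(2)] f, of "bas i"] by (simp add: D_one balanced_0[OF f] add.commute add.left_commute)
    qed
    moreover have "set ?w \<subseteq> UNIV \<times> A (Suc (length xs))"
      using u(1) A_mono[of "length xs" "Suc (length xs)"] A_D by fastforce
    ultimately show ?case by (intro exI[of _ ?w]) simp
  qed
  moreover have "length (sorted_list_of_multiset \<beta>) = size \<beta>" by (metis mset_sorted_list_of_multiset size_mset)
  ultimately show ?thesis by (simp add: z_def V_zt) metis
qed

lemma val_low:
  assumes "set_mset \<beta> \<subseteq> {..<h}" "l < q" "a \<in> A (size \<beta>)" "finite J"
    and "\<And>\<beta>' l'. (\<beta>', l') \<in> J \<Longrightarrow> set_mset \<beta>' \<subseteq> {..<h} \<and> l' < q \<and> size \<beta>' = size \<beta> \<and> (\<beta>' < \<beta> \<or> \<beta>' = \<beta> \<and> l' < l)"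
  shows "a + (\<Sum>j\<in>J. sc (c j) (z j)) \<in> v ` V.low \<beta> l"
  using assms(4,5)
proof (induction J rule: finite_induct)
  case empty
  then show ?case using assms(3) by (auto simp: A_pol intro: V.low_pol)
next
  case (insert j J)
  obtain \<beta>' l' where j: "j = (\<beta>', l')" by (cases j)
  have "a + (\<Sum>j\<in>J. sc (c j) (z j)) \<in> v ` V.low \<beta> l" using insert by blast
  then obtain t where t: "t \<in> V.low \<beta> l" "a + (\<Sum>j\<in>J. sc (c j) (z j)) = v t" by blast
  have mem: "Plus (Times (Const (c j)) (V.zt \<beta>' l')) t \<in> V.low \<beta> l"
    using insert.prems[of \<beta>' l'] t(1) by (intro V.low_Plus V.low_zt) (auto simp: j)
  have "a + (\<Sum>j\<in>insert j J. sc (c j) (z j)) = sc (c j) (z j) + (a + (\<Sum>j\<in>J. sc (c j) (z j)))"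
    using insert.hyps by (simp add: add.left_commute)
  also have "\<dots> = v (Plus (Times (Const (c j)) (V.zt \<beta>' l')) t)"
    unfolding t(2) by (simp add: scale_one_mult) (simp add: z_def j)
  finally have "a + (\<Sum>j\<in>insert j J. sc (c j) (z j)) = v (Plus (Times (Const (c j)) (V.zt \<beta>' l')) t)" .
  then show ?case by (rule image_eqI[OF _ mem])
qed

text \<open>Otherwise the relation could be solved for the largest \<open>(\<beta>, l)\<close> with
  nonzero coefficient, which would make \<open>zt \<beta> l\<close> dependent.\<close>

lemma I_relation:
  assumes "finite J" "J \<subseteq> I m" "a \<in> A m" "a + (\<Sum>j\<in>J. sc (c j) (z j)) = 0" "j \<in> J"
  shows "c j = 0"
proof (rule ccontr)
  assume "c j \<noteq> 0"
  define J' where "J' = {j \<in> J. c j \<noteq> 0}"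
  define \<beta> where "\<beta> = Max (fst ` J')"
  define l where "l = Max {l. (\<beta>, l) \<in> J'}"
  have "j \<in> J'" using assms(5) \<open>c j \<noteq> 0\<close> by (simp add: J'_def)
  then have fin: "finite J'" "J' \<noteq> {}" using assms(1) unfolding J'_def by (simp, blast)
  have "\<beta> \<in> fst ` J'" unfolding \<beta>_def using fin by (intro Max_in) auto
  moreover have fl: "finite {l. (\<beta>, l) \<in> J'}"
    using fin(1) by (rule_tac finite_subset[of _ "snd ` J'"]) force+
  moreover from calculation have "{l. (\<beta>, l) \<in> J'} \<noteq> {}" by force
  ultimately have \<beta>l: "(\<beta>, l) \<in> J'" unfolding l_def using Max_in[OF fl] by blast
  then have cl: "c (\<beta>, l) \<noteq> 0" and \<beta>lI: "(\<beta>, l) \<in> I m" using assms(2) by (auto simp: J'_def)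
  have max: "\<beta>' < \<beta> \<or> \<beta>' = \<beta> \<and> l' < l" if "(\<beta>', l') \<in> J' - {(\<beta>, l)}" for \<beta>' l'
  proof -
    have "\<beta>' \<le> \<beta>" unfolding \<beta>_def using that fin by (intro Max_ge) force+
    moreover have "l' \<le> l" if "\<beta>' = \<beta>" unfolding l_def using that \<open>(\<beta>', l') \<in> _\<close> fl by (intro Max_ge) auto
    ultimately show ?thesis using that by (auto simp: less_le)
  qed
  have s: "a + (sc (c (\<beta>, l)) (z (\<beta>, l)) + (\<Sum>j\<in>J' - {(\<beta>, l)}. sc (c j) (z j))) = 0"
  proof -
    have "(\<Sum>j\<in>J. sc (c j) (z j)) = (\<Sum>j\<in>J'. sc (c j) (z j))"
      using assms(1) by (intro sum.mono_neutral_right) (auto simp: J'_def)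
    then show ?thesis using assms(4) sum.remove[OF fin(1) \<beta>l, of "\<lambda>j. sc (c j) (z j)"] by simp
  qed
  let ?d = "- inverse (c (\<beta>, l))"
  have "z (\<beta>, l) = sc ?d a + (\<Sum>j\<in>J' - {(\<beta>, l)}. sc (?d * c j) (z j))"
  proof -
    have "sc ?d (a + (sc (c (\<beta>, l)) (z (\<beta>, l)) + (\<Sum>j\<in>J' - {(\<beta>, l)}. sc (c j) (z j)))) = 0"
      unfolding s by simp
    then have "sc ?d a + (- z (\<beta>, l) + (\<Sum>j\<in>J' - {(\<beta>, l)}. sc (?d * c j) (z j))) = 0"
      using cl by (simp only: scale_right_distrib scale_sum_right scale_scale) simp
    then show ?thesis by (simp add: algebra_simps eq_neg_iff_add_eq_0)
  qed
  also have "\<dots> \<in> v ` V.low \<beta> l"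
  proof (rule val_low)
    show "sc ?d a \<in> A (size \<beta>)"
      using subspace_scale[OF A_subspace assms(3), of ?d] \<beta>lI by (simp add: I_def)
  qed (use \<beta>lI max fin(1) assms(2) in \<open>auto simp: I_def J'_def\<close>)
  finally obtain t where "t \<in> V.low \<beta> l" "v (V.zt \<beta> l) = v t" by (auto simp: z_def)
  then have "V.dep \<beta> l" by (auto simp: V.dep_def)
  then show False using \<beta>lI by (simp add: I_def)
qed

lemma z_independent:
  assumes "i \<in> I m"
  shows "z i \<notin> span (A m \<union> z ` (I m - {i}))"
proof
  assume "z i \<in> span (A m \<union> z ` (I m - {i}))"
  then have "\<exists>J c a. finite J \<and> J \<subseteq> I m - {i} \<and> a \<in> A m \<and> z i = a + (\<Sum>j\<in>J. sc (c j) (z j))"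
  proof (induction rule: span_induct_alt)
    case base
    show ?case by (rule exI[of _ "{}"]) (simp add: A_0)
  next
    case (step c x y)
    then obtain J d a where J: "finite J" "J \<subseteq> I m - {i}" "a \<in> A m" "y = a + (\<Sum>j\<in>J. sc (d j) (z j))" by auto
    from step(1) consider "x \<in> A m" | k where "k \<in> I m - {i}" "x = z k" by auto
    then show ?case
    proof cases
      case 1
      then have "sc c x + a \<in> A m" using J(3) A_subspace by (simp add: subspace_def)
      then show ?thesis using J by (intro exI[of _ J] exI[of _ d] exI[of _ "sc c x + a"]) (simp add: add.assoc)
    next
      case 2
      let ?d = "\<lambda>j. (if j = k then c else 0) + (if j \<in> J then d j else 0)"
      have "(\<Sum>j\<in>insert k J. sc (?d j) (z j)) =
          (\<Sum>j\<in>insert k J. (if j = k then sc c (z j) else 0) + (if j \<in> J then sc (d j) (z j) else 0))"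
        by (rule sum.cong) (auto simp: scale_left_distrib)
      also have "\<dots> = sc c x + (\<Sum>j\<in>J. sc (d j) (z j))"
      proof -
        have "(\<Sum>j\<in>insert k J. if j \<in> J then sc (d j) (z j) else 0) = (\<Sum>j\<in>J. sc (d j) (z j))"
          using J(1) by (intro sum.mono_neutral_cong_right) auto
        then show ?thesis using J(1) by (simp add: sum.distrib 2(2) del: sum.insert)
      qed
      finally show ?thesis
        using J 2 by (intro exI[of _ "insert k J"] exI[of _ ?d] exI[of _ a]) (simp add: add.left_commute)
    qed
  qed
  then obtain J c a where J: "finite J" "J \<subseteq> I m - {i}" "a \<in> A m" "z i = a + (\<Sum>j\<in>J. sc (c j) (z j))" by blast
  let ?c = "\<lambda>j. if j = i then - 1 else c j"
  have "(\<Sum>j\<in>insert i J. sc (?c j) (z j)) = - z i + (\<Sum>j\<in>J. sc (c j) (z j))"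
  proof -
    have "i \<notin> J" using J(2) by auto
    moreover have "(\<Sum>j\<in>J. sc (?c j) (z j)) = (\<Sum>j\<in>J. sc (c j) (z j))"
      using J(2) by (intro sum.cong) auto
    ultimately show ?thesis using J(1) by simp
  qed
  then have "a + (\<Sum>j\<in>insert i J. sc (?c j) (z j)) = 0" using J(4) by simp
  then have "?c i = 0"
    using J assms by (intro I_relation[of "insert i J" m a ?c i]) auto
  then show False by simp
qed

lemma block_I: "block sc cop eps S (A m) z (I m)"
proof
  show "\<exists>u. set u \<subseteq> UNIV \<times> A m \<and> repr (z i) ((1, z i) # u)" if "i \<in> I m" for i
  proof -
    obtain \<beta> l where i: "i = (\<beta>, l)" by (cases i)
    then have "l < q" "size \<beta> = m" using that by (auto simp: I_def)
    then show ?thesis using z_comodule[of l \<beta>] i by simp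
  qed
  show "hopf_subalgebra (A m)" by (rule A_hopf)
  show "z i \<notin> span (A m \<union> z ` (I m - {i}))" if "i \<in> I m" for i by (rule z_independent[OF that])
qed

lemma mset_val_mem_A: "(\<And>\<beta> l. (\<beta>, l) \<in># P \<Longrightarrow> set_mset \<beta> \<subseteq> {..<h} \<and> l < q \<and> size \<beta> < m) \<Longrightarrow> mset_val z P \<in> A m"
proof (induction P)
  case empty
  show ?case using A_const[of 1 m] by simp
next
  case (add i P)
  obtain \<beta> l where i: "i = (\<beta>, l)" by (cases i)
  have "V.zt \<beta> l \<in> V.pol m" using add.prems[of \<beta> l] i by (intro V.pol_zt) auto
  then have "z i \<in> A m" by (auto simp: A_pol z_def i)
  then show ?case using add.IH add.prems by (auto intro!: A_mult)
qed

text \<open>Induction up the tower of the \<open>A m\<close>. From each monomial the part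
  \<open>f P\<close> with indices of size \<open>m\<close> is split off; the rest has its value in
  \<open>A m\<close>. So \<open>alg_independent\<close> makes the coefficient of every
  \<open>f P\<close> vanish, and these coefficients are relations for the induction
  hypothesis.\<close>

lemma z_monomials_independent:
  assumes "finite R" "\<And>P. P \<in> R \<Longrightarrow> set_mset P \<subseteq> (\<Union>k<m. I k)" "\<And>P. P \<in> R \<Longrightarrow> a P \<in> A 0"
    "(\<Sum>P\<in>R. a P * mset_val z P) = 0"
  shows "\<forall>P\<in>R. a P = 0"
  using assms
proof (induction m arbitrary: R a)
  case 0
  have "R \<subseteq> {{#}}" using 0(2) by auto
  then have "R = {} \<or> R = {{#}}" by auto
  then show ?case using 0(4) by auto
next
  case (Suc m)
  interpret block sc cop eps S "A m" z "I m" by (rule block_I)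
  define f where "f P = filter_mset (\<lambda>i. size (fst i) = m) P" for P :: "(nat multiset \<times> nat) multiset"
  define g where "g P = filter_mset (\<lambda>i. size (fst i) \<noteq> m) P" for P :: "(nat multiset \<times> nat) multiset"
  have fg: "P = f P + g P" for P
    unfolding f_def g_def by (rule multiset_partition)
  have fI: "set_mset (f P) \<subseteq> I m" and gI: "set_mset (g P) \<subseteq> (\<Union>k<m. I k)" if "P \<in> R" for P
    using Suc.prems(2)[OF that] by (auto simp: f_def g_def I_def)
  define b where "b Q = (\<Sum>P | P \<in> R \<and> f P = Q. a P * mset_val z (g P))" for Q
  have "(\<Sum>Q\<in>f ` R. b Q * mset_val z Q) = (\<Sum>Q\<in>f ` R. \<Sum>P | P \<in> R \<and> f P = Q. a P * mset_val z P)"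
    unfolding b_def sum_distrib_right
  proof (intro sum.cong HOL.refl)
    fix Q P assume "P \<in> {P \<in> R. f P = Q}"
    then have "mset_val z P = mset_val z Q * mset_val z (g P)" using fg[of P] mset_val_simps(3)[of z "f P" "g P"] by simp
    then show "a P * mset_val z (g P) * mset_val z Q = a P * mset_val z P" by (simp add: ac_simps)
  qed
  also have "\<dots> = (\<Sum>P\<in>R. a P * mset_val z P)"
    using Suc.prems(1) by (intro sum.group) auto
  finally have s: "(\<Sum>Q\<in>f ` R. b Q * mset_val z Q) = 0" using Suc.prems(4) by simp
  have "\<forall>Q\<in>f ` R. b Q = 0"
  proof (rule alg_independent[OF _ _ _ s])
    fix Q assume "Q \<in> f ` R"
    have "mset_val z (g P) \<in> A m" if "P \<in> R" for P
      using gI[OF that] by (intro mset_val_mem_A) (force simp: I_def)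
    moreover have "a P \<in> A m" if "P \<in> R" for P
      using Suc.prems(3)[OF that] A_mono[of 0 m] by auto
    ultimately show "b Q \<in> A m"
      unfolding b_def by (intro subspace_sum A_subspace A_mult) auto
  qed (use Suc.prems(1) fI in auto)
  then have bQ: "b Q = 0" if "Q \<in> f ` R" for Q using that by blast
  show ?case
  proof
    fix P0 assume P0: "P0 \<in> R"
    let ?Q = "f P0"
    let ?R = "{P \<in> R. f P = ?Q}"
    have inj: "inj_on g ?R" by (rule inj_onI) (metis (mono_tags, lifting) fg mem_Collect_eq)
    have "(\<Sum>P'\<in>g ` ?R. a (?Q + P') * mset_val z P') = (\<Sum>P\<in>?R. a (?Q + g P) * mset_val z (g P))"
      by (subst sum.reindex[OF inj]) simp
    also have "\<dots> = b ?Q"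
      unfolding b_def
    proof (rule sum.cong[OF HOL.refl])
      fix P assume "P \<in> ?R"
      then have "?Q + g P = P" using fg[of P] by simp
      then show "a (?Q + g P) * mset_val z (g P) = a P * mset_val z (g P)" by simp
    qed
    finally have "(\<Sum>P'\<in>g ` ?R. a (?Q + P') * mset_val z P') = 0" using bQ P0 by simp
    moreover have "a (?Q + P') \<in> A 0" if "P' \<in> g ` ?R" for P'
    proof -
      from that obtain P where "P \<in> R" "f P = ?Q" "P' = g P" by auto
      then have "?Q + P' = P" using fg[of P] by simp
      then show ?thesis using Suc.prems(3) \<open>P \<in> R\<close> by simp
    qed
    ultimately have "\<forall>P'\<in>g ` ?R. a (?Q + P') = 0"
      using Suc.prems(1) gI by (intro Suc.IH) auto
    then have "a (?Q + g P0) = 0" using P0 by blast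
    then show "a P0 = 0" using fg[of P0] by simp
  qed
qed

definition N :: "nat multiset set" where
  "N = {\<mu>. set_mset \<mu> \<subseteq> {..<p} \<and> \<not> V.depx \<mu>}"

lemma val_mt: "v (mt f M) = mset_val (\<lambda>i. v (f i)) M"
proof -
  have "v (prodt (map f xs)) = mset_val (\<lambda>i. v (f i)) (mset xs)" for xs
    by (induction xs) (auto simp: prodt_def)
  then show ?thesis by (simp add: mt_def)
qed

text \<open>The argument of \<open>I_relation\<close> for monomials: the largest one with nonzero
  coefficient would be the leading monomial of a relation.\<close>

lemma x_monomials_independent:
  assumes "finite R" "R \<subseteq> N" "(\<Sum>\<mu>\<in>R. sc (c \<mu>) (mset_val gen \<mu>)) = 0"
  shows "\<forall>\<mu>\<in>R. c \<mu> = 0"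
proof (rule ccontr)
  assume "\<not> (\<forall>\<mu>\<in>R. c \<mu> = 0)"
  define R' where "R' = {\<mu> \<in> R. c \<mu> \<noteq> 0}"
  have fin: "finite R'" "R' \<noteq> {}" using assms(1) \<open>\<not> _\<close> by (auto simp: R'_def)
  define \<mu> where "\<mu> = Max R'"
  have \<mu>: "\<mu> \<in> R'" unfolding \<mu>_def using fin by (rule Max_in)
  have max: "\<nu> < \<mu>" if "\<nu> \<in> R' - {\<mu>}" for \<nu>
    using that fin Max_ge[of R' \<nu>] by (auto simp: \<mu>_def less_le)
  have "(\<Sum>\<nu>\<in>R. sc (c \<nu>) (mset_val gen \<nu>)) = (\<Sum>\<nu>\<in>R'. sc (c \<nu>) (mset_val gen \<nu>))"
    using assms(1) by (intro sum.mono_neutral_right) (auto simp: R'_def)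
  then have s: "sc (c \<mu>) (mset_val gen \<mu>) + (\<Sum>\<nu>\<in>R' - {\<mu>}. sc (c \<nu>) (mset_val gen \<nu>)) = 0"
    using assms(3) sum.remove[OF fin(1) \<mu>, of "\<lambda>\<nu>. sc (c \<nu>) (mset_val gen \<nu>)"] by simp
  let ?d = "- inverse (c \<mu>)"
  have "c \<mu> \<noteq> 0" using \<mu> by (simp add: R'_def)
  have "sc ?d (sc (c \<mu>) (mset_val gen \<mu>) + (\<Sum>\<nu>\<in>R' - {\<mu>}. sc (c \<nu>) (mset_val gen \<nu>))) = 0"
    unfolding s by simp
  then have "- mset_val gen \<mu> + (\<Sum>\<nu>\<in>R' - {\<mu>}. sc (?d * c \<nu>) (mset_val gen \<nu>)) = 0"
    using \<open>c \<mu> \<noteq> 0\<close> by (simp only: scale_right_distrib scale_sum_right scale_scale) simp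
  then have eq: "mset_val gen \<mu> = (\<Sum>\<nu>\<in>R' - {\<mu>}. sc (?d * c \<nu>) (mset_val gen \<nu>))"
    by (simp add: algebra_simps eq_neg_iff_add_eq_0)
  have "(\<Sum>\<nu>\<in>J. sc (d \<nu>) (mset_val gen \<nu>)) \<in> v ` V.lowx \<mu>" if "finite J" "J \<subseteq> R' - {\<mu>}" for J d
    using that
  proof (induction J rule: finite_induct)
    case empty
    have "v (Const 0) = 0" by simp
    then show ?case using V.lowx_0[of \<mu>] by (metis imageI sum.empty)
  next
    case (insert \<nu> J)
    then obtain t where t: "t \<in> V.lowx \<mu>" "(\<Sum>\<nu>\<in>J. sc (d \<nu>) (mset_val gen \<nu>)) = v t" by auto
    have mem: "Plus (Times (Const (d \<nu>)) (xmon \<nu>)) t \<in> V.lowx \<mu>"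
      using insert.prems max assms(2) t(1) by (intro V.lowx_Plus V.lowx_mon) (auto simp: R'_def N_def)
    have "(\<Sum>\<nu>\<in>insert \<nu> J. sc (d \<nu>) (mset_val gen \<nu>)) = v (Plus (Times (Const (d \<nu>)) (xmon \<nu>)) t)"
      using insert.hyps t(2) by (simp add: val_mt scale_one_mult)
    then show ?case by (rule image_eqI[OF _ mem])
  qed
  from this[of "R' - {\<mu>}" "\<lambda>\<nu>. ?d * c \<nu>"] fin(1) have "mset_val gen \<mu> \<in> v ` V.lowx \<mu>" using eq by simp
  then have "V.depx \<mu>" by (auto simp: V.depx_def val_mt)
  then show False using \<mu> assms(2) by (auto simp: R'_def N_def)
qed

text \<open>Grouped by the \<open>z\<close> part, the coefficients lie in \<open>A 0\<close> and
  therefore vanish; each of them is a combination of standard monomials, which are independent over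
  the base field.\<close>

lemma monomials_independent:
  assumes "finite Ks" "\<And>\<mu> P. (\<mu>, P) \<in> Ks \<Longrightarrow> \<mu> \<in> N \<and> set_mset P \<subseteq> (\<Union>k. I k)"
    and s: "(\<Sum>k\<in>Ks. sc (c k) (mset_val gen (fst k) * mset_val z (snd k))) = 0"
  shows "\<forall>k\<in>Ks. c k = 0"
proof -
  define a where "a P = (\<Sum>\<mu> | (\<mu>, P) \<in> Ks. sc (c (\<mu>, P)) (mset_val gen \<mu>))" for P
  have fin: "finite {\<mu>. (\<mu>, P) \<in> Ks}" for P
    using assms(1) by (rule_tac finite_subset[of _ "fst ` Ks"]) force+
  have "(\<Sum>P\<in>snd ` Ks. a P * mset_val z P) =
      (\<Sum>P\<in>snd ` Ks. \<Sum>k | k \<in> Ks \<and> snd k = P. sc (c k) (mset_val gen (fst k) * mset_val z (snd k)))"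
  proof (rule sum.cong[OF HOL.refl])
    fix P
    have "(\<Sum>k | k \<in> Ks \<and> snd k = P. sc (c k) (mset_val gen (fst k) * mset_val z (snd k))) =
        (\<Sum>\<mu> | (\<mu>, P) \<in> Ks. sc (c (\<mu>, P)) (mset_val gen \<mu> * mset_val z P))"
      by (rule sum.reindex_bij_witness[where j = fst and i = "\<lambda>\<mu>. (\<mu>, P)"]) auto
    then show "a P * mset_val z P = (\<Sum>k | k \<in> Ks \<and> snd k = P. sc (c k) (mset_val gen (fst k) * mset_val z (snd k)))"
      by (simp add: a_def sum_distrib_right scale_mult)
  qed
  also have "\<dots> = (\<Sum>k\<in>Ks. sc (c k) (mset_val gen (fst k) * mset_val z (snd k)))"
    using assms(1) by (intro sum.group) auto
  finally have s': "(\<Sum>P\<in>snd ` Ks. a P * mset_val z P) = 0" using s by simp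
  have "\<exists>m. \<forall>P\<in>snd ` Ks. set_mset P \<subseteq> (\<Union>k<m. I k)"
  proof -
    let ?S = "\<Union>P\<in>snd ` Ks. set_mset P"
    have "finite ?S" using assms(1) by auto
    then have b: "size (fst i) < Suc (Max ((\<lambda>i. size (fst i)) ` ?S))" if "i \<in> ?S" for i
      using that by (intro le_imp_less_Suc Max_ge) auto
    have "set_mset P \<subseteq> (\<Union>k<Suc (Max ((\<lambda>i. size (fst i)) ` ?S)). I k)" if P: "P \<in> snd ` Ks" for P
    proof
      fix i assume i: "i \<in># P"
      then obtain k where "i \<in> I k" using assms(2) P by force
      then have "i \<in> I (size (fst i))" by (auto simp: I_def)
      then show "i \<in> (\<Union>k<Suc (Max ((\<lambda>i. size (fst i)) ` ?S)). I k)" using b[of i] i P by blast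
    qed
    then show ?thesis by blast
  qed
  then obtain m where m: "\<And>P. P \<in> snd ` Ks \<Longrightarrow> set_mset P \<subseteq> (\<Union>k<m. I k)" by blast
  have mset_val_x: "mset_val gen \<mu> \<in> A 0" if "set_mset \<mu> \<subseteq> {..<p}" for \<mu>
    using that by (induction \<mu>) (use A_const[of 1 0] in \<open>auto intro: A_mult A_gen\<close>)
  have "\<forall>P\<in>snd ` Ks. a P = 0"
  proof (rule z_monomials_independent[OF _ m _ s'])
    show "a P \<in> A 0" for P
      unfolding a_def using assms(2) A_subspace
      by (intro subspace_sum subspace_scale mset_val_x) (auto simp: N_def)
  qed (use assms(1) in auto)
  then have a0: "a P = 0" if "(\<mu>, P) \<in> Ks" for \<mu> P using that by force
  have "c (\<mu>, P) = 0" if "(\<mu>, P) \<in> Ks" for \<mu> P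
    using x_monomials_independent[OF fin[of P], of "\<lambda>\<mu>. c (\<mu>, P)"] assms(2) a0[OF that] that
    unfolding a_def by auto
  then show ?thesis by auto
qed

text \<open>Repeated keys are collected first, so the conclusion concerns total coefficients, as
  \<open>lc_collapse\<close> requires.\<close>

lemma lc_independent:
  assumes "\<And>\<mu> P. (\<mu>, P) \<in> snd ` set L \<Longrightarrow> \<mu> \<in> N \<and> set_mset P \<subseteq> (\<Union>k. I k)"
    and "v (lc (\<lambda>(\<mu>, P). Times (xmon \<mu>) (mt (\<lambda>(\<beta>, l). V.zt \<beta> l) P)) L) = 0"
  shows "csum k L = 0"
proof (cases "k \<in> snd ` set L")
  case True
  have eq: "v (lc (\<lambda>(\<mu>, P). Times (xmon \<mu>) (mt (\<lambda>(\<beta>, l). V.zt \<beta> l) P)) L) =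
      (\<Sum>(c, k)\<leftarrow>L. sc c (mset_val gen (fst k) * mset_val z (snd k)))"
  proof (induction L)
    case Nil
    show ?case by (simp add: lc_def sumt_def)
  next
    case (Cons a L)
    have "z = (\<lambda>i. v ((\<lambda>(\<beta>, l). V.zt \<beta> l) i))" by (auto simp: z_def)
    then show ?case using Cons by (cases a) (auto simp: lc_def sumt_def val_mt scale_one_mult)
  qed
  have "(\<Sum>k\<in>snd ` set L. sc (csum k L) (mset_val gen (fst k) * mset_val z (snd k))) = 0"
    using sum_list_collect[OF vector_space_axioms, of "snd ` set L" L "\<lambda>k. mset_val gen (fst k) * mset_val z (snd k)"] eq assms(2)
    by simp
  then show ?thesis
    using monomials_independent[of "snd ` set L" "\<lambda>k. csum k L"] assms(1) True by auto
next
  case False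
  then show ?thesis unfolding csum_def by (induction L) auto
qed

end

section \<open>Finite presentation\<close>

context differential_field
begin

section \<open>The free differential algebra and its ideals\<close>

definition cls :: "'v set \<Rightarrow> ('v, 'k, 'd) dterm \<Rightarrow> ('v, 'k, 'd) dterm set" where
  "cls W t = dterm_rel W `` {t}"

lemma dterms_simps [simp]:
  "Const c \<in> dterms W" "Plus s t \<in> dterms W \<longleftrightarrow> s \<in> dterms W \<and> t \<in> dterms W"
  "Times s t \<in> dterms W \<longleftrightarrow> s \<in> dterms W \<and> t \<in> dterms W" "Der x t \<in> dterms W \<longleftrightarrow> t \<in> dterms W"
  "Var j \<in> dterms W \<longleftrightarrow> j \<in> W"
  by (auto simp: dterms_def)

lemma cls_eq: "s \<in> dterms W \<Longrightarrow> t \<in> dterms W \<Longrightarrow> cls W s = cls W t \<longleftrightarrow> s \<approx> t"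
  unfolding cls_def dterm_rel_def
  by (auto intro: dterm_eq.intros)

lemma cls_mem: "u \<in> cls W t \<longleftrightarrow> t \<in> dterms W \<and> u \<in> dterms W \<and> t \<approx> u"
  by (auto simp: cls_def dterm_rel_def)

lemma free_carrier: "carrier (free_D_algebra W) = cls W ` dterms W"
  by (auto simp: free_D_algebra_def quotient_def cls_def)

lemma UN_const: "X \<noteq> {} \<Longrightarrow> (\<And>x. x \<in> X \<Longrightarrow> f x = c) \<Longrightarrow> (\<Union>x\<in>X. f x) = c"
  by auto

lemma free_ops:
  assumes "s \<in> dterms W" "t \<in> dterms W"
  shows "cls W s \<oplus>\<^bsub>free_D_algebra W\<^esub> cls W t = cls W (Plus s t)"
    and "cls W s \<otimes>\<^bsub>free_D_algebra W\<^esub> cls W t = cls W (Times s t)"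
    and "c \<odot>\<^bsub>free_D_algebra W\<^esub> cls W s = cls W (Times (Const c) s)"
    and "der (free_D_algebra W) x (cls W s) = cls W (Der x s)"
    and "\<one>\<^bsub>free_D_algebra W\<^esub> = cls W (Const 1)" and "\<zero>\<^bsub>free_D_algebra W\<^esub> = cls W (Const 0)"
proof -
  have ne: "cls W s \<noteq> {}" "cls W t \<noteq> {}" using assms cls_mem dterm_eq.refl by blast+
  have P: "cls W (Plus s' t') = cls W (Plus s t)" "cls W (Times s' t') = cls W (Times s t)"
    if "s' \<in> cls W s" "t' \<in> cls W t" for s' t'
    using that by (simp_all add: cls_mem cls_eq dterm_eq.cong_Plus dterm_eq.cong_Times dterm_eq.sym)
  show "cls W s \<oplus>\<^bsub>free_D_algebra W\<^esub> cls W t = cls W (Plus s t)"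
    unfolding free_D_algebra_def by (simp add: cls_def[of W, symmetric]) (intro UN_const ne P)
  show "cls W s \<otimes>\<^bsub>free_D_algebra W\<^esub> cls W t = cls W (Times s t)"
    unfolding free_D_algebra_def by (simp add: cls_def[of W, symmetric]) (intro UN_const ne P)
  have Q: "cls W (Times (Const c) s') = cls W (Times (Const c) s)" "cls W (Der x s') = cls W (Der x s)"
    if "s' \<in> cls W s" for s'
    using that by (simp_all add: cls_mem cls_eq dterm_eq.cong_Times dterm_eq.cong_Der dterm_eq.refl dterm_eq.sym)
  show "c \<odot>\<^bsub>free_D_algebra W\<^esub> cls W s = cls W (Times (Const c) s)"
    unfolding free_D_algebra_def by (simp add: cls_def[of W, symmetric]) (intro UN_const ne Q)
  show "der (free_D_algebra W) x (cls W s) = cls W (Der x s)"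
    unfolding free_D_algebra_def by (simp add: cls_def[of W, symmetric]) (intro UN_const ne Q)
  show "\<one>\<^bsub>free_D_algebra W\<^esub> = cls W (Const 1)" "\<zero>\<^bsub>free_D_algebra W\<^esub> = cls W (Const 0)"
    by (simp_all add: free_D_algebra_def cls_def)
qed

text \<open>\<open>Const 0\<close> fills the places of terms on which these equations do not
  depend.\<close>

lemmas free_const = free_ops(5,6)[of "Const 0" _ "Const 0", simplified]
lemmas free_smult = free_ops(3)[of _ _ "Const 0", OF _ dterms_simps(1)]
lemmas free_der = free_ops(4)[of _ _ "Const 0", OF _ dterms_simps(1)]

lemma free_cring: "cring (free_D_algebra W)"
proof -
  let ?F = "free_D_algebra W"
  have eqI: "cls W s = cls W t" if "s \<approx> t" "s \<in> dterms W" "t \<in> dterms W" for s t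
    using that cls_eq by blast
  have car: "\<exists>s\<in>dterms W. X = cls W s" if "X \<in> carrier ?F" for X
    using that by (auto simp: free_carrier)
  have closed: "cls W s \<in> carrier ?F" if "s \<in> dterms W" for s
    using that by (simp add: free_carrier)
  note ops = free_ops free_const closed
  show ?thesis
  proof (rule cringI)
    show "abelian_group ?F"
    proof (rule abelian_groupI)
      fix X Y Z assume "X \<in> carrier ?F" "Y \<in> carrier ?F" "Z \<in> carrier ?F"
      then obtain s t u where s: "X = cls W s" "s \<in> dterms W" and t: "Y = cls W t" "t \<in> dterms W"
        and u: "Z = cls W u" "u \<in> dterms W" using car by metis
      show "X \<oplus>\<^bsub>?F\<^esub> Y \<in> carrier ?F" using s t by (simp add: ops)
      show "(X \<oplus>\<^bsub>?F\<^esub> Y) \<oplus>\<^bsub>?F\<^esub> Z = X \<oplus>\<^bsub>?F\<^esub> (Y \<oplus>\<^bsub>?F\<^esub> Z)"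
        using s t u by (simp add: ops) (rule eqI[OF dterm_eq.Plus_assoc], simp_all)
    next
      fix X Y assume "X \<in> carrier ?F" "Y \<in> carrier ?F"
      then obtain s t where s: "X = cls W s" "s \<in> dterms W" and t: "Y = cls W t" "t \<in> dterms W"
        using car by metis
      show "X \<oplus>\<^bsub>?F\<^esub> Y = Y \<oplus>\<^bsub>?F\<^esub> X"
        using s t by (simp add: ops) (rule eqI[OF dterm_eq.Plus_commute], simp_all)
    next
      fix X assume "X \<in> carrier ?F"
      then obtain s where s: "X = cls W s" "s \<in> dterms W" using car by metis
      show "\<zero>\<^bsub>?F\<^esub> \<oplus>\<^bsub>?F\<^esub> X = X"
        using s by (simp add: ops) (rule eqI[OF dterm_eq.Plus_zero], simp_all)
      show "\<exists>Y\<in>carrier ?F. Y \<oplus>\<^bsub>?F\<^esub> X = \<zero>\<^bsub>?F\<^esub>"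
        using s
        by (intro bexI[of _ "cls W (Times (Const (- 1)) s)"])
          (simp_all add: ops, rule eqI[OF dterm_eq.Plus_minus], simp_all)
    qed (simp add: ops)
    show "comm_monoid ?F"
    proof (rule comm_monoidI)
      fix X Y Z assume "X \<in> carrier ?F" "Y \<in> carrier ?F" "Z \<in> carrier ?F"
      then obtain s t u where s: "X = cls W s" "s \<in> dterms W" and t: "Y = cls W t" "t \<in> dterms W"
        and u: "Z = cls W u" "u \<in> dterms W" using car by metis
      show "X \<otimes>\<^bsub>?F\<^esub> Y \<otimes>\<^bsub>?F\<^esub> Z = X \<otimes>\<^bsub>?F\<^esub> (Y \<otimes>\<^bsub>?F\<^esub> Z)"
        using s t u by (simp add: ops) (rule eqI[OF dterm_eq.Times_assoc], simp_all)
    next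
      fix X Y assume "X \<in> carrier ?F" "Y \<in> carrier ?F"
      then obtain s t where s: "X = cls W s" "s \<in> dterms W" and t: "Y = cls W t" "t \<in> dterms W"
        using car by metis
      show "X \<otimes>\<^bsub>?F\<^esub> Y \<in> carrier ?F" using s t by (simp add: ops)
      show "X \<otimes>\<^bsub>?F\<^esub> Y = Y \<otimes>\<^bsub>?F\<^esub> X"
        using s t by (simp add: ops) (rule eqI[OF dterm_eq.Times_commute], simp_all)
    next
      fix X assume "X \<in> carrier ?F"
      then obtain s where s: "X = cls W s" "s \<in> dterms W" using car by metis
      show "\<one>\<^bsub>?F\<^esub> \<otimes>\<^bsub>?F\<^esub> X = X"
        using s by (simp add: ops) (rule eqI[OF dterm_eq.Times_one], simp_all)
    qed (simp add: ops)
    fix X Y Z assume "X \<in> carrier ?F" "Y \<in> carrier ?F" "Z \<in> carrier ?F"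
    then obtain s t u where s: "X = cls W s" "s \<in> dterms W" and t: "Y = cls W t" "t \<in> dterms W"
      and u: "Z = cls W u" "u \<in> dterms W" using car by metis
    show "(X \<oplus>\<^bsub>?F\<^esub> Y) \<otimes>\<^bsub>?F\<^esub> Z = X \<otimes>\<^bsub>?F\<^esub> Z \<oplus>\<^bsub>?F\<^esub> Y \<otimes>\<^bsub>?F\<^esub> Z"
      using s t u by (simp add: ops) (rule eqI[OF dterm_eq.distrib], simp_all)
  qed
qed

lemma free_neg: "t \<in> dterms W \<Longrightarrow> \<ominus>\<^bsub>free_D_algebra W\<^esub> cls W t = cls W (Times (Const (- 1)) t)"
proof -
  assume t: "t \<in> dterms W"
  interpret cring "free_D_algebra W" by (rule free_cring)
  show ?thesis
    by (rule minus_equality)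
      (use t in \<open>auto simp: free_carrier free_ops free_const cls_eq intro: dterm_eq.Plus_minus\<close>)
qed

lemma D_genideal_props:
  fixes W G
  defines "F \<equiv> free_D_algebra W" and "J \<equiv> D_genideal (free_D_algebra W) G"
  assumes "G \<subseteq> carrier (free_D_algebra W)"
  shows "ideal J F" "X \<in> J \<Longrightarrow> der F x X \<in> J" "G \<subseteq> J" "D_ideal I F \<Longrightarrow> G \<subseteq> I \<Longrightarrow> J \<subseteq> I"
proof -
  interpret cring F unfolding F_def by (rule free_cring)
  \<comment> \<open>The whole ring belongs to the family, so the intersection is not over the empty
    family.\<close>
  have "D_ideal (carrier F) F"
    unfolding D_ideal_def using oneideal by (auto simp: F_def free_carrier free_der)
  then have ne: "{I. D_ideal I F \<and> G \<subseteq> I} \<noteq> {}" using assms(3) by (auto simp: F_def)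
  have J: "J = \<Inter>{I. D_ideal I F \<and> G \<subseteq> I}" by (simp add: J_def D_genideal_def F_def)
  show "ideal J F" unfolding J by (rule i_Intersect[OF _ ne]) (auto simp: D_ideal_def)
  show "X \<in> J \<Longrightarrow> der F x X \<in> J" unfolding J by (auto simp: D_ideal_def)
  show "G \<subseteq> J" "D_ideal I F \<Longrightarrow> G \<subseteq> I \<Longrightarrow> J \<subseteq> I" unfolding J by auto
qed

end

primrec trunc :: "nat \<Rightarrow> (nat, 'k::zero, 'd) dterm \<Rightarrow> (nat, 'k, 'd) dterm" where
  "trunc n (Var j) = (if j < n then Var j else Const 0)"
| "trunc n (Const c) = Const c"
| "trunc n (Plus s t) = Plus (trunc n s) (trunc n t)"
| "trunc n (Times s t) = Times (trunc n s) (trunc n t)"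
| "trunc n (Der x t) = Der x (trunc n t)"

context differential_field
begin

lemma trunc_eq: "s \<approx> t \<Longrightarrow> trunc n s \<approx> trunc n t"
  by (induction rule: dterm_eq.induct) (auto intro: dterm_eq.intros)

lemma trunc_dterms: "trunc n t \<in> dterms {..<n}"
  by (induction t) auto

lemma trunc_id: "t \<in> dterms {..<n} \<Longrightarrow> trunc n t = t"
  by (induction t) auto

end

locale presented_dhopf = generated_dhopf sc cop eps S scD br \<theta> D bas h gen p q
  for sc :: "'k::field_char_0 \<Rightarrow> 'b::comm_ring_1 \<Rightarrow> 'b" and cop eps S
    and scD :: "'k \<Rightarrow> 'd::ab_group_add \<Rightarrow> 'd" and br \<theta> D bas h gen p q +
  assumes val_surj: "\<exists>t. v t = b"
begin

abbreviation "W \<equiv> {..<p + q}"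
abbreviation "Fr \<equiv> free_D_algebra W"

lemma v_trunc: "v (trunc (p + q) t) = v t"
  by (induction t) (auto simp: gen_0)

lemma zt_dterms: "l < q \<Longrightarrow> V.zt \<beta> l \<in> dterms W"
proof -
  assume "l < q"
  then have "foldr (\<lambda>i. Der (bas i)) xs (Var (p + l)) \<in> dterms W" for xs
    by (induction xs) auto
  then show ?thesis by (simp add: V.zt_def)
qed

lemma pol_dterms: "t \<in> V.pol m \<Longrightarrow> t \<in> dterms W"
  by (induction rule: V.pol.induct) (auto intro: zt_dterms)

lemma low_dterms: "t \<in> V.low \<beta> l \<Longrightarrow> t \<in> dterms W"
  by (induction rule: V.low.induct) (auto intro: zt_dterms pol_dterms)

lemma xmon_dterms: "set_mset \<mu> \<subseteq> {..<p} \<Longrightarrow> xmon \<mu> \<in> dterms W"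
proof -
  have "set xs \<subseteq> {..<p} \<Longrightarrow> prodt (map Var xs) \<in> dterms W" for xs
    by (induction xs) (auto simp: prodt_def)
  from this[of "list_of \<mu>"] show "set_mset \<mu> \<subseteq> {..<p} \<Longrightarrow> xmon \<mu> \<in> dterms W"
    by (metis mset_list_of mt_def set_mset_mset)
qed

lemma lowx_dterms: "t \<in> V.lowx \<mu> \<Longrightarrow> t \<in> dterms W"
  by (induction rule: V.lowx.induct) (auto intro: xmon_dterms)

text \<open>Three families: the derivatives of the order 0 generators, one relation for each minimal
  leading monomial in order 0, and, for each logarithmic derivative, one relation for each of its
  minimal dependent derivatives. The last two are finite by Dickson's lemma.\<close>

lemma finite_relations:
  obtains Rel where "finite Rel" "\<And>s t. (s, t) \<in> Rel \<Longrightarrow> s \<in> dterms W \<and> t \<in> dterms W \<and> v s = v t"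
    "\<And>i j. i < h \<Longrightarrow> j < p \<Longrightarrow> \<exists>t\<in>V.pol 1. (Der (bas i) (Var j), t) \<in> Rel"
    "\<And>\<mu>. set_mset \<mu> \<subseteq> {..<p} \<Longrightarrow> V.depx \<mu> \<Longrightarrow>
      \<exists>\<nu> t. \<nu> \<subseteq># \<mu> \<and> t \<in> V.lowx \<nu> \<and> (xmon \<nu>, t) \<in> Rel"
    "\<And>\<beta> l. set_mset \<beta> \<subseteq> {..<h} \<Longrightarrow> l < q \<Longrightarrow> V.dep \<beta> l \<Longrightarrow>
      \<exists>\<nu> t. \<nu> \<subseteq># \<beta> \<and> t \<in> V.low \<nu> l \<and> (V.zt \<nu> l, t) \<in> Rel"
proof -
  have "\<exists>t\<in>V.pol 1. v (Der (bas i) (Var j)) = v t" if "i < h" "j < p" for i j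
    using V.der_var that by blast
  then obtain td where td: "\<And>i j. i < h \<Longrightarrow> j < p \<Longrightarrow> td i j \<in> V.pol 1"
    "\<And>i j. i < h \<Longrightarrow> j < p \<Longrightarrow> v (Der (bas i) (Var j)) = v (td i j)" by metis
  obtain Mx where Mx: "finite Mx" "Mx \<subseteq> {\<mu>. set_mset \<mu> \<subseteq> {..<p} \<and> V.depx \<mu>}"
    "\<And>\<mu>. \<mu> \<in> {\<mu>. set_mset \<mu> \<subseteq> {..<p} \<and> V.depx \<mu>} \<Longrightarrow> \<exists>\<nu>\<in>Mx. \<nu> \<subseteq># \<mu>"
    by (rule dickson[of "{\<mu>. set_mset \<mu> \<subseteq> {..<p} \<and> V.depx \<mu>}" p]) (blast, rule that, assumption+)
  have "\<exists>t\<in>V.lowx \<mu>. v (xmon \<mu>) = v t" if "\<mu> \<in> Mx" for \<mu>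
    using Mx(2) that by (auto simp: V.depx_def)
  then obtain tx where tx: "\<And>\<mu>. \<mu> \<in> Mx \<Longrightarrow> tx \<mu> \<in> V.lowx \<mu>" "\<And>\<mu>. \<mu> \<in> Mx \<Longrightarrow> v (xmon \<mu>) = v (tx \<mu>)"
    by metis
  have "\<exists>M. finite M \<and> M \<subseteq> {\<beta>. set_mset \<beta> \<subseteq> {..<h} \<and> V.dep \<beta> l} \<and>
    (\<forall>\<beta>\<in>{\<beta>. set_mset \<beta> \<subseteq> {..<h} \<and> V.dep \<beta> l}. \<exists>\<nu>\<in>M. \<nu> \<subseteq># \<beta>)" for l
  proof -
    obtain M where M: "finite M" "M \<subseteq> {\<beta>. set_mset \<beta> \<subseteq> {..<h} \<and> V.dep \<beta> l}"
      "\<And>\<beta>. \<beta> \<in> {\<beta>. set_mset \<beta> \<subseteq> {..<h} \<and> V.dep \<beta> l} \<Longrightarrow> \<exists>\<nu>\<in>M. \<nu> \<subseteq># \<beta>"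
      by (rule dickson[of "{\<beta>. set_mset \<beta> \<subseteq> {..<h} \<and> V.dep \<beta> l}" h]) (blast, rule that, assumption+)
    show ?thesis by (intro exI[of _ M] conjI ballI M)
  qed
  then have "\<exists>M. \<forall>l. finite (M l) \<and> M l \<subseteq> {\<beta>. set_mset \<beta> \<subseteq> {..<h} \<and> V.dep \<beta> l} \<and>
    (\<forall>\<beta>\<in>{\<beta>. set_mset \<beta> \<subseteq> {..<h} \<and> V.dep \<beta> l}. \<exists>\<nu>\<in>M l. \<nu> \<subseteq># \<beta>)" by (intro choice allI)
  then obtain M where M0: "\<forall>l. finite (M l) \<and> M l \<subseteq> {\<beta>. set_mset \<beta> \<subseteq> {..<h} \<and> V.dep \<beta> l} \<and>
    (\<forall>\<beta>\<in>{\<beta>. set_mset \<beta> \<subseteq> {..<h} \<and> V.dep \<beta> l}. \<exists>\<nu>\<in>M l. \<nu> \<subseteq># \<beta>)" by (rule exE)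
  have M: "finite (M l)" "M l \<subseteq> {\<beta>. set_mset \<beta> \<subseteq> {..<h} \<and> V.dep \<beta> l}"
    "set_mset \<beta> \<subseteq> {..<h} \<Longrightarrow> V.dep \<beta> l \<Longrightarrow> \<exists>\<nu>\<in>M l. \<nu> \<subseteq># \<beta>" for l \<beta>
    using M0[rule_format, of l] by simp_all
  have "\<exists>t\<in>V.low \<beta> l. v (V.zt \<beta> l) = v t" if "\<beta> \<in> M l" for \<beta> l
    using M(2)[of l] that by (auto simp: V.dep_def)
  then obtain tz where tz: "\<And>\<beta> l. \<beta> \<in> M l \<Longrightarrow> tz \<beta> l \<in> V.low \<beta> l" "\<And>\<beta> l. \<beta> \<in> M l \<Longrightarrow> v (V.zt \<beta> l) = v (tz \<beta> l)"
    by metis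
  define R1 :: "((nat, 'k, 'd) dterm \<times> (nat, 'k, 'd) dterm) set" where "R1 = (\<lambda>(i, j). (Der (bas i) (Var j), td i j)) ` ({..<h} \<times> {..<p})"
  define R2 :: "((nat, 'k, 'd) dterm \<times> (nat, 'k, 'd) dterm) set" where "R2 = (\<lambda>\<mu>. (xmon \<mu>, tx \<mu>)) ` Mx"
  define R3 :: "((nat, 'k, 'd) dterm \<times> (nat, 'k, 'd) dterm) set" where "R3 = (\<Union>l<q. (\<lambda>\<beta>. (V.zt \<beta> l, tz \<beta> l)) ` M l)"
  show thesis
  proof (rule that[of "R1 \<union> R2 \<union> R3"])
    show "finite (R1 \<union> R2 \<union> R3)" using Mx(1) M(1) by (simp add: R1_def R2_def R3_def)
    show "s \<in> dterms W \<and> t \<in> dterms W \<and> v s = v t" if "(s, t) \<in> R1 \<union> R2 \<union> R3" for s t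
      using that
    proof (elim UnE)
      assume "(s, t) \<in> R1"
      then obtain i j where "i < h" "j < p" "s = Der (bas i) (Var j)" "t = td i j" by (auto simp: R1_def)
      then show ?thesis using td pol_dterms[OF td(1)] by auto
    next
      assume "(s, t) \<in> R2"
      then obtain \<mu> where "\<mu> \<in> Mx" "s = xmon \<mu>" "t = tx \<mu>" by (auto simp: R2_def)
      then show ?thesis using tx(2) lowx_dterms[OF tx(1)] Mx(2) xmon_dterms by auto
    next
      assume "(s, t) \<in> R3"
      then obtain \<beta> l where "l < q" "\<beta> \<in> M l" "s = V.zt \<beta> l" "t = tz \<beta> l" by (auto simp: R3_def)
      then show ?thesis using tz(2) low_dterms[OF tz(1)] zt_dterms by auto
    qed
    show "\<exists>t\<in>V.pol 1. (Der (bas i) (Var j), t) \<in> R1 \<union> R2 \<union> R3" if "i < h" "j < p" for i j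
      using td(1)[OF that] that by (intro bexI[of _ "td i j"]) (auto simp: R1_def)
    show "\<exists>\<nu> t. \<nu> \<subseteq># \<mu> \<and> t \<in> V.lowx \<nu> \<and> (xmon \<nu>, t) \<in> R1 \<union> R2 \<union> R3"
      if "set_mset \<mu> \<subseteq> {..<p}" "V.depx \<mu>" for \<mu>
    proof -
      obtain \<nu> where "\<nu> \<in> Mx" "\<nu> \<subseteq># \<mu>" using Mx(3)[of \<mu>] \<open>set_mset \<mu> \<subseteq> {..<p}\<close> \<open>V.depx \<mu>\<close> by auto
      then show ?thesis using tx(1) by (intro exI[of _ \<nu>] exI[of _ "tx \<nu>"]) (auto simp: R2_def)
    qed
    show "\<exists>\<nu> t. \<nu> \<subseteq># \<beta> \<and> t \<in> V.low \<nu> l \<and> (V.zt \<nu> l, t) \<in> R1 \<union> R2 \<union> R3"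
      if "set_mset \<beta> \<subseteq> {..<h}" "l < q" "V.dep \<beta> l" for \<beta> l
    proof -
      obtain \<nu> where "\<nu> \<in> M l" "\<nu> \<subseteq># \<beta>" using M(3) \<open>set_mset \<beta> \<subseteq> {..<h}\<close> \<open>V.dep \<beta> l\<close> by blast
      then show ?thesis using tz(1) \<open>l < q\<close> by (intro exI[of _ \<nu>] exI[of _ "tz \<nu> l"]) (auto simp: R3_def)
    qed
  qed
qed

lemma kernel_D_ideal: "D_ideal {cls W t |t. t \<in> dterms W \<and> v t = 0} Fr"
proof -
  interpret F: cring Fr by (rule free_cring)
  let ?K = "{cls W t |t. t \<in> dterms W \<and> v t = 0}"
  have K: "cls W t \<in> ?K" if "t \<in> dterms W" "v t = 0" for t using that by blast
  have "ideal ?K Fr"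
  proof (rule idealI)
    show "ring Fr" by (rule F.ring_axioms)
    show "subgroup ?K (add_monoid Fr)"
    proof (rule group.subgroupI[OF F.a_group])
      show "?K \<subseteq> carrier (add_monoid Fr)" by (auto simp: free_carrier)
      show "?K \<noteq> {}" using K[of "Const 0"] by auto
      show "inv\<^bsub>add_monoid Fr\<^esub> X \<in> ?K" if X: "X \<in> ?K" for X
      proof -
        from X obtain t where t: "X = cls W t" "t \<in> dterms W" "v t = 0" by blast
        have "\<ominus>\<^bsub>Fr\<^esub> X \<in> ?K" unfolding t(1) free_neg[OF t(2)] by (rule K) (use t in auto)
        then show ?thesis by (simp add: a_inv_def)
      qed
      show "X \<otimes>\<^bsub>add_monoid Fr\<^esub> Y \<in> ?K" if XY: "X \<in> ?K" "Y \<in> ?K" for X Y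
      proof -
        obtain s t where "X = cls W s" "s \<in> dterms W" "v s = 0" "Y = cls W t" "t \<in> dterms W" "v t = 0"
          using XY by blast
        then show ?thesis using K[of "Plus s t"] by (simp add: free_ops)
      qed
    qed
    fix X Y assume "X \<in> ?K" "Y \<in> carrier Fr"
    then obtain s t where "X = cls W s" "s \<in> dterms W" "v s = 0" "Y = cls W t" "t \<in> dterms W"
      by (auto simp: free_carrier)
    then show "Y \<otimes>\<^bsub>Fr\<^esub> X \<in> ?K" "X \<otimes>\<^bsub>Fr\<^esub> Y \<in> ?K"
      using K[of "Times s t"] K[of "Times t s"] by (simp_all add: free_ops)
  qed
  moreover have "der Fr x X \<in> ?K" if "X \<in> ?K" for x X
  proof -
    from that obtain t where "X = cls W t" "t \<in> dterms W" "v t = 0" by blast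
    then show ?thesis using K[of "Der x t"] by (simp add: free_der D_0)
  qed
  ultimately show ?thesis by (simp add: D_ideal_def)
qed

text \<open>Two congruences are compared: \<open>\<pi>\<close>, modulo the chosen relations, and
  \<open>v\<close>, equality in the algebra. By \<open>\<pi>_val\<close> the first is contained in
  the second. Conversely, a term of value zero is brought to normal form modulo
  \<open>\<pi>\<close>, whose total coefficients vanish by the independence proved for
  \<open>v\<close>.\<close>

lemma finitely_presented: "D_finitely_presented (dalg_of_type sc D)"
proof -
  obtain Rel where Rel: "finite Rel" "\<And>s t. (s, t) \<in> Rel \<Longrightarrow> s \<in> dterms W \<and> t \<in> dterms W \<and> v s = v t"
    and Rel_der: "\<And>i j. i < h \<Longrightarrow> j < p \<Longrightarrow> \<exists>t\<in>V.pol 1. (Der (bas i) (Var j), t) \<in> Rel"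
    and Rel_x: "\<And>\<mu>. set_mset \<mu> \<subseteq> {..<p} \<Longrightarrow> V.depx \<mu> \<Longrightarrow>
      \<exists>\<nu> t. \<nu> \<subseteq># \<mu> \<and> t \<in> V.lowx \<nu> \<and> (xmon \<nu>, t) \<in> Rel"
    and Rel_z: "\<And>\<beta> l. set_mset \<beta> \<subseteq> {..<h} \<Longrightarrow> l < q \<Longrightarrow> V.dep \<beta> l \<Longrightarrow>
      \<exists>\<nu> t. \<nu> \<subseteq># \<beta> \<and> t \<in> V.low \<nu> l \<and> (V.zt \<nu> l, t) \<in> Rel"
    by (rule finite_relations) (rule that, assumption+)
  define G where "G = (\<lambda>(s, t). cls W (Plus s (Times (Const (- 1)) t))) ` Rel"
  define J where "J = D_genideal Fr G"
  have finG: "finite G" using Rel(1) by (simp add: G_def)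
  have GF: "G \<subseteq> carrier Fr" using Rel(2) by (auto simp: G_def free_carrier)
  note J = D_genideal_props[OF GF, folded J_def]
  interpret F: cring Fr by (rule free_cring)
  interpret J: ideal J Fr by (rule J(1))
  let ?c = "\<lambda>t. cls W (trunc (p + q) t)"
  have c_carrier: "?c t \<in> carrier Fr" for t using trunc_dterms by (auto simp: free_carrier)
  have c_ops: "?c (Plus s t) = ?c s \<oplus>\<^bsub>Fr\<^esub> ?c t" "?c (Times s t) = ?c s \<otimes>\<^bsub>Fr\<^esub> ?c t"
    "?c (Der x s) = der Fr x (?c s)" "?c (Const 1) = \<one>\<^bsub>Fr\<^esub>" for s t x
    by (simp_all add: free_ops free_der trunc_dterms free_const)
  \<comment> \<open>Cosets are attached to all terms, not only to those in the first
    \<open>p + q\<close> variables, so that \<open>\<pi>\<close> gives a congruence as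
    \<open>term_cong\<close> demands.\<close>
  define \<pi> where "\<pi> t = J +>\<^bsub>Fr\<^esub> ?c t" for t
  have \<pi>_plus: "\<pi> (Plus s t) = \<pi> s <+>\<^bsub>Fr\<^esub> \<pi> t" for s t
    unfolding \<pi>_def c_ops by (rule J.a_rcos_sum[symmetric]) (rule c_carrier)+
  have \<pi>_times: "\<pi> (Times s t) = rcoset_mult Fr J (\<pi> s) (\<pi> t)" for s t
    unfolding \<pi>_def c_ops by (rule J.rcoset_mult_add[symmetric]) (rule c_carrier)+
  have coset_der: "J +>\<^bsub>Fr\<^esub> der Fr x X = J +>\<^bsub>Fr\<^esub> der Fr x Y"
    if X: "X \<in> J +>\<^bsub>Fr\<^esub> Y" and Y: "Y \<in> carrier Fr" for x X Y
  proof -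
    from X obtain j where j: "j \<in> J" "X = j \<oplus>\<^bsub>Fr\<^esub> Y" by (auto simp: a_r_coset_def')
    obtain s t where st: "j = cls W s" "s \<in> dterms W" "Y = cls W t" "t \<in> dterms W"
      using J.a_Hcarr[OF j(1)] Y by (auto simp: free_carrier)
    have "der Fr x X = der Fr x j \<oplus>\<^bsub>Fr\<^esub> der Fr x Y"
      unfolding j(2) st using st(2,4) by (simp add: free_ops free_der cls_eq dterm_eq.Der_Plus)
    then have "der Fr x X \<in> J +>\<^bsub>Fr\<^esub> der Fr x Y"
      using J(2)[OF j(1), of x] by (auto simp: a_r_coset_def')
    moreover have "der Fr x Y \<in> carrier Fr" using st by (simp add: free_der free_carrier)
    ultimately show ?thesis using J.a_repr_independence' by metis
  qed
  have \<pi>_self: "?c t \<in> \<pi> t" for t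
    unfolding \<pi>_def by (rule J.a_rcos_self) (rule c_carrier)
  have \<pi>_der: "\<pi> (Der x s) = \<pi> (Der x t)" if "\<pi> s = \<pi> t" for s t x
    unfolding \<pi>_def c_ops
    using coset_der[of "?c s" "?c t" x] \<pi>_self[of s] that c_carrier by (simp add: \<pi>_def)
  have \<pi>_val: "v s = v t" if "\<pi> s = \<pi> t" for s t
  proof -
    \<comment> \<open>The kernel of evaluation is a differential ideal that contains
      \<open>G\<close>, hence contains \<open>J\<close>.\<close>
    have "G \<subseteq> {cls W t |t. t \<in> dterms W \<and> v t = 0}"
      using Rel(2) unfolding G_def by (fastforce simp: scale_one_mult)
    then have JK: "J \<subseteq> {cls W t |t. t \<in> dterms W \<and> v t = 0}" by (rule J(4)[OF kernel_D_ideal])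
    have "?c s \<in> J +>\<^bsub>Fr\<^esub> ?c t" using \<pi>_self[of s] that by (simp add: \<pi>_def)
    then obtain j where j: "j \<in> J" "?c s = j \<oplus>\<^bsub>Fr\<^esub> ?c t" by (auto simp: a_r_coset_def')
    obtain w where w: "j = cls W w" "w \<in> dterms W" "v w = 0" using JK j(1) by auto
    have "trunc (p + q) s \<approx> Plus w (trunc (p + q) t)"
      using j(2) w by (simp add: free_ops trunc_dterms cls_eq)
    from val_cong[OF this] show ?thesis using w(3) by (simp add: v_trunc)
  qed
  have Rel_\<pi>: "\<pi> s = \<pi> t" if "(s, t) \<in> Rel" for s t
  proof -
    let ?u = "Plus s (Times (Const (- 1)) t)"
    have st: "s \<in> dterms W" "t \<in> dterms W" using Rel(2)[OF that] by auto
    have uJ: "cls W ?u \<in> J" using J(3) that by (auto simp: G_def)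
    have "Plus ?u t \<approx> s"
      by (rule dterm_eq.trans[OF dterm_eq.Plus_assoc])
        (rule dterm_eq.trans[OF dterm_eq.cong_Plus[OF dterm_eq.refl dterm_eq.Plus_minus]],
         rule dterm_eq.trans[OF dterm_eq.Plus_commute dterm_eq.Plus_zero])
    then have "cls W s = cls W ?u \<oplus>\<^bsub>Fr\<^esub> cls W t"
      using st by (simp add: free_ops cls_eq dterm_eq.sym)
    then have "cls W s \<in> J +>\<^bsub>Fr\<^esub> cls W t" using uJ by (auto simp: a_r_coset_def')
    moreover have "cls W t \<in> carrier Fr" using st by (simp add: free_carrier)
    ultimately have "J +>\<^bsub>Fr\<^esub> cls W t = J +>\<^bsub>Fr\<^esub> cls W s" by (rule J.a_repr_independence')
    then show ?thesis using st by (simp add: \<pi>_def trunc_id)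
  qed
  interpret Q: term_cong scD br \<theta> "\<lambda>s t. \<pi> s = \<pi> t" p q bas h
  proof
    show "\<pi> s = \<pi> t" if "s \<approx> t" for s t
    proof -
      have "?c s = ?c t" using trunc_eq[OF that] by (simp add: cls_eq trunc_dterms)
      then show ?thesis by (simp add: \<pi>_def)
    qed
    show "\<pi> (Var j) = \<pi> (Const 0)" if "p + q \<le> j" for j using that by (simp add: \<pi>_def)
    show "\<pi> (Der x s) = \<pi> (Der x t)" if "\<pi> s = \<pi> t" for x s t by (rule \<pi>_der[OF that])
  qed (simp_all add: \<pi>_plus \<pi>_times bas)
  \<comment> \<open>\<open>V.pol\<close>, \<open>V.low\<close> and \<open>V.lowx\<close> are sets of
    terms that do not refer to a congruence, so memberships known for \<open>V\<close> can be used
    for \<open>Q\<close>.\<close>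
  interpret Q: der_term_cong scD br \<theta> "\<lambda>s t. \<pi> s = \<pi> t" p q bas h
  proof
    fix i j assume "i < h" "j < p"
    then obtain t where "t \<in> V.pol 1" "(Der (bas i) (Var j), t) \<in> Rel" using Rel_der by blast
    then show "\<exists>t\<in>V.pol 1. \<pi> (Der (bas i) (Var j)) = \<pi> t" using Rel_\<pi> by blast
  qed
  \<comment> \<open>\<open>N\<close> and \<open>I\<close> are defined by \<open>V\<close>. An index
    outside them lies above a minimal one whose relation is in \<open>Rel\<close>, and reducibility
    modulo \<open>Q\<close> is carried upwards by \<open>depx_add\<close> and
    \<open>dep_add\<close>.\<close>
  interpret Q: normal_form scD br \<theta> "\<lambda>s t. \<pi> s = \<pi> t" p q bas h N "\<Union>k. I k"
  proof
    fix \<mu> assume \<mu>: "set_mset \<mu> \<subseteq> {..<p}" "\<mu> \<notin> N"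
    then obtain \<nu> t where \<nu>: "\<nu> \<subseteq># \<mu>" "t \<in> V.lowx \<nu>" "(xmon \<nu>, t) \<in> Rel"
      using Rel_x[of \<mu>] by (auto simp: N_def)
    have \<nu>_dep: "Q.depx \<nu>" using \<nu>(2) Rel_\<pi>[OF \<nu>(3)] by (auto simp: Q.depx_def)
    have "set_mset \<rho> \<subseteq> {..<p} \<Longrightarrow> Q.depx (\<nu> + \<rho>)" for \<rho>
      by (induction \<rho>) (auto simp: \<nu>_dep intro: Q.depx_add)
    from this[of "\<mu> - \<nu>"] show "Q.depx \<mu>" using \<nu>(1) \<mu>(1) by (simp add: subset_eq) (meson in_diffD)
  next
    fix \<beta> l assume \<beta>: "set_mset \<beta> \<subseteq> {..<h}" "l < q" "(\<beta>, l) \<notin> (\<Union>k. I k)"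
    then obtain \<nu> t where \<nu>: "\<nu> \<subseteq># \<beta>" "t \<in> V.low \<nu> l" "(V.zt \<nu> l, t) \<in> Rel"
      using Rel_z[of \<beta> l] by (auto simp: I_def)
    have \<nu>_dep: "Q.dep \<nu> l" using \<nu>(2) Rel_\<pi>[OF \<nu>(3)] by (auto simp: Q.dep_def)
    have \<nu>h: "set_mset \<nu> \<subseteq> {..<h}" using set_mset_mono[OF \<nu>(1)] \<beta>(1) by blast
    have "set_mset \<rho> \<subseteq> {..<h} \<Longrightarrow> Q.dep (\<nu> + \<rho>) l" for \<rho>
      by (induction \<rho>) (use \<nu>_dep \<nu>h \<beta>(2) in \<open>auto intro!: Q.dep_add\<close>)
    from this[of "\<beta> - \<nu>"] show "Q.dep \<beta> l" using \<nu>(1) \<beta>(1) by (simp add: subset_eq) (meson in_diffD)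
  qed
  have complete: "\<pi> s = \<pi> t" if "v s = v t" for s t
  proof -
    let ?u = "Plus s (Times (Const (- 1)) t)"
    obtain L where L: "snd ` set L \<subseteq> Q.keys" "\<pi> ?u = \<pi> (lc Q.mon L)" by (rule Q.normal_form)
    have "v (lc Q.mon L) = v ?u" using \<pi>_val[OF L(2)] by simp
    also have "\<dots> = 0" using that by (simp add: scale_one_mult)
    finally have "csum k L = 0" for k
      using L(1) by (intro lc_independent) (auto simp: Q.keys_def Q.mon_def)
    then have "Q.nf (lc Q.mon L) = Q.cn 0" by (rule Q.lc_collapse)
    then have u0: "Q.nf ?u = Q.cn 0"
      using Q.cong_iff[THEN iffD1, OF L(2)] by (rule HOL.trans[rotated])
    have "Q.nf ?u = Q.pl s (Q.tm (Q.cn (- 1)) t)" by simp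
    with u0 have "Q.pl s (Q.tm (Q.cn (- 1)) t) = Q.cn 0" by (simp only:)
    then have "Q.pl (Q.pl s (Q.tm (Q.cn (- 1)) t)) t = Q.pl (Q.cn 0) t" by (simp only:)
    then have "Q.nf s = Q.nf t" by (simp only: Q.ring_rules(1) Q.const_rules(1,2,5))
    then show ?thesis by (rule Q.cong_iff[THEN iffD2])
  qed
  define B where "B = dalg_of_type sc D"
  \<comment> \<open>By \<open>complete\<close>, the choice among the terms with value
    \<open>b\<close> does not matter.\<close>
  define f where "f b = \<pi> (SOME t. v t = b)" for b
  have f: "f (v t) = \<pi> t" for t
    unfolding f_def by (rule complete) (rule someI[of "\<lambda>s. v s = v t" t], rule HOL.refl)
  let ?Q = "D_quot Fr J"
  have Q_ops: "carrier ?Q = carrier (Fr Quot J)" "\<pi> s \<otimes>\<^bsub>?Q\<^esub> \<pi> t = \<pi> (Times s t)"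
    "\<pi> s \<oplus>\<^bsub>?Q\<^esub> \<pi> t = \<pi> (Plus s t)" "\<one>\<^bsub>?Q\<^esub> = \<pi> (Const 1)" for s t
    by (simp_all add: D_quot_def FactRing_def \<pi>_times \<pi>_plus) (simp add: \<pi>_def c_ops(4)[simplified])
  have Q_car: "carrier ?Q = range \<pi>"
  proof -
    have "carrier ?Q = (\<lambda>X. J +>\<^bsub>Fr\<^esub> X) ` carrier Fr"
      by (auto simp: Q_ops(1) FactRing_def A_RCOSETS_def')
    also have "\<dots> = (\<lambda>t. J +>\<^bsub>Fr\<^esub> cls W t) ` dterms W" by (simp add: free_carrier image_image)
    also have "\<dots> = range \<pi>"
    proof
      show "(\<lambda>t. J +>\<^bsub>Fr\<^esub> cls W t) ` dterms W \<subseteq> range \<pi>"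
        by (auto simp: \<pi>_def trunc_id intro: range_eqI[of _ _ t for t]) (metis rangeI trunc_id)
      show "range \<pi> \<subseteq> (\<lambda>t. J +>\<^bsub>Fr\<^esub> cls W t) ` dterms W" by (auto simp: \<pi>_def trunc_dterms)
    qed
    finally show ?thesis .
  qed
  have Q_smult: "c \<odot>\<^bsub>?Q\<^esub> \<pi> t = \<pi> (Times (Const c) t)" for c t
  proof -
    have "J +>\<^bsub>Fr\<^esub> (c \<odot>\<^bsub>Fr\<^esub> X) = \<pi> (Times (Const c) t)" if X: "X \<in> \<pi> t" for X
    proof -
      obtain j where j: "j \<in> J" "X = j \<oplus>\<^bsub>Fr\<^esub> ?c t" using X by (auto simp: \<pi>_def a_r_coset_def')
      obtain s where s: "X = cls W s" "s \<in> dterms W"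
        using J.a_Hcarr[OF j(1)] j(2) c_carrier[of t] F.a_closed by (metis free_carrier imageE)
      have "\<pi> s = \<pi> t"
        using J.a_repr_independence'[OF X[unfolded \<pi>_def] c_carrier] s by (simp add: \<pi>_def trunc_id)
      then have "\<pi> (Times (Const c) s) = \<pi> (Times (Const c) t)" by (simp add: \<pi>_times)
      then show ?thesis using s by (simp add: \<pi>_def free_smult trunc_id)
    qed
    moreover have "c \<odot>\<^bsub>?Q\<^esub> \<pi> t = (\<Union>X\<in>\<pi> t. J +>\<^bsub>Fr\<^esub> (c \<odot>\<^bsub>Fr\<^esub> X))" by (simp add: D_quot_def)
    ultimately show ?thesis using \<pi>_self[of t] UN_const[of "\<pi> t"] by auto
  qed
  have Q_der: "der ?Q x (\<pi> t) = \<pi> (Der x t)" for x t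
  proof -
    have "J +>\<^bsub>Fr\<^esub> der Fr x X = \<pi> (Der x t)" if "X \<in> \<pi> t" for X
      using coset_der[OF that[unfolded \<pi>_def] c_carrier, of x] by (simp only: \<pi>_def c_ops)
    moreover have "der ?Q x (\<pi> t) = (\<Union>X\<in>\<pi> t. J +>\<^bsub>Fr\<^esub> der Fr x X)" by (simp add: D_quot_def)
    ultimately show ?thesis using \<pi>_self[of t] UN_const[of "\<pi> t"] by auto
  qed
  have vt: "\<exists>t. b = v t" for b using val_surj[of b] by metis
  have "f \<in> D_hom B ?Q"
    unfolding D_hom_def
  proof (intro CollectI conjI allI ballI)
    show "f \<in> ring_hom B ?Q"
    proof (rule ring_hom_memI)
      fix a b
      obtain s t where st: "a = v s" "b = v t" using vt[of a] vt[of b] by blast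
      show "f a \<in> carrier ?Q" by (simp add: Q_car st f)
      show "f (a \<otimes>\<^bsub>B\<^esub> b) = f a \<otimes>\<^bsub>?Q\<^esub> f b" using f[of "Times s t"] by (simp add: st f Q_ops B_def)
      show "f (a \<oplus>\<^bsub>B\<^esub> b) = f a \<oplus>\<^bsub>?Q\<^esub> f b" using f[of "Plus s t"] by (simp add: st f Q_ops B_def)
    next
      show "f \<one>\<^bsub>B\<^esub> = \<one>\<^bsub>?Q\<^esub>" using f[of "Const 1"] by (simp add: Q_ops B_def)
    qed
    fix a
    obtain s where s: "a = v s" using vt[of a] by blast
    show "f (c \<odot>\<^bsub>B\<^esub> a) = c \<odot>\<^bsub>?Q\<^esub> f a" for c
      using f[of "Times (Const c) s"] by (simp add: s f Q_smult B_def scale_one_mult)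
    show "f (der B x a) = der ?Q x (f a)" for x
      using f[of "Der x s"] by (simp add: s f Q_der B_def)
  qed
  moreover have "bij_betw f (carrier B) (carrier ?Q)"
    unfolding bij_betw_def
  proof
    show "inj_on f (carrier B)"
    proof (rule inj_onI)
      fix a b assume ab: "f a = f b"
      obtain s t where st: "a = v s" "b = v t" using vt[of a] vt[of b] by blast
      show "a = b" unfolding st by (rule \<pi>_val) (use ab in \<open>simp only: st f\<close>)
    qed
    have "UNIV = range v" using vt by blast
    then have "carrier B = range v" by (simp only: B_def dalg_of_type_sel)
    then show "f ` carrier B = carrier ?Q" by (simp add: f Q_car image_image)
  qed
  ultimately have "D_iso B ?Q \<noteq> {}" by (auto simp: D_iso_def)
  then show ?thesis
    unfolding D_finitely_presented_def Let_def using finG GF by (auto simp: J_def B_def)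
qed

end

theorem lemma6p3:
  fixes scD :: "'k::field_char_0 \<Rightarrow> 'd::ab_group_add \<Rightarrow> 'd"
    and br :: "'d \<Rightarrow> 'd \<Rightarrow> 'd"
    and \<theta> :: "'d \<Rightarrow> 'k \<Rightarrow> 'k"
    and scB :: "'k \<Rightarrow> 'b::comm_ring_1 \<Rightarrow> 'b"
    and derB :: "'d \<Rightarrow> 'b \<Rightarrow> 'b"
    and \<Delta> :: "'b \<Rightarrow> ('b \<times> 'b) list set"
    and \<epsilon> :: "'b \<Rightarrow> 'k"
    and antipode :: "'b \<Rightarrow> 'b"
  assumes "differential_field scD br \<theta>"
    and "D_Hopf_algebra scD br \<theta> (dalg_of_type scB derB) \<Delta> \<epsilon> antipode"
    and "D_finitely_generated (dalg_of_type scB derB)"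
  shows "differential_field.D_finitely_presented scD br \<theta> (dalg_of_type scB derB)"
proof -
  interpret differential_field scD br \<theta> by (rule assms(1))
  let ?B = "dalg_of_type scB derB"
  obtain bas :: "nat \<Rightarrow> 'd" and h where bas: "\<And>x. \<exists>c. x = (\<Sum>i<h. scD (c i) (bas i))"
    by (rule finite_spanning) (rule that)
  interpret H: dhopf scB "\<lambda>b. rep (\<Delta> b)" \<epsilon> antipode scD br \<theta> derB bas h
    by (rule dhopf_of_D_Hopf_algebra[OF assms(2) bas])
  obtain \<Sigma> where \<Sigma>: "finite \<Sigma>" "carrier ?B = generate_ring ?B
       ({c \<odot>\<^bsub>?B\<^esub> \<one>\<^bsub>?B\<^esub> | c. True} \<union> {foldr (der ?B) xs a | xs a. a \<in> \<Sigma>})"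
    using assms(3) unfolding D_finitely_generated_def by blast
  obtain XS LS where fin: "finite XS" "finite LS" and \<Sigma>X: "\<Sigma> \<subseteq> H.span XS"
    and X: "\<And>a. a \<in> XS \<Longrightarrow> H.in_tensor XS XS a" "\<And>a. a \<in> XS \<Longrightarrow> antipode a \<in> XS"
    and L: "\<And>l. l \<in> LS \<Longrightarrow> \<exists>u. set u \<subseteq> LS \<times> {a * b |a b. a \<in> XS \<and> b \<in> XS} \<and> H.repr l ((1, l) # u)"
      "\<And>l. l \<in> LS \<Longrightarrow> \<exists>u x. set u \<subseteq> XS \<times> XS \<and> antipode l = ev (\<lambda>a b. a * derB x b) u"
    and XD: "\<And>i a. i < h \<Longrightarrow> a \<in> XS \<Longrightarrow> \<exists>u c. set u \<subseteq> XS \<times> LS \<and> derB (bas i) a = scB c (ev (\<lambda>a l. a * l) u)"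
    by (rule H.hopf_generators[OF \<Sigma>(1)]) (rule that, assumption+)
  obtain xs ls where xs: "set xs = XS" and ls: "set ls = LS"
    using fin finite_list by metis
  define p q where "p = length xs" and "q = length ls"
  \<comment> \<open>Beyond the two lists the value is 0, as \<open>gen_0\<close> demands.\<close>
  define gen where "gen j = (if j < p then xs ! j else if j < p + q then ls ! (j - p) else 0)" for j
  have gx: "gen ` {..<p} = XS"
    using xs by (auto simp: gen_def p_def set_conv_nth image_def)
  have gl: "(\<lambda>l. gen (p + l)) ` {..<q} = LS"
    using ls by (auto simp: gen_def q_def set_conv_nth image_def)
  interpret G: generated_dhopf scB "\<lambda>b. rep (\<Delta> b)" \<epsilon> antipode scD br \<theta> derB bas h gen p q
  proof
    have "gen j \<in> XS" if "j < p" for j using that gx by blast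
    moreover have "gen (p + l) \<in> LS" if "l < q" for l using that gl by blast
    ultimately show "H.in_tensor (gen ` {..<p}) (gen ` {..<p}) (gen j)" "antipode (gen j) \<in> gen ` {..<p}"
      "i < h \<Longrightarrow> \<exists>u c. set u \<subseteq> gen ` {..<p} \<times> (\<lambda>l. gen (p + l)) ` {..<q} \<and>
        derB (bas i) (gen j) = scB c (ev (\<lambda>a l. a * l) u)" if "j < p" for i j
      unfolding gx gl using X XD that by blast+
    show "\<exists>u. set u \<subseteq> (\<lambda>l. gen (p + l)) ` {..<q} \<times>
        {a * b |a b. a \<in> gen ` {..<p} \<and> b \<in> gen ` {..<p}} \<and> H.repr (gen (p + l)) ((1, gen (p + l)) # u)"
      "\<exists>u x. set u \<subseteq> gen ` {..<p} \<times> gen ` {..<p} \<and> antipode (gen (p + l)) = ev (\<lambda>a b. a * derB x b) u"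
      if "l < q" for l
      unfolding gx gl using L gl that by blast+
    show "gen j = 0" if "p + q \<le> j" for j using that by (simp add: gen_def)
  qed
  interpret P: presented_dhopf scB "\<lambda>b. rep (\<Delta> b)" \<epsilon> antipode scD br \<theta> derB bas h gen p q
  proof
    have S: "a \<in> range G.v" if "a \<in> \<Sigma>" for a
    proof -
      have "a \<in> H.span XS" using that \<Sigma>X by blast
      then show ?thesis
      proof (induction rule: H.span_induct_alt)
        case base
        show ?case by (rule range_eqI[of _ _ "Const 0"]) simp
      next
        case (step c x y)
        then obtain j t where "x = gen j" "y = G.v t" using gx by auto
        then show ?case
          by (intro range_eqI[of _ _ "Plus (Times (Const c) (Var j)) t"]) (simp add: H.scale_one_mult)
      qed
    qed
    have SD: "foldr derB xs a \<in> range G.v" if "a \<in> \<Sigma>" for xs a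
    proof (induction xs)
      case (Cons x xs)
      then obtain t where "foldr derB xs a = G.v t" by blast
      then show ?case by (intro range_eqI[of _ _ "Der x t"]) simp
    qed (use S that in simp)
    fix b
    have "b \<in> carrier ?B" by simp
    then have "b \<in> generate_ring ?B ({c \<odot>\<^bsub>?B\<^esub> \<one>\<^bsub>?B\<^esub> | c. True} \<union> {foldr (der ?B) xs a | xs a. a \<in> \<Sigma>})"
      using \<Sigma>(2) by blast
    then have "b \<in> range G.v"
    proof induction
      case one
      show ?case by (rule range_eqI[of _ _ "Const 1"]) simp
    next
      case (incl b)
      then show ?case
      proof
        assume "b \<in> {c \<odot>\<^bsub>?B\<^esub> \<one>\<^bsub>?B\<^esub> | c. True}"
        then obtain c where "b = scB c 1" by auto
        then show ?thesis by (intro range_eqI[of _ _ "Const c"]) simp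
      qed (use SD in auto)
    next
      case (a_inv b)
      interpret D: D_Hopf_algebra scD br \<theta> ?B \<Delta> \<epsilon> antipode by (rule assms(2))
      \<comment> \<open>The additive inverse of the record is defined through its group structure
        and has to be identified with the negation of the type.\<close>
      have "abelian_group ?B"
        using D.D_algebra_B unfolding D_algebra_def algebra_def module_def by blast
      then have "\<ominus>\<^bsub>?B\<^esub> b \<oplus>\<^bsub>?B\<^esub> b = \<zero>\<^bsub>?B\<^esub>" by (rule abelian_group.l_neg) simp
      then have "\<ominus>\<^bsub>?B\<^esub> b = - b" by (simp add: eq_neg_iff_add_eq_0)
      moreover obtain t where "b = G.v t" using a_inv.IH by blast
      ultimately show ?case
        by (intro range_eqI[of _ _ "Times (Const (- 1)) t"]) (simp add: H.scale_one_mult)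
    next
      case (eng_add a b)
      then obtain s t where "a = G.v s" "b = G.v t" by blast
      then show ?case by (intro range_eqI[of _ _ "Plus s t"]) simp
    next
      case (eng_mult a b)
      then obtain s t where "a = G.v s" "b = G.v t" by blast
      then show ?case by (intro range_eqI[of _ _ "Times s t"]) simp
    qed
    then show "\<exists>t. G.v t = b" by blast
  qed
  show ?thesis by (rule P.finitely_presented)
qed

end
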